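(* Let $M$ be a supertorus of dimension $m|n$, with $\mathrm H^0(M,\mathcal O_M)$ regarded as a $\mathbb C$-subalgebra of the exterior algebra $E$ on the generators $\alpha_{ij}$ ($1\le i\le m$, $1\le j\le n$) and $\theta_1,\dots,\theta_n$. For a multiset $N=\{1^{\nu_1},\dots,n^{\nu_n}\}$ of size $m+1$ of elements of $\{1,\dots,n\}$ put $$q_N=\nu_1!\cdots\nu_n!\sum_{\{i_1,\dots,i_m,j\}=N}\alpha_{1i_1}\cdots\alpha_{mi_m}\theta_j,$$ where the sum is over all distinct orderings $(i_1,\dots,i_m,j)$ of the multiset $N$. Then: (i) $\mathrm H^0(M,\mathcal O_M)$ is generated as a $\mathbb C$-algebra by the $\alpha_{ij}$ and the $q_N$, where $N$ runs over all $(m+1)$-multisets of $\{1,\dots,n\}$. (ii) The following relations among these generators hold and generate all relations among them: - for each $1\le i\le m$ and each $(m+2)$-multiset $N$ of $\{1,\dots,n\}$, $$\sum_{j\in N}\alpha_{ij}\,q_{N\setminus\{j\}}=0;$$ - for all multisets $N_1,N_2$ of $\{1,\dots,n\}$ of sizes $m$ and $m+2$ respectively, $$\sum_{j\in N_2}q_{N_1\cup\{j\}}\,q_{N_2\setminus\{j\}}=0.$$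
   Context: Supertorus. Let $\Lambda$ be the exterior $\mathbb C$-algebra freely generated by odd symbols $\alpha_{ij}$ ($1\le i\le m$, $1\le j\le n$), and $E$ the exterior $\mathbb C$-algebra freely generated by all $\alpha_{ij}$ and $\theta_1,\dots,\theta_n$. Choose $\tau_{ij}\in\mathbb C$ ($1\le i,j\le m$) with $\det(\mathrm{Im}\,\tau_{ij})\ne 0$. $\mathbb C^{m|n}$ (over $\Lambda$) has underlying space $\mathbb C^m$ and structure sheaf $\mathcal O_{\mathbb C^m}\otimes_{\mathbb C}E$ (holomorphic functions). The free abelian group $G$ on $S_1,\dots,S_m,T_1,\dots,T_m$ acts by $S_i: z_i\mapsto z_i+1$ (other coordinates fixed) and $T_i: z_k\mapsto z_k+\tau_{ik},\ \theta_j\mapsto\theta_j+\alpha_{ij}$, fixing all $\alpha_{kl}$. The supertorus is $M=\mathbb C^{m|n}/G$ with $\mathcal O_M=(\pi_*\mathcal O_{\mathbb C^{m|n}})^G$, $\pi$ the quotient map. Global sections of $\mathcal O_M$ are independent of $z$, and $\mathrm H^0(M,\mathcal O_M)$ is the subalgebra of $E$ consisting of the elements killed by all $X_{i,m+1}=\sum_{k=1}^n\alpha_{ik}\,\partial/\partial\theta_k$, $1\le i\le m$ (equivalently the elements invariant under the algebra automorphisms $\theta_j\mapsto\theta_j+\alpha_{ij}$, $\alpha_{kl}\mapsto\alpha_{kl}$). Conventions. Sums $\sum_{j\in N}$ over a multiset are taken with multiplicity ($j$ occurs $\nu_j$ times); $N_1\cup\{j\}$ increases the multiplicity of $j$ by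 one and $N\setminus\{j\}$ decreases it by one. "Generate all relations" is meant for supercommutative algebras: the $\alpha_{ij}$ are odd and each $q_N$ has parity $m+1$, and the kernel of the surjection from the free supercommutative $\mathbb C$-algebra on symbols $\alpha_{ij}$, $q_N$, namely $\bigwedge^\bullet\langle\alpha_{ij}\rangle\otimes\bigwedge^\bullet\langle q_N\rangle$ if $m$ is even and $\bigwedge^\bullet\langle\alpha_{ij}\rangle\otimes \mathrm{Sym}^\bullet\langle q_N\rangle$ if $m$ is odd, onto $\mathrm H^0(M,\mathcal O_M)$ is the ideal generated by the left-hand sides of the listed relations. *)

theory Defs
  imports
    "HOL-Library.Multiset"
    "HOL-Library.FuncSet"
    "HOL-Library.Countable"
    "HOL-Combinatorics.Multiset_Permutations"
    "HOL-Analysis.Function_Topology"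
    "HOL-Analysis.Complex_Analysis_Basics"
    "HOL-Algebra.Generated_Rings"
    "HOL-Algebra.Ideal"
    "Jordan_Normal_Form.Determinant"
begin

section \<open>Free supercommutative algebras over the complex numbers\<close>

text \<open>
  The free supercommutative algebra on a set of letters, each of them even or odd, is the tensor
  product of the exterior algebra on the odd letters and the symmetric algebra on the even ones.
  It is modelled on its monomial basis: a basis monomial is a finite multiset of letters in which
  no odd letter is repeated, and it stands for the product of its letters in increasing order.
  The linear order on the letters only serves to fix the signs of the basis monomials.
\<close>

class superletter = linorder +
  fixes odd_letter :: "'a \<Rightarrow> bool"

definition sc_monomial :: "'g::superletter multiset \<Rightarrow> bool" where
  "sc_monomial M \<longleftrightarrow> (\<forall>x. odd_letter x \<longrightarrow> count M x \<le> 1)"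

text \<open>The sign picked up by the odd letters when the concatenation of two monomials is sorted.\<close>

definition koszul_sign :: "'g::superletter multiset \<Rightarrow> 'g multiset \<Rightarrow> complex" where
  "koszul_sign A B =
     (\<Prod>a\<in>#A. \<Prod>b\<in>#B. if odd_letter a \<and> odd_letter b \<and> b < a then -1 else 1)"

lemma koszul_sign_add_left: "koszul_sign (A + B) C = koszul_sign A C * koszul_sign B C"
  by (simp add: koszul_sign_def)

lemma koszul_sign_add_right: "koszul_sign A (B + C) = koszul_sign A B * koszul_sign A C"
  by (simp add: koszul_sign_def prod_mset.distrib)

lemma koszul_sign_empty [simp]: "koszul_sign {#} B = 1" "koszul_sign A {#} = 1"
  by (simp_all add: koszul_sign_def)

lemma sc_monomial_empty [simp]: "sc_monomial {#}"
  by (simp add: sc_monomial_def)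

lemma sc_monomial_single [simp]: "sc_monomial {#x#}"
  by (simp add: sc_monomial_def)

lemma sc_monomial_addD:
  assumes "sc_monomial (A + B)"
  shows "sc_monomial A" "sc_monomial B"
  using assms unfolding sc_monomial_def by (fastforce)+

typedef (overloaded) 'g supercomm =
  "{f :: 'g::superletter multiset \<Rightarrow> complex.
      finite {M. f M \<noteq> 0} \<and> (\<forall>M. f M \<noteq> 0 \<longrightarrow> sc_monomial M)}"
  morphisms sc_coeff Abs_supercomm
  by (rule exI[of _ "\<lambda>_. 0"]) simp

setup_lifting type_definition_supercomm

definition splittings :: "'a multiset \<Rightarrow> ('a multiset \<times> 'a multiset) set" where
  "splittings M = {(A, B). A + B = M}"

lemma splittings_empty [simp]: "splittings {#} = {({#}, {#})}"
  by (auto simp: splittings_def)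

lemma finite_splittings [simp]: "finite (splittings M)"
proof -
  have fin: "finite {A. A \<subseteq># M}"
  proof (induction M)
    case (add x M)
    have "{A. A \<subseteq># add_mset x M} \<subseteq> {A. A \<subseteq># M} \<union> add_mset x ` {A. A \<subseteq># M}"
    proof
      fix A assume "A \<in> {A. A \<subseteq># add_mset x M}"
      then have A: "A \<subseteq># add_mset x M" by simp
      show "A \<in> {A. A \<subseteq># M} \<union> add_mset x ` {A. A \<subseteq># M}"
      proof (cases "x \<in># A")
        case True
        then obtain A' where "A = add_mset x A'" by (metis insert_DiffM)
        with A show ?thesis by auto
      next
        case False
        have "count A y \<le> count M y" for y
          using mset_subset_eq_count[OF A, of y] False by (cases "y = x") (auto simp: not_in_iff)
        then have "A \<subseteq># M" by (rule mset_subset_eqI)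
        then show ?thesis by simp
      qed
    qed
    with add show ?case by (meson finite_Un finite_imageI finite_subset)
  qed simp
  have "splittings M \<subseteq> (\<lambda>A. (A, M - A)) ` {A. A \<subseteq># M}"
    by (auto simp: splittings_def image_iff)
  with fin show ?thesis by (meson finite_imageI finite_subset)
qed

instantiation supercomm :: (superletter) ring_1
begin

lift_definition zero_supercomm :: "'a supercomm" is "\<lambda>_. 0" by simp

lift_definition one_supercomm :: "'a supercomm" is "\<lambda>M. if M = {#} then 1 else 0" by simp

lift_definition plus_supercomm :: "'a supercomm \<Rightarrow> 'a supercomm \<Rightarrow> 'a supercomm"
  is "\<lambda>f g M. f M + g M"
proof -
  fix f g :: "'a multiset \<Rightarrow> complex"
  assume *: "finite {M. f M \<noteq> 0} \<and> (\<forall>M. f M \<noteq> 0 \<longrightarrow> sc_monomial M)"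
    "finite {M. g M \<noteq> 0} \<and> (\<forall>M. g M \<noteq> 0 \<longrightarrow> sc_monomial M)"
  have "{M. f M + g M \<noteq> 0} \<subseteq> {M. f M \<noteq> 0} \<union> {M. g M \<noteq> 0}" by auto
  then have "finite {M. f M + g M \<noteq> 0}"
    by (rule finite_subset) (use * in simp)
  moreover have "sc_monomial M" if "f M + g M \<noteq> 0" for M
  proof -
    have "f M \<noteq> 0 \<or> g M \<noteq> 0" using that by auto
    with * show ?thesis by blast
  qed
  ultimately show "finite {M. f M + g M \<noteq> 0} \<and> (\<forall>M. f M + g M \<noteq> 0 \<longrightarrow> sc_monomial M)"
    by blast
qed

lift_definition uminus_supercomm :: "'a supercomm \<Rightarrow> 'a supercomm" is "\<lambda>f M. - f M" by simp

definition minus_supercomm :: "'a supercomm \<Rightarrow> 'a supercomm \<Rightarrow> 'a supercomm" where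
  "minus_supercomm f g = f + (- g)"

lift_definition times_supercomm :: "'a supercomm \<Rightarrow> 'a supercomm \<Rightarrow> 'a supercomm"
  is "\<lambda>f g M. if sc_monomial M
              then (\<Sum>(A, B)\<in>splittings M. koszul_sign A B * f A * g B) else 0"
proof -
  fix f g :: "'a multiset \<Rightarrow> complex"
  assume *: "finite {M. f M \<noteq> 0} \<and> (\<forall>M. f M \<noteq> 0 \<longrightarrow> sc_monomial M)"
    "finite {M. g M \<noteq> 0} \<and> (\<forall>M. g M \<noteq> 0 \<longrightarrow> sc_monomial M)"
  let ?h = "\<lambda>M. if sc_monomial M
              then (\<Sum>(A, B)\<in>splittings M. koszul_sign A B * f A * g B) else 0"
  have "{M. ?h M \<noteq> 0} \<subseteq> (\<lambda>(A, B). A + B) ` ({M. f M \<noteq> 0} \<times> {M. g M \<noteq> 0})"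
  proof
    fix M assume "M \<in> {M. ?h M \<noteq> 0}"
    then have "(\<Sum>(A, B)\<in>splittings M. koszul_sign A B * f A * g B) \<noteq> 0"
      by (cases "sc_monomial M") simp_all
    then obtain p where "p \<in> splittings M" "(case p of (A, B) \<Rightarrow> koszul_sign A B * f A * g B) \<noteq> 0"
      by (meson sum.not_neutral_contains_not_neutral)
    then show "M \<in> (\<lambda>(A, B). A + B) ` ({M. f M \<noteq> 0} \<times> {M. g M \<noteq> 0})"
      by (auto simp: splittings_def)
  qed
  then have "finite {M. ?h M \<noteq> 0}"
    by (rule finite_subset) (use * in simp)
  then show "finite {M. ?h M \<noteq> 0} \<and> (\<forall>M. ?h M \<noteq> 0 \<longrightarrow> sc_monomial M)"
    by simp
qed

instance
proof
  fix a b c :: "'a supercomm"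
  show "a + b + c = a + (b + c)" by transfer (simp add: add.assoc)
  show "a + b = b + a" by transfer (simp add: add.commute)
  show "0 + a = a" by transfer simp
  show "- a + a = 0" by transfer simp
  show "a - b = a + - b" by (simp add: minus_supercomm_def)
  show "(a + b) * c = a * c + b * c"
    by transfer (simp add: fun_eq_iff distrib_left distrib_right case_prod_unfold sum.distrib)
  show "a * (b + c) = a * b + a * c"
    by transfer (simp add: fun_eq_iff distrib_left distrib_right case_prod_unfold sum.distrib)
  show "(0::'a supercomm) \<noteq> 1"
    by transfer (auto simp: fun_eq_iff)
  show "1 * a = a"
  proof (transfer, rule ext)
    fix f :: "'a multiset \<Rightarrow> complex" and M
    assume *: "finite {M. f M \<noteq> 0} \<and> (\<forall>M. f M \<noteq> 0 \<longrightarrow> sc_monomial M)"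
    have "(\<Sum>(A, B)\<in>splittings M. koszul_sign A B * (if A = {#} then 1 else 0) * f B)
        = (\<Sum>p\<in>{({#}, M)}. case p of (A, B) \<Rightarrow>
             koszul_sign A B * (if A = {#} then 1 else 0) * f B)"
      by (rule sum.mono_neutral_right, rule finite_splittings)
        (auto simp: splittings_def split: if_splits)
    with * show "(if sc_monomial M then \<Sum>(A, B)\<in>splittings M.
        koszul_sign A B * (if A = {#} then 1 else 0) * f B else 0) = f M" by auto
  qed
  show "a * 1 = a"
  proof (transfer, rule ext)
    fix f :: "'a multiset \<Rightarrow> complex" and M
    assume *: "finite {M. f M \<noteq> 0} \<and> (\<forall>M. f M \<noteq> 0 \<longrightarrow> sc_monomial M)"
    have "(\<Sum>(A, B)\<in>splittings M. koszul_sign A B * f A * (if B = {#} then 1 else 0))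
        = (\<Sum>p\<in>{(M, {#})}. case p of (A, B) \<Rightarrow>
             koszul_sign A B * f A * (if B = {#} then 1 else 0))"
      by (rule sum.mono_neutral_right, rule finite_splittings)
        (auto simp: splittings_def split: if_splits)
    with * show "(if sc_monomial M then \<Sum>(A, B)\<in>splittings M.
        koszul_sign A B * f A * (if B = {#} then 1 else 0) else 0) = f M" by auto
  qed
  show "a * b * c = a * (b * c)"
  proof (transfer, rule ext)
    fix f g h :: "'a multiset \<Rightarrow> complex" and M
    let ?fg = "\<lambda>M. if sc_monomial M
              then (\<Sum>(A, B)\<in>splittings M. koszul_sign A B * f A * g B) else 0"
    let ?gh = "\<lambda>M. if sc_monomial M
              then (\<Sum>(A, B)\<in>splittings M. koszul_sign A B * g A * h B) else 0"
    show "(if sc_monomial M then \<Sum>(D, C)\<in>splittings M. koszul_sign D C * ?fg D * h C else 0)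
        = (if sc_monomial M then \<Sum>(A, D)\<in>splittings M. koszul_sign A D * f A * ?gh D else 0)"
    proof (cases "sc_monomial M")
      case True
      have mono: "sc_monomial A \<and> sc_monomial B" if "(A, B) \<in> splittings M" for A B
        using True that sc_monomial_addD[of A B] by (auto simp: splittings_def)
      let ?w = "\<lambda>A B C. koszul_sign A B * koszul_sign A C * koszul_sign B C * f A * g B * h C"
      have "(\<Sum>(D, C)\<in>splittings M. koszul_sign D C * ?fg D * h C)
          = (\<Sum>p\<in>splittings M. \<Sum>q\<in>splittings (fst p). ?w (fst q) (snd q) (snd p))"
      proof (rule sum.cong[OF refl])
        fix p assume p: "p \<in> splittings M"
        have "(case p of (D, C) \<Rightarrow> koszul_sign D C * ?fg D * h C)
            = (\<Sum>q\<in>splittings (fst p). koszul_sign (fst p) (snd p)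
                 * (koszul_sign (fst q) (snd q) * f (fst q) * g (snd q)) * h (snd p))"
          using mono[of "fst p" "snd p"] p
          by (simp add: split_def sum_distrib_left sum_distrib_right)
        also have "\<dots> = (\<Sum>q\<in>splittings (fst p). ?w (fst q) (snd q) (snd p))"
        proof (rule sum.cong[OF refl])
          fix q assume "q \<in> splittings (fst p)"
          then have "fst p = fst q + snd q" by (auto simp: splittings_def)
          then show "koszul_sign (fst p) (snd p)
                 * (koszul_sign (fst q) (snd q) * f (fst q) * g (snd q)) * h (snd p)
              = ?w (fst q) (snd q) (snd p)" by (simp add: koszul_sign_add_left)
        qed
        finally show "(case p of (D, C) \<Rightarrow> koszul_sign D C * ?fg D * h C)
            = (\<Sum>q\<in>splittings (fst p). ?w (fst q) (snd q) (snd p))" .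
      qed
      also have "\<dots> = (\<Sum>(p, q)\<in>Sigma (splittings M) (\<lambda>p. splittings (fst p)).
          ?w (fst q) (snd q) (snd p))"
        by (rule sum.Sigma) auto
      also have "\<dots> = (\<Sum>(p, q)\<in>Sigma (splittings M) (\<lambda>p. splittings (snd p)).
          ?w (fst p) (fst q) (snd q))"
        by (rule sum.reindex_bij_witness[where
              j = "\<lambda>(p, q). ((fst q, snd q + snd p), (snd q, snd p))" and
              i = "\<lambda>(p, q). ((fst p + fst q, snd q), (fst p, fst q))"])
           (auto simp: splittings_def add.assoc)
      also have "\<dots> = (\<Sum>p\<in>splittings M. \<Sum>q\<in>splittings (snd p). ?w (fst p) (fst q) (snd q))"
        by (rule sum.Sigma[symmetric]) auto
      also have "\<dots> = (\<Sum>(A, D)\<in>splittings M. koszul_sign A D * f A * ?gh D)"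
      proof (rule sum.cong[OF refl])
        fix p assume p: "p \<in> splittings M"
        have "(case p of (A, D) \<Rightarrow> koszul_sign A D * f A * ?gh D)
            = (\<Sum>q\<in>splittings (snd p). koszul_sign (fst p) (snd p)
                 * f (fst p) * (koszul_sign (fst q) (snd q) * g (fst q) * h (snd q)))"
          using mono[of "fst p" "snd p"] p
          by (simp add: split_def sum_distrib_left sum_distrib_right)
        also have "\<dots> = (\<Sum>q\<in>splittings (snd p). ?w (fst p) (fst q) (snd q))"
        proof (rule sum.cong[OF refl])
          fix q assume "q \<in> splittings (snd p)"
          then have "snd p = fst q + snd q" by (auto simp: splittings_def)
          then show "koszul_sign (fst p) (snd p)
                 * f (fst p) * (koszul_sign (fst q) (snd q) * g (fst q) * h (snd q))
              = ?w (fst p) (fst q) (snd q)" by (simp add: koszul_sign_add_right)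
        qed
        finally show "(\<Sum>q\<in>splittings (snd p). ?w (fst p) (fst q) (snd q))
            = (case p of (A, D) \<Rightarrow> koszul_sign A D * f A * ?gh D)" by simp
      qed
      finally show ?thesis using True by simp
    qed simp
  qed
qed

end

lift_definition sc_scalar :: "complex \<Rightarrow> 'g::superletter supercomm"
  is "\<lambda>c M. if M = {#} then c else 0" by simp

lift_definition sc_letter :: "'g::superletter \<Rightarrow> 'g supercomm"
  is "\<lambda>x M. if M = {#x#} then 1 else 0" by simp

lemma sc_coeff_times:
  "sc_coeff (f * g) M = (if sc_monomial M
     then (\<Sum>(A, B)\<in>splittings M. koszul_sign A B * sc_coeff f A * sc_coeff g B) else 0)"
  by transfer simp

lemma sc_letter_mult_coeff:
  "sc_coeff (sc_letter x * sc_letter y) M =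
     (if M = {#x, y#} \<and> sc_monomial M then koszul_sign {#x#} {#y#} else 0)"
proof -
  have "(\<Sum>(A, B)\<in>splittings M. koszul_sign A B * sc_coeff (sc_letter x) A * sc_coeff (sc_letter y) B)
      = (\<Sum>(A, B)\<in>splittings M \<inter> {({#x#}, {#y#})}.
           koszul_sign A B * sc_coeff (sc_letter x) A * sc_coeff (sc_letter y) B)"
    by (rule sum.mono_neutral_right) (auto simp: sc_letter.rep_eq split: if_splits)
  also have "\<dots> = (if M = {#x, y#} then koszul_sign {#x#} {#y#} else 0)"
    by (cases "M = {#x, y#}") (auto simp: splittings_def sc_letter.rep_eq)
  finally show ?thesis unfolding sc_coeff_times by auto
qed

lemma sc_letter_supercommute:
  "sc_letter x * sc_letter y =
     (if odd_letter x \<and> odd_letter y then - (sc_letter y * sc_letter x)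
      else sc_letter y * sc_letter x)"
proof -
  have "sc_coeff (sc_letter x * sc_letter y) M =
      (if odd_letter x \<and> odd_letter y then - sc_coeff (sc_letter y * sc_letter x) M
      else sc_coeff (sc_letter y * sc_letter x) M)" for M
    using less_linear[of x y]
    by (auto simp: sc_letter_mult_coeff koszul_sign_def sc_monomial_def add_mset_commute)
  then show ?thesis
    by (auto simp: sc_coeff_inject[symmetric] fun_eq_iff uminus_supercomm.rep_eq)
qed

lemma prod_list_sorted_letters:
  assumes "sc_monomial M"
  shows "sc_coeff (prod_list (map sc_letter (sorted_list_of_multiset M))) =
           (\<lambda>K. if K = M then 1 else 0)"
proof -
  have "sorted xs \<Longrightarrow> sc_monomial (mset xs) \<Longrightarrow>
      sc_coeff (prod_list (map sc_letter xs)) = (\<lambda>K. if K = mset xs then 1 else 0)"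
    for xs :: "'a list"
  proof (induction xs)
    case Nil
    then show ?case by (simp add: one_supercomm.rep_eq)
  next
    case (Cons x xs)
    have "sc_monomial ({#x#} + mset xs)" using Cons.prems by simp
    then have "sc_monomial (mset xs)" by (rule sc_monomial_addD)
    then have IH: "sc_coeff (prod_list (map sc_letter xs)) = (\<lambda>K. if K = mset xs then 1 else 0)"
      using Cons.IH Cons.prems(1) by simp
    have "koszul_sign {#x#} (mset xs) =
        (\<Prod>b\<in>#mset xs. if odd_letter x \<and> odd_letter b \<and> b < x then -1 else 1)"
      by (simp add: koszul_sign_def)
    also have "\<dots> = (\<Prod>b\<in>#mset xs. 1)"
      using Cons.prems by (intro arg_cong[where f = prod_mset] image_mset_cong) auto
    finally have sgn: "koszul_sign {#x#} (mset xs) = 1" by simp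
    show ?case
    proof
      fix K
      have "(\<Sum>(A, B)\<in>splittings K. koszul_sign A B * sc_coeff (sc_letter x) A
               * (if B = mset xs then 1 else 0))
          = (\<Sum>(A, B)\<in>splittings K \<inter> {({#x#}, mset xs)}. koszul_sign A B
               * sc_coeff (sc_letter x) A * (if B = mset xs then 1 else 0))"
        by (rule sum.mono_neutral_right) (auto simp: sc_letter.rep_eq split: if_splits)
      also have "\<dots> = (if K = mset (x # xs) then 1 else 0)"
        by (cases "K = mset (x # xs)") (auto simp: splittings_def sc_letter.rep_eq sgn)
      finally show "sc_coeff (prod_list (map sc_letter (x # xs))) K =
          (if K = mset (x # xs) then 1 else 0)"
        using Cons.prems by (auto simp: sc_coeff_times IH)
    qed
  qed
  from this[of "sorted_list_of_multiset M"] assms show ?thesis by simp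
qed

definition free_supercomm :: "'g::superletter set \<Rightarrow> 'g supercomm ring" where
  "free_supercomm L =
     \<lparr>carrier = {f. \<forall>M. sc_coeff f M \<noteq> 0 \<longrightarrow> set_mset M \<subseteq> L},
      mult = (*), one = 1, zero = 0, add = (+)\<rparr>"

lemma ring_free_supercomm: "ring (free_supercomm L)"
proof (rule ringI)
  let ?C = "{f. \<forall>M. sc_coeff f M \<noteq> 0 \<longrightarrow> set_mset M \<subseteq> L}"
  have add: "f + g \<in> ?C" if "f \<in> ?C" "g \<in> ?C" for f g
  proof (clarify)
    fix M x assume "sc_coeff (f + g) M \<noteq> 0" and x: "x \<in># M"
    then have "sc_coeff f M \<noteq> 0 \<or> sc_coeff g M \<noteq> 0" by (auto simp: plus_supercomm.rep_eq)
    then show "x \<in> L" using that x by auto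
  qed
  have uminus: "- f \<in> ?C" if "f \<in> ?C" for f
    using that by (simp add: uminus_supercomm.rep_eq)
  have mult: "f * g \<in> ?C" if fg: "f \<in> ?C" "g \<in> ?C" for f g
  proof (clarify)
    fix M x assume M: "sc_coeff (f * g) M \<noteq> 0" and x: "x \<in># M"
    then have "(\<Sum>(A, B)\<in>splittings M. koszul_sign A B * sc_coeff f A * sc_coeff g B) \<noteq> 0"
      unfolding sc_coeff_times by meson
    then obtain p where p: "p \<in> splittings M"
      "(case p of (A, B) \<Rightarrow> koszul_sign A B * sc_coeff f A * sc_coeff g B) \<noteq> 0"
      by (meson sum.not_neutral_contains_not_neutral)
    then have M_eq: "M = fst p + snd p"
      and "sc_coeff f (fst p) \<noteq> 0" "sc_coeff g (snd p) \<noteq> 0"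
      by (auto simp: splittings_def)
    then have "set_mset (fst p) \<subseteq> L" "set_mset (snd p) \<subseteq> L" using fg by simp_all
    then show "x \<in> L" using M_eq x by auto
  qed
  have carrier: "carrier (free_supercomm L) = ?C" by (simp add: free_supercomm_def)
  have ops: "f \<otimes>\<^bsub>free_supercomm L\<^esub> g = f * g" "f \<oplus>\<^bsub>free_supercomm L\<^esub> g = f + g"
    "\<one>\<^bsub>free_supercomm L\<^esub> = 1" "\<zero>\<^bsub>free_supercomm L\<^esub> = 0" for f g
    by (simp_all add: free_supercomm_def)
  have zero: "0 \<in> ?C" by (simp add: zero_supercomm.rep_eq)
  have one: "1 \<in> ?C" by (simp add: one_supercomm.rep_eq)
  show "abelian_group (free_supercomm L)"
  proof (rule abelian_groupI, unfold carrier ops)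
    show "\<exists>g\<in>?C. g + f = 0" if "f \<in> ?C" for f
      using uminus[OF that] by (rule rev_bexI) (rule left_minus)
  qed (erule (1) add | rule zero add.assoc add.commute add_0_left)+
  show "monoid (free_supercomm L)"
    by (rule monoidI, unfold carrier ops) (erule (1) mult | rule one mult.assoc mult_1_left mult_1_right)+
qed (simp_all add: free_supercomm_def distrib_left distrib_right)

text \<open>
  The algebra homomorphism with prescribed values on the letters; the values have to respect the
  parity of the letters.
\<close>

definition sc_subst ::
  "('g::superletter \<Rightarrow> 'h::superletter supercomm) \<Rightarrow> 'g supercomm \<Rightarrow> 'h supercomm" where
  "sc_subst \<phi> f = (\<Sum>M | sc_coeff f M \<noteq> 0.
     sc_scalar (sc_coeff f M) * prod_list (map \<phi> (sorted_list_of_multiset M)))"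


section \<open>The supertorus\<close>

text \<open>All indices start at 0: rows \<open>i < m\<close>, columns \<open>j < n\<close>.\<close>

datatype torus_letter = Alpha nat nat | Theta nat

instantiation torus_letter :: superletter
begin

fun code_torus_letter :: "torus_letter \<Rightarrow> nat" where
  "code_torus_letter (Alpha i j) = 2 * to_nat (i, j)"
| "code_torus_letter (Theta j) = Suc (2 * j)"

definition less_eq_torus_letter :: "torus_letter \<Rightarrow> torus_letter \<Rightarrow> bool" where
  "x \<le> y \<longleftrightarrow> code_torus_letter x \<le> code_torus_letter y"

definition less_torus_letter :: "torus_letter \<Rightarrow> torus_letter \<Rightarrow> bool" where
  "x < y \<longleftrightarrow> code_torus_letter x < code_torus_letter y"

definition odd_letter_torus_letter :: "torus_letter \<Rightarrow> bool" where
  "odd_letter (x :: torus_letter) \<longleftrightarrow> True"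

lemma code_torus_letter_inject: "code_torus_letter x = code_torus_letter y \<Longrightarrow> x = y"
  by (cases x; cases y) (auto dest: arg_cong[where f = even])

instance
  by standard
    (auto simp: less_eq_torus_letter_def less_torus_letter_def intro: code_torus_letter_inject)

end

definition torus_letters :: "nat \<Rightarrow> nat \<Rightarrow> torus_letter set" where
  "torus_letters m n = {Alpha i j | i j. i < m \<and> j < n} \<union> {Theta j | j. j < n}"

abbreviation E_algebra :: "nat \<Rightarrow> nat \<Rightarrow> torus_letter supercomm ring" where
  "E_algebra m n \<equiv> free_supercomm (torus_letters m n)"

text \<open>Points of affine space are functions that are \<^const>\<open>undefined\<close> outside \<open>{..<m}\<close>.\<close>

definition affine_space :: "nat \<Rightarrow> (nat \<Rightarrow> complex) set" where
  "affine_space m = {..<m} \<rightarrow>\<^sub>E UNIV"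

text \<open>
  Holomorphic functions of several variables on an open subset of affine space: continuous and
  holomorphic in each variable separately.
\<close>

definition holomorphic_several ::
  "nat \<Rightarrow> (nat \<Rightarrow> complex) set \<Rightarrow> ((nat \<Rightarrow> complex) \<Rightarrow> complex) \<Rightarrow> bool" where
  "holomorphic_several m V f \<longleftrightarrow>
     continuous_on V f \<and>
     (\<forall>z\<in>V. \<forall>i<m. (\<lambda>w. f (z(i := w))) field_differentiable at (z i))"

definition translate_S :: "nat \<Rightarrow> nat \<Rightarrow> (nat \<Rightarrow> complex) \<Rightarrow> nat \<Rightarrow> complex" where
  "translate_S m i z = (\<lambda>k\<in>{..<m}. z k + (if k = i then 1 else 0))"

definition translate_T ::
  "nat \<Rightarrow> complex mat \<Rightarrow> nat \<Rightarrow> (nat \<Rightarrow> complex) \<Rightarrow> nat \<Rightarrow> complex" where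
  "translate_T m \<tau> i z = (\<lambda>k\<in>{..<m}. z k + \<tau> $$ (i, k))"

definition shift_theta :: "nat \<Rightarrow> torus_letter \<Rightarrow> torus_letter supercomm" where
  "shift_theta i x = (case x of
     Alpha k l \<Rightarrow> sc_letter (Alpha k l)
   | Theta j \<Rightarrow> sc_letter (Theta j) + sc_letter (Alpha i j))"

text \<open>The underlying space of the supertorus is the orbit space of affine space.\<close>

definition orbit_rel :: "nat \<Rightarrow> complex mat \<Rightarrow> ((nat \<Rightarrow> complex) \<times> (nat \<Rightarrow> complex)) set" where
  "orbit_rel m \<tau> =
     (let R = {(z, translate_S m i z) | z i. z \<in> affine_space m \<and> i < m} \<union>
              {(z, translate_T m \<tau> i z) | z i. z \<in> affine_space m \<and> i < m}
      in (R \<union> R\<inverse>)\<^sup>*)"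

definition torus_space :: "nat \<Rightarrow> complex mat \<Rightarrow> (nat \<Rightarrow> complex) set set" where
  "torus_space m \<tau> = affine_space m // orbit_rel m \<tau>"

definition torus_preimage ::
  "nat \<Rightarrow> complex mat \<Rightarrow> (nat \<Rightarrow> complex) set set \<Rightarrow> (nat \<Rightarrow> complex) set" where
  "torus_preimage m \<tau> U = {z \<in> affine_space m. orbit_rel m \<tau> `` {z} \<in> U}"

text \<open>
  Sections over \<open>U\<close> (meant for open \<open>U\<close>) are the holomorphic functions on the preimage of \<open>U\<close> with
  values in the exterior algebra that are invariant under pullback by the \<open>S\<^sub>i\<close> and \<open>T\<^sub>i\<close>; pullback
  by \<open>T\<^sub>i\<close> translates the argument and substitutes \<open>\<theta>\<^sub>j \<mapsto> \<theta>\<^sub>j + \<alpha>\<^sub>i\<^sub>j\<close> in the value.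
\<close>

definition supertorus_sections ::
  "nat \<Rightarrow> nat \<Rightarrow> complex mat \<Rightarrow> (nat \<Rightarrow> complex) set set
     \<Rightarrow> ((nat \<Rightarrow> complex) \<Rightarrow> torus_letter supercomm) set" where
  "supertorus_sections m n \<tau> U =
     {s \<in> torus_preimage m \<tau> U \<rightarrow>\<^sub>E carrier (E_algebra m n).
        (\<forall>M. holomorphic_several m (torus_preimage m \<tau> U) (\<lambda>z. sc_coeff (s z) M)) \<and>
        (\<forall>i<m. \<forall>z\<in>torus_preimage m \<tau> U.
           s (translate_S m i z) = s z \<and>
           sc_subst (shift_theta i) (s (translate_T m \<tau> i z)) = s z)}"

definition supertorus_sheaf ::
  "nat \<Rightarrow> nat \<Rightarrow> complex mat \<Rightarrow> (nat \<Rightarrow> complex) set set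
     \<Rightarrow> ((nat \<Rightarrow> complex) \<Rightarrow> torus_letter supercomm) ring" where
  "supertorus_sheaf m n \<tau> U =
     \<lparr>carrier = supertorus_sections m n \<tau> U,
      mult = (\<lambda>s t. \<lambda>z\<in>torus_preimage m \<tau> U. s z * t z),
      one = (\<lambda>z\<in>torus_preimage m \<tau> U. 1),
      zero = (\<lambda>z\<in>torus_preimage m \<tau> U. 0),
      add = (\<lambda>s t. \<lambda>z\<in>torus_preimage m \<tau> U. s z + t z)\<rparr>"

definition H0 ::
  "nat \<Rightarrow> nat \<Rightarrow> complex mat \<Rightarrow> ((nat \<Rightarrow> complex) \<Rightarrow> torus_letter supercomm) ring" where
  "H0 m n \<tau> = supertorus_sheaf m n \<tau> (torus_space m \<tau>)"

text \<open>
  The identification of elements of the exterior algebra with functions on affine space that do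
  not depend on \<open>z\<close>.
\<close>

definition constant_section ::
  "nat \<Rightarrow> torus_letter supercomm \<Rightarrow> (nat \<Rightarrow> complex) \<Rightarrow> torus_letter supercomm" where
  "constant_section m c = (\<lambda>z\<in>affine_space m. c)"


section \<open>Generators and relations\<close>

definition msets :: "nat \<Rightarrow> nat \<Rightarrow> nat multiset set" where
  "msets n k = {N. set_mset N \<subseteq> {..<n} \<and> size N = k}"

abbreviation alpha_elem :: "nat \<Rightarrow> nat \<Rightarrow> torus_letter supercomm" where
  "alpha_elem i j \<equiv> sc_letter (Alpha i j)"

abbreviation theta_elem :: "nat \<Rightarrow> torus_letter supercomm" where
  "theta_elem j \<equiv> sc_letter (Theta j)"

text \<open>The list \<open>xs\<close> below is the ordering \<open>(i\<^sub>1, \<dots>, i\<^sub>m, j)\<close>.\<close>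

definition q_elem :: "nat \<Rightarrow> nat multiset \<Rightarrow> torus_letter supercomm" where
  "q_elem m N =
     of_nat (\<Prod>j\<in>set_mset N. fact (count N j)) *
     (\<Sum>xs\<in>permutations_of_multiset N.
        prod_list (map (\<lambda>k. alpha_elem k (xs ! k)) [0..<m]) * theta_elem (xs ! m))"

text \<open>
  Symbols for the generators. The symbol \<open>GenQ N\<close> has the parity of the size of \<open>N\<close>, which is
  \<open>m + 1\<close> for the multisets that occur.
\<close>

datatype gen_letter = GenAlpha nat nat | GenQ "nat multiset"

instantiation gen_letter :: superletter
begin

fun code_gen_letter :: "gen_letter \<Rightarrow> nat" where
  "code_gen_letter (GenAlpha i j) = 2 * to_nat (i, j)"
| "code_gen_letter (GenQ N) = Suc (2 * to_nat (sorted_list_of_multiset N))"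

definition less_eq_gen_letter :: "gen_letter \<Rightarrow> gen_letter \<Rightarrow> bool" where
  "x \<le> y \<longleftrightarrow> code_gen_letter x \<le> code_gen_letter y"

definition less_gen_letter :: "gen_letter \<Rightarrow> gen_letter \<Rightarrow> bool" where
  "x < y \<longleftrightarrow> code_gen_letter x < code_gen_letter y"

definition odd_letter_gen_letter :: "gen_letter \<Rightarrow> bool" where
  "odd_letter x \<longleftrightarrow> (case x of GenAlpha i j \<Rightarrow> True | GenQ N \<Rightarrow> odd (size N))"

lemma code_gen_letter_inject: "code_gen_letter x = code_gen_letter y \<Longrightarrow> x = y"
  by (cases x; cases y)
    (auto dest: arg_cong[where f = even] arg_cong[where f = mset])

instance
  by standard
    (auto simp: less_eq_gen_letter_def less_gen_letter_def intro: code_gen_letter_inject)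

end

definition gen_letters :: "nat \<Rightarrow> nat \<Rightarrow> gen_letter set" where
  "gen_letters m n = {GenAlpha i j | i j. i < m \<and> j < n} \<union> {GenQ N | N. N \<in> msets n (m + 1)}"

abbreviation gen_algebra :: "nat \<Rightarrow> nat \<Rightarrow> gen_letter supercomm ring" where
  "gen_algebra m n \<equiv> free_supercomm (gen_letters m n)"

definition gen_value :: "nat \<Rightarrow> gen_letter \<Rightarrow> torus_letter supercomm" where
  "gen_value m x = (case x of GenAlpha i j \<Rightarrow> alpha_elem i j | GenQ N \<Rightarrow> q_elem m N)"

definition linear_relation :: "nat \<Rightarrow> nat multiset \<Rightarrow> gen_letter supercomm" where
  "linear_relation i N = (\<Sum>j\<in>#N. sc_letter (GenAlpha i j) * sc_letter (GenQ (N - {#j#})))"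

definition quadratic_relation :: "nat multiset \<Rightarrow> nat multiset \<Rightarrow> gen_letter supercomm" where
  "quadratic_relation N1 N2 =
     (\<Sum>j\<in>#N2. sc_letter (GenQ (N1 + {#j#})) * sc_letter (GenQ (N2 - {#j#})))"

definition supertorus_relations :: "nat \<Rightarrow> nat \<Rightarrow> gen_letter supercomm set" where
  "supertorus_relations m n =
     {linear_relation i N | i N. i < m \<and> N \<in> msets n (m + 2)} \<union>
     {quadratic_relation N1 N2 | N1 N2. N1 \<in> msets n m \<and> N2 \<in> msets n (m + 2)}"

end

theory Submission
  imports
    Defs
    "HOL-Library.Function_Algebras"
    "HOL-Complex_Analysis.Cauchy_Integral_Formula"
begin

text \<open>
  Adjoin to the letters \<open>\<alpha>\<^sub>i\<^sub>j\<close> the \<open>\<theta>\<^sub>j\<close> as a last row, and to the exterior algebra one even variable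
  \<open>u\<^sub>j\<close> per column. Then \<open>\<Delta>\<^sub>a = \<Sum>\<^sub>j \<alpha>\<^sub>a\<^sub>j \<partial>/\<partial>u\<^sub>j\<close> and \<open>\<nabla>\<^sub>a = \<Sum>\<^sub>j u\<^sub>j \<partial>/\<partial>\<alpha>\<^sub>a\<^sub>j\<close> are odd operators of a general linear Lie
  superalgebra whose anticommutators are \<open>E\<^sub>a\<^sub>b + \<delta>\<^sub>a\<^sub>b U\<close>, with \<open>E\<^sub>a\<^sub>b\<close> in the Lie algebra \<open>gl\<^sub>m\<^sub>+\<^sub>1\<close> of the rows and \<open>U\<close>
  the degree in \<open>u\<close>. A product of all \<open>\<Delta>\<^sub>a\<close>, or of all \<open>\<nabla>\<^sub>a\<close>, can be peeled off one factor at a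
  time: on a highest weight vector for \<open>gl\<^sub>m\<^sub>+\<^sub>1\<close> the adjoint of the factor removes it up to \<open>E\<^sub>a\<^sub>a + U\<close>,
  which is positive.

  For the product of the \<open>\<nabla>\<^sub>a\<close> this shows that an invariant killed by the adjoints of all \<open>q\<^sub>N\<close> does
  not contain \<open>\<theta>\<close>; hence the orthogonal complement of the generated subalgebra in the invariants
  vanishes. For the product of the \<open>\<Delta>\<^sub>a\<close> it shows that replacing one symbol \<open>q\<^sub>N\<close> at a time by its
  value is injective on the polynomials in the symbols that are orthogonal to the relations; hence
  the evaluation of the symbols is injective on this orthogonal complement.

  Global sections are constant because, by induction on the \<open>\<theta>\<close>-degree from above, their
  coefficients are periodic up to additive constants, so that they have linear growth and are
  affine functions with period 1.
\<close>

section \<open>Calculus in free supercommutative algebras\<close>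

text \<open>The factorials in \<open>q_elem\<close> and the even variables u_j have the same origin.
  Count the \<theta>_j as row \<open>m\<close>. Then the product over all rows a of the odd elements
  sum_j \<alpha>_aj u_j is the sum of q_N u^N / N! over the (m+1)-multisets N, where N! is the
  product of the factorials of the multiplicities. A function on multisets is therefore read as an
  exponential series in u. The linear relations say that an odd factor of this product squares to
  zero.

  Positivity takes the place of dimension counts: the inner products are definite and make
  multiplication by a letter adjoint to a derivative, so each half reduces to a vector with many
  vanishing derivatives.

  The obstacle in the second half is that replacing a symbol by its value brings in \<theta>, while
  the orthogonality has to survive for the next replacement. So the linear relations are demanded
  for the \<theta> row as well. For a polynomial without \<theta> this extra demand is void; the
  quadratic relations are what carries it through the induction.\<close>

lemma supercomm_eqI: "(\<And>M. sc_coeff f M = sc_coeff g M) \<Longrightarrow> f = g"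
  by (simp add: sc_coeff_inject[symmetric] fun_eq_iff)

lemma sc_coeff_monomial: "sc_coeff f M \<noteq> 0 \<Longrightarrow> sc_monomial M"
  using sc_coeff[of f] by auto

lemma finite_support: "finite {M. sc_coeff f M \<noteq> 0}"
  using sc_coeff[of f] by auto

lemma sc_coeff_0 [simp]: "sc_coeff 0 M = 0"
  by (simp add: zero_supercomm.rep_eq)

lemma sc_coeff_add [simp]: "sc_coeff (f + g) M = sc_coeff f M + sc_coeff g M"
  by (simp add: plus_supercomm.rep_eq)

lemma sc_coeff_minus [simp]: "sc_coeff (- f) M = - sc_coeff f M"
  by (simp add: uminus_supercomm.rep_eq)

lemma sc_coeff_diff [simp]: "sc_coeff (f - g) M = sc_coeff f M - sc_coeff g M"
  by (simp only: diff_conv_add_uminus sc_coeff_add sc_coeff_minus)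

lemma sc_coeff_sum: "sc_coeff (sum f A) M = (\<Sum>a\<in>A. sc_coeff (f a) M)"
  by (induction A rule: infinite_finite_induct) auto

lemma sc_coeff_scalar_mult [simp]: "sc_coeff (sc_scalar c * f) M = c * sc_coeff f M"
proof (cases "sc_monomial M")
  case True
  have "(\<Sum>(A, B)\<in>splittings M. koszul_sign A B * sc_coeff (sc_scalar c) A * sc_coeff f B)
      = (\<Sum>(A, B)\<in>{({#}, M)}. koszul_sign A B * sc_coeff (sc_scalar c) A * sc_coeff f B)"
    by (rule sum.mono_neutral_right, rule finite_splittings)
      (auto simp: splittings_def sc_scalar.rep_eq split: if_splits)
  with True show ?thesis by (simp add: sc_coeff_times sc_scalar.rep_eq)
next
  case False
  then have "sc_coeff (sc_scalar c * f) M = 0" "sc_coeff f M = 0" using sc_coeff_monomial by blast+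
  then show ?thesis by simp
qed

lemma sc_coeff_mult_scalar: "sc_coeff (f * sc_scalar c) M = c * sc_coeff f M"
proof (cases "sc_monomial M")
  case True
  have "(\<Sum>(A, B)\<in>splittings M. koszul_sign A B * sc_coeff f A * sc_coeff (sc_scalar c) B)
      = (\<Sum>(A, B)\<in>{(M, {#})}. koszul_sign A B * sc_coeff f A * sc_coeff (sc_scalar c) B)"
    by (rule sum.mono_neutral_right, rule finite_splittings)
      (auto simp: splittings_def sc_scalar.rep_eq split: if_splits)
  with True show ?thesis by (simp add: sc_coeff_times sc_scalar.rep_eq)
next
  case False
  then have "sc_coeff (f * sc_scalar c) M = 0" "sc_coeff f M = 0" using sc_coeff_monomial by blast+
  then show ?thesis by simp
qed

lemma scalar_central: "f * sc_scalar c = sc_scalar c * f"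
  by (rule supercomm_eqI) (simp add: sc_coeff_mult_scalar)

lemma scalar_left_commute: "f * (sc_scalar c * g) = sc_scalar c * (f * g)"
  by (metis mult.assoc scalar_central)

lemma sc_scalar_0 [simp]: "sc_scalar 0 = 0"
  by (rule supercomm_eqI) (simp add: sc_scalar.rep_eq)

lemma sc_scalar_1 [simp]: "sc_scalar 1 = 1"
  by (rule supercomm_eqI) (simp add: sc_scalar.rep_eq one_supercomm.rep_eq)

lemma sc_scalar_add: "sc_scalar (a + b) = sc_scalar a + sc_scalar b"
  by (rule supercomm_eqI) (simp add: sc_scalar.rep_eq)

lemma sc_scalar_mult: "sc_scalar (a * b) = sc_scalar a * sc_scalar b"
  by (rule supercomm_eqI) (simp add: sc_scalar.rep_eq)

lemma sc_scalar_minus: "sc_scalar (- a) = - sc_scalar a"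
  by (rule supercomm_eqI) (simp add: sc_scalar.rep_eq)

lemma sc_scalar_of_nat: "sc_scalar (of_nat k) = of_nat k"
  by (induction k) (simp_all add: sc_scalar_add)

lemma sc_coeff_of_nat_mult: "sc_coeff (of_nat k * f) M = of_nat k * sc_coeff f M"
  using sc_coeff_scalar_mult[of "of_nat k" f M] by (simp only: sc_scalar_of_nat)

section \<open>Signs of reordering, and left multiplication by a letter\<close>

definition swap_sign :: "'g::superletter \<Rightarrow> 'g \<Rightarrow> complex" where
  "swap_sign x y = (if odd_letter x \<and> odd_letter y \<and> y < x then -1 else 1)"

lemma swap_sign_same [simp]: "swap_sign x x = 1"
  by (simp add: swap_sign_def)

lemma swap_sign_square [simp]: "swap_sign x y * swap_sign x y = 1"
  by (simp add: swap_sign_def)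

lemma swap_sign_swap:
  "x \<noteq> y \<Longrightarrow> swap_sign x y * swap_sign y x = (if odd_letter x \<and> odd_letter y then -1 else 1)"
  using less_linear[of x y] by (auto simp: swap_sign_def)

definition insert_sign :: "'g::superletter \<Rightarrow> 'g multiset \<Rightarrow> complex" where
  "insert_sign x M = koszul_sign {#x#} M"

lemma insert_sign_empty [simp]: "insert_sign x {#} = 1"
  by (simp add: insert_sign_def)

lemma insert_sign_add_mset [simp]: "insert_sign x (add_mset y M) = swap_sign x y * insert_sign x M"
  by (simp add: insert_sign_def koszul_sign_def swap_sign_def)

lemma insert_sign_square [simp]: "insert_sign x M * insert_sign x M = 1"
proof (induction M)
  case (add y M)
  have "insert_sign x (add_mset y M) * insert_sign x (add_mset y M)
     = (swap_sign x y * swap_sign x y) * (insert_sign x M * insert_sign x M)"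
    by (simp only: insert_sign_add_mset mult_ac)
  with add show ?case by simp
qed simp

lemma insert_sign_square' [simp]: "insert_sign x M * (insert_sign x M * c) = c"
  using insert_sign_square[of x M] by (metis mult.assoc mult_1)

lemma sc_coeff_letter_mult:
  "sc_coeff (sc_letter x * f) M =
     (if x \<in># M \<and> sc_monomial M then insert_sign x (M - {#x#}) * sc_coeff f (M - {#x#}) else 0)"
proof (cases "sc_monomial M")
  case True
  have "(\<Sum>(A, B)\<in>splittings M. koszul_sign A B * sc_coeff (sc_letter x) A * sc_coeff f B)
      = (\<Sum>(A, B)\<in>(if x \<in># M then {({#x#}, M - {#x#})} else {}).
           koszul_sign A B * sc_coeff (sc_letter x) A * sc_coeff f B)"
    by (rule sum.mono_neutral_right, rule finite_splittings)
      (auto simp: splittings_def sc_letter.rep_eq split: if_splits)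
  with True show ?thesis by (simp add: sc_coeff_times sc_letter.rep_eq insert_sign_def)
next
  case False
  then show ?thesis using sc_coeff_monomial[of "sc_letter x * f" M] by auto
qed

lemma sc_coeff_letter_mult_add_mset:
  "sc_coeff (sc_letter x * f) (add_mset x M) =
     (if sc_monomial (add_mset x M) then insert_sign x M * sc_coeff f M else 0)"
  by (simp add: sc_coeff_letter_mult)

lemma letter_supercommute_left:
  "sc_letter x * (sc_letter y * f) =
     (if odd_letter x \<and> odd_letter y then - (sc_letter y * (sc_letter x * f))
      else sc_letter y * (sc_letter x * f))"
  using arg_cong[OF sc_letter_supercommute[of x y], of "\<lambda>g. g * f"]
  by (auto simp: mult.assoc split: if_splits)

lemma sc_monomial_add_mset:
  "sc_monomial (add_mset x M) \<longleftrightarrow> sc_monomial M \<and> (odd_letter x \<longrightarrow> x \<notin># M)"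
proof
  assume "sc_monomial (add_mset x M)"
  then show "sc_monomial M \<and> (odd_letter x \<longrightarrow> x \<notin># M)"
    using sc_monomial_addD(2)[of "{#x#}" M]
    by (auto simp: sc_monomial_def not_in_iff dest!: spec[of _ x])
next
  assume "sc_monomial M \<and> (odd_letter x \<longrightarrow> x \<notin># M)"
  then show "sc_monomial (add_mset x M)"
    by (auto simp: sc_monomial_def not_in_iff)
qed

text \<open>
  The left derivative with respect to a letter: on a basis monomial it moves the letter to the
  front, with the corresponding sign, and removes it.
\<close>

lift_definition sc_deriv :: "'g::superletter \<Rightarrow> 'g supercomm \<Rightarrow> 'g supercomm"
  is "\<lambda>x f M. of_nat (Suc (count M x)) * insert_sign x M * f (add_mset x M)"
proof -
  fix x :: 'g and f :: "'g multiset \<Rightarrow> complex"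
  assume *: "finite {M. f M \<noteq> 0} \<and> (\<forall>M. f M \<noteq> 0 \<longrightarrow> sc_monomial M)"
  let ?h = "\<lambda>M. of_nat (Suc (count M x)) * insert_sign x M * f (add_mset x M)"
  have "{M. ?h M \<noteq> 0} \<subseteq> (\<lambda>M. M - {#x#}) ` {M. f M \<noteq> 0}"
    by (auto intro!: image_eqI[where x = "add_mset x _"])
  then have "finite {M. ?h M \<noteq> 0}"
    by (rule finite_subset) (use * in simp)
  moreover have "sc_monomial M" if "?h M \<noteq> 0" for M
  proof -
    have "sc_monomial (add_mset x M)" using that * by auto
    then show ?thesis by (simp add: sc_monomial_add_mset)
  qed
  ultimately show "finite {M. ?h M \<noteq> 0} \<and> (\<forall>M. ?h M \<noteq> 0 \<longrightarrow> sc_monomial M)"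
    by blast
qed

lemmas sc_coeff_deriv = sc_deriv.rep_eq

lemma sc_deriv_add: "sc_deriv x (f + g) = sc_deriv x f + sc_deriv x g"
  by (rule supercomm_eqI) (simp add: sc_coeff_deriv algebra_simps)

lemma sc_deriv_scalar_mult: "sc_deriv x (sc_scalar c * f) = sc_scalar c * sc_deriv x f"
  by (rule supercomm_eqI) (simp add: sc_coeff_deriv algebra_simps)

lemma sc_deriv_0 [simp]: "sc_deriv x 0 = 0"
  by (rule supercomm_eqI) (simp add: sc_coeff_deriv)

lemma sc_deriv_scalar [simp]: "sc_deriv x (sc_scalar c) = 0"
  by (rule supercomm_eqI) (simp add: sc_coeff_deriv sc_scalar.rep_eq)

lemma sc_deriv_1 [simp]: "sc_deriv x 1 = 0"
  using sc_deriv_scalar[of x 1] by simp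


lemma sc_deriv_of_nat_mult: "sc_deriv x (of_nat k * f) = of_nat k * sc_deriv x f"
  using sc_deriv_scalar_mult[of x "of_nat k" f] by (simp only: sc_scalar_of_nat)

lemma sc_deriv_sum: "sc_deriv x (sum f A) = (\<Sum>a\<in>A. sc_deriv x (f a))"
  by (induction A rule: infinite_finite_induct) (auto simp: sc_deriv_add)

lemma sc_deriv_commute:
  "sc_deriv x (sc_deriv y f) =
     (if odd_letter x \<and> odd_letter y then - sc_deriv y (sc_deriv x f)
      else sc_deriv y (sc_deriv x f))"
proof (cases "x = y")
  case True
  \<comment> \<open>A monomial never repeats an odd letter, so its second derivative is zero and
    agrees with its own negative.\<close>
  have "sc_coeff f (add_mset x (add_mset x M)) = 0" if "odd_letter x" for M
    using that sc_coeff_monomial[of f "add_mset x (add_mset x M)"]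
    by (auto simp: sc_monomial_add_mset)
  then have "sc_deriv x (sc_deriv x f) = 0" if "odd_letter x"
    using that by (intro supercomm_eqI) (simp add: sc_coeff_deriv)
  with True show ?thesis by auto
next
  case False
  show ?thesis
  proof (rule supercomm_eqI)
    fix M
    define K where "K = of_nat (Suc (count M x)) * of_nat (Suc (count M y)) * insert_sign x M *
      insert_sign y M * sc_coeff f (add_mset x (add_mset y M))"
    have "sc_coeff (sc_deriv x (sc_deriv y f)) M = swap_sign y x * K"
      using False by (simp add: sc_coeff_deriv K_def add_mset_commute)
    moreover have "sc_coeff (sc_deriv y (sc_deriv x f)) M = swap_sign x y * K"
      using False by (simp add: sc_coeff_deriv K_def add_mset_commute)
    moreover have "swap_sign y x = (if odd_letter x \<and> odd_letter y then - swap_sign x y else swap_sign x y)"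
      using False less_linear[of x y] by (auto simp: swap_sign_def)
    ultimately show "sc_coeff (sc_deriv x (sc_deriv y f)) M =
      sc_coeff (if odd_letter x \<and> odd_letter y then - sc_deriv y (sc_deriv x f)
        else sc_deriv y (sc_deriv x f)) M"
      by simp
  qed
qed

text \<open>Removing a letter and putting it back produces the same sign twice, so this is a number
  operator, diagonal on monomials. It supplies the eigenvalues of \<open>E a a\<close> and Euler's
  identity.\<close>

lemma letter_mult_deriv_same:
  "sc_coeff (sc_letter x * sc_deriv x f) M = of_nat (count M x) * sc_coeff f M"
proof (cases "x \<in># M")
  case True
  then obtain N where N: "M = add_mset x N" by (metis insert_DiffM)
  then show ?thesis using sc_coeff_monomial[of f M]
    by (auto simp: sc_coeff_letter_mult sc_coeff_deriv)
next
  case False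
  then have "count M x = 0" by (simp add: not_in_iff)
  with False show ?thesis by (simp add: sc_coeff_letter_mult)
qed

lemma sc_deriv_letter_mult_same:
  "sc_deriv x (sc_letter x * f) =
     (if odd_letter x then f - sc_letter x * sc_deriv x f else f + sc_letter x * sc_deriv x f)"
proof (rule supercomm_eqI)
  fix M
  have 1: "sc_coeff (sc_deriv x (sc_letter x * f)) M =
     of_nat (Suc (count M x)) * (if sc_monomial (add_mset x M) then sc_coeff f M else 0)"
    by (simp add: sc_coeff_deriv sc_coeff_letter_mult_add_mset)
  note 2 = letter_mult_deriv_same[of x f M]
  show "sc_coeff (sc_deriv x (sc_letter x * f)) M = sc_coeff
     (if odd_letter x then f - sc_letter x * sc_deriv x f else f + sc_letter x * sc_deriv x f) M"
  proof (cases "sc_monomial M")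
    case True
    have "count M x = 1" if "odd_letter x" "x \<in># M"
      using True that unfolding sc_monomial_def by (metis count_greater_zero_iff le_antisym Suc_leI One_nat_def)
    with True show ?thesis using 1 2
      by (auto simp: sc_monomial_add_mset not_in_iff algebra_simps)
  next
    case False
    then have "sc_coeff f M = 0" using sc_coeff_monomial by blast
    then show ?thesis using 1 2 by simp
  qed
qed

lemma sc_deriv_letter_mult_other:
  assumes "x \<noteq> y"
  shows "sc_deriv x (sc_letter y * f) =
     (if odd_letter x \<and> odd_letter y then - (sc_letter y * sc_deriv x f)
      else sc_letter y * sc_deriv x f)"
proof (rule supercomm_eqI)
  fix M
  show "sc_coeff (sc_deriv x (sc_letter y * f)) M = sc_coeff
     (if odd_letter x \<and> odd_letter y then - (sc_letter y * sc_deriv x f)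
      else sc_letter y * sc_deriv x f) M"
  proof (cases "y \<in># M")
    case True
    then obtain N where N: "M = add_mset y N" by (metis insert_DiffM)
    define K where "K = of_nat (Suc (count N x)) * insert_sign x N * insert_sign y N *
      sc_coeff f (add_mset x N)"
    have "sc_coeff (sc_letter y * f) (add_mset x M) =
        (if sc_monomial (add_mset y (add_mset x N))
         then swap_sign y x * insert_sign y N * sc_coeff f (add_mset x N) else 0)"
      unfolding N add_mset_commute[of x y] sc_coeff_letter_mult_add_mset by simp
    then have 1: "sc_coeff (sc_deriv x (sc_letter y * f)) M = (if sc_monomial (add_mset y (add_mset x N)) then
        swap_sign x y * swap_sign y x * K else 0)"
      using assms by (simp add: N sc_coeff_deriv K_def)
    have 2: "sc_coeff (sc_letter y * sc_deriv x f) M = (if sc_monomial (add_mset y N) then K else 0)"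
      by (simp add: N sc_coeff_letter_mult_add_mset sc_coeff_deriv K_def)
    have "K = 0" if "\<not> sc_monomial (add_mset x N)"
      using that sc_coeff_monomial[of f "add_mset x N"] by (auto simp: K_def)
    then show ?thesis using 1 2 swap_sign_swap[OF assms] assms
      by (cases "sc_monomial (add_mset x N)") (auto simp: sc_monomial_add_mset)
  next
    case False
    then show ?thesis using assms by (auto simp: sc_coeff_deriv sc_coeff_letter_mult)
  qed
qed

section \<open>Elements supported on a set of letters, and their expansion in monomials\<close>

lemma free_supercomm_simps [simp]:
  "mult (free_supercomm L) = (*)" "one (free_supercomm L) = 1"
  "zero (free_supercomm L) = 0" "add (free_supercomm L) = (+)"
  by (simp_all add: free_supercomm_def)

lemma in_free_supercomm:
  "f \<in> carrier (free_supercomm L) \<longleftrightarrow> (\<forall>M. sc_coeff f M \<noteq> 0 \<longrightarrow> set_mset M \<subseteq> L)"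
  by (simp add: free_supercomm_def)

lemma free_supercomm_closed:
  shows free_supercomm_zero: "0 \<in> carrier (free_supercomm L)"
    and free_supercomm_one: "1 \<in> carrier (free_supercomm L)"
    and free_supercomm_add:
      "\<lbrakk>f \<in> carrier (free_supercomm L); g \<in> carrier (free_supercomm L)\<rbrakk> \<Longrightarrow> f + g \<in> carrier (free_supercomm L)"
    and free_supercomm_mult:
      "\<lbrakk>f \<in> carrier (free_supercomm L); g \<in> carrier (free_supercomm L)\<rbrakk> \<Longrightarrow> f * g \<in> carrier (free_supercomm L)"
  using ring.ring_simprules(1,2,5,6)[OF ring_free_supercomm[of L]] by simp_all

lemma free_supercomm_minus: "f \<in> carrier (free_supercomm L) \<Longrightarrow> - f \<in> carrier (free_supercomm L)"
  by (simp add: in_free_supercomm)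

lemma free_supercomm_diff:
  "\<lbrakk>f \<in> carrier (free_supercomm L); g \<in> carrier (free_supercomm L)\<rbrakk> \<Longrightarrow> f - g \<in> carrier (free_supercomm L)"
  using free_supercomm_add[OF _ free_supercomm_minus, of f L g] by simp

lemma free_supercomm_sum:
  "(\<And>a. a \<in> A \<Longrightarrow> f a \<in> carrier (free_supercomm L)) \<Longrightarrow> sum f A \<in> carrier (free_supercomm L)"
  by (induction A rule: infinite_finite_induct) (auto intro: free_supercomm_zero free_supercomm_add)

lemma free_supercomm_sum_mset:
  "(\<And>a. a \<in># N \<Longrightarrow> f a \<in> carrier (free_supercomm L)) \<Longrightarrow> (\<Sum>a\<in>#N. f a) \<in> carrier (free_supercomm L)"
  by (induction N) (auto intro: free_supercomm_zero free_supercomm_add)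

lemma free_supercomm_scalar: "sc_scalar c \<in> carrier (free_supercomm L)"
  by (simp add: in_free_supercomm sc_scalar.rep_eq)

lemma free_supercomm_of_nat_mult:
  "f \<in> carrier (free_supercomm L) \<Longrightarrow> of_nat k * f \<in> carrier (free_supercomm L)"
  using free_supercomm_mult[OF free_supercomm_scalar[of "of_nat k"]] by (simp add: sc_scalar_of_nat)

lemma free_supercomm_letter: "x \<in> L \<Longrightarrow> sc_letter x \<in> carrier (free_supercomm L)"
  by (auto simp: in_free_supercomm sc_letter.rep_eq split: if_splits)

lemma free_supercomm_deriv:
  "f \<in> carrier (free_supercomm L) \<Longrightarrow> sc_deriv x f \<in> carrier (free_supercomm L)"
  unfolding in_free_supercomm sc_coeff_deriv by (fastforce dest: spec[of _ "add_mset x _"])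

lemma free_supercomm_mono: "L \<subseteq> L' \<Longrightarrow> carrier (free_supercomm L) \<subseteq> carrier (free_supercomm L')"
  unfolding in_free_supercomm subset_iff by blast

lemma carrier_UNIV: "f \<in> carrier (free_supercomm UNIV)"
  by (simp add: in_free_supercomm)

lemma sc_deriv_eq_0:
  assumes "f \<in> carrier (free_supercomm L)" "x \<notin> L"
  shows "sc_deriv x f = 0"
  using assms by (intro supercomm_eqI) (auto simp: in_free_supercomm sc_coeff_deriv)

lift_definition sc_basis :: "'g::superletter multiset \<Rightarrow> 'g supercomm"
  is "\<lambda>M K. if K = M \<and> sc_monomial M then 1 else 0"
  by (auto split: if_splits)

lemma sc_basis_empty [simp]: "sc_basis {#} = 1"
  by (rule supercomm_eqI) (simp add: sc_basis.rep_eq one_supercomm.rep_eq)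

lemma letter_mult_basis:
  "sc_letter x * sc_basis M = sc_scalar (insert_sign x M) * sc_basis (add_mset x M)"
proof (rule supercomm_eqI)
  fix K
  show "sc_coeff (sc_letter x * sc_basis M) K = sc_coeff (sc_scalar (insert_sign x M) * sc_basis (add_mset x M)) K"
  proof (cases "x \<in># K")
    case True
    then obtain N where "K = add_mset x N" by (metis insert_DiffM)
    then show ?thesis
      by (auto simp: sc_coeff_letter_mult_add_mset sc_basis.rep_eq sc_monomial_add_mset)
  next
    case False
    then show ?thesis by (auto simp: sc_coeff_letter_mult sc_basis.rep_eq)
  qed
qed

lemma sc_basis_add_mset:
  "sc_basis (add_mset x M) = sc_scalar (insert_sign x M) * (sc_letter x * sc_basis M)"
  unfolding letter_mult_basis by (simp flip: mult.assoc sc_scalar_mult)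

lemma basis_expansion:
  assumes "finite S" "{M. sc_coeff f M \<noteq> 0} \<subseteq> S"
  shows "f = (\<Sum>M\<in>S. sc_scalar (sc_coeff f M) * sc_basis M)"
proof (rule supercomm_eqI)
  fix K
  have "sc_coeff (\<Sum>M\<in>S. sc_scalar (sc_coeff f M) * sc_basis M) K
      = (\<Sum>M\<in>S. if M = K then sc_coeff f K else 0)"
    unfolding sc_coeff_sum
    by (rule sum.cong) (use sc_coeff_monomial[of f] in \<open>auto simp: sc_basis.rep_eq\<close>)
  also have "\<dots> = sc_coeff f K" using assms by auto
  finally show "sc_coeff f K = sc_coeff (\<Sum>M\<in>S. sc_scalar (sc_coeff f M) * sc_basis M) K" by simp
qed

text \<open>Up to sign, every monomial arises from 1 by multiplying letters on the left. Facts about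
  substitutions and derivations then need only a rule for one letter on the left.\<close>

lemma free_supercomm_induct [consumes 1, case_names scalar add scale letter]:
  assumes f: "f \<in> carrier (free_supercomm L)"
    and one: "P 1"
    and add: "\<And>f g. \<lbrakk>f \<in> carrier (free_supercomm L); g \<in> carrier (free_supercomm L); P f; P g\<rbrakk> \<Longrightarrow> P (f + g)"
    and scale: "\<And>c f. \<lbrakk>f \<in> carrier (free_supercomm L); P f\<rbrakk> \<Longrightarrow> P (sc_scalar c * f)"
    and letter: "\<And>x f. \<lbrakk>x \<in> L; f \<in> carrier (free_supercomm L); P f\<rbrakk> \<Longrightarrow> P (sc_letter x * f)"
  shows "P f"
proof -
  have basis: "sc_basis M \<in> carrier (free_supercomm L) \<and> P (sc_basis M)" if "set_mset M \<subseteq> L" for M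
    using that
  proof (induction M)
    case (add x M)
    then have M: "sc_basis M \<in> carrier (free_supercomm L)" "P (sc_basis M)" "x \<in> L" by auto
    show ?case unfolding sc_basis_add_mset
      using letter[OF M(3,1,2)] M
      by (intro conjI scale free_supercomm_mult free_supercomm_scalar free_supercomm_letter)
  qed (use one free_supercomm_one in auto)
  have zero: "P 0" using scale[OF free_supercomm_one one, of 0] by simp
  have "(\<Sum>M\<in>S. sc_scalar (c M) * sc_basis M) \<in> carrier (free_supercomm L) \<and>
      P (\<Sum>M\<in>S. sc_scalar (c M) * sc_basis M)"
    if "finite S" "\<And>M. M \<in> S \<Longrightarrow> set_mset M \<subseteq> L" for S c
    using that
  proof (induction S)
    case (insert M S)
    have M: "sc_scalar (c M) * sc_basis M \<in> carrier (free_supercomm L)" "P (sc_scalar (c M) * sc_basis M)"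
      using basis[of M] insert.prems scale[of "sc_basis M" "c M"]
      by (auto intro: free_supercomm_mult free_supercomm_scalar)
    show ?case using insert M by (auto intro!: add free_supercomm_add)
  qed (auto simp: zero free_supercomm_zero)
  from this[of "{M. sc_coeff f M \<noteq> 0}" "sc_coeff f"] f
  show ?thesis using basis_expansion[OF finite_support order_refl, of f] finite_support[of f]
    by (simp add: in_free_supercomm)
qed

subsection \<open>Substitution\<close>

lemma sc_subst_basis_sum:
  assumes "finite S" "{M. sc_coeff f M \<noteq> 0} \<subseteq> S"
  shows "sc_subst \<phi> f = (\<Sum>M\<in>S. sc_scalar (sc_coeff f M) * prod_list (map \<phi> (sorted_list_of_multiset M)))"
  unfolding sc_subst_def by (rule sum.mono_neutral_left) (use assms in auto)

lemma sc_subst_add: "sc_subst \<phi> (f + g) = sc_subst \<phi> f + sc_subst \<phi> g"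
proof -
  let ?S = "{M. sc_coeff f M \<noteq> 0} \<union> {M. sc_coeff g M \<noteq> 0}"
  have S: "finite ?S" using finite_support by auto
  show ?thesis
    by (subst (1 2 3) sc_subst_basis_sum[OF S])
      (auto simp: sc_scalar_add distrib_right sum.distrib)
qed

lemma sc_subst_scale: "sc_subst \<phi> (sc_scalar c * f) = sc_scalar c * sc_subst \<phi> f"
proof -
  have S: "finite {M. sc_coeff f M \<noteq> 0}" by (rule finite_support)
  show ?thesis
    by (subst (1 2) sc_subst_basis_sum[OF S])
      (auto simp: sc_scalar_mult mult.assoc sum_distrib_left)
qed

lemma sc_subst_1 [simp]: "sc_subst \<phi> 1 = 1"
  by (subst sc_subst_basis_sum[of "{{#}}"]) (auto simp: one_supercomm.rep_eq)

lemma sc_subst_scalar [simp]: "sc_subst \<phi> (sc_scalar c) = sc_scalar c"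
  using sc_subst_scale[of \<phi> c 1] by simp

lemma sc_subst_0 [simp]: "sc_subst \<phi> 0 = 0"
  using sc_subst_scalar[of \<phi> 0] by simp

lemma sc_subst_sum: "sc_subst \<phi> (sum f A) = (\<Sum>a\<in>A. sc_subst \<phi> (f a))"
  by (induction A rule: infinite_finite_induct) (auto simp: sc_subst_add)

lemma sc_subst_basis:
  "sc_monomial M \<Longrightarrow> sc_subst \<phi> (sc_basis M) = prod_list (map \<phi> (sorted_list_of_multiset M))"
  by (subst sc_subst_basis_sum[of "{M}"]) (auto simp: sc_basis.rep_eq)

text \<open>
  That the squares of the values of odd letters vanish need not be required, because the
  characteristic is not 2.
\<close>

definition respects_parity ::
  "'g::superletter set \<Rightarrow> ('g \<Rightarrow> 'h::superletter supercomm) \<Rightarrow> bool" where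
  "respects_parity L \<phi> \<longleftrightarrow> (\<forall>x\<in>L. \<forall>y\<in>L. \<phi> x * \<phi> y =
     (if odd_letter x \<and> odd_letter y then - (\<phi> y * \<phi> x) else \<phi> y * \<phi> x))"

lemma supercomm_self_neg:
  assumes "f = - (f :: 'h::superletter supercomm)" shows "f = 0"
proof (rule supercomm_eqI)
  fix M
  have "sc_coeff f M = - sc_coeff f M" using assms by (metis sc_coeff_minus)
  then show "sc_coeff f M = sc_coeff 0 M" by simp
qed

lemma respects_parity_square:
  "\<lbrakk>respects_parity L \<phi>; x \<in> L; odd_letter x\<rbrakk> \<Longrightarrow> \<phi> x * \<phi> x = 0"
  unfolding respects_parity_def by (rule supercomm_self_neg) metis

text \<open>Sorting a new factor into a product of values costs exactly the sign that sorting the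
  letter costs in a monomial, and a repeated odd factor gives 0. This is why \<open>sc_subst\<close>
  is multiplicative.\<close>

lemma prod_list_insort:
  assumes "respects_parity L \<phi>" "x \<in> L" "set xs \<subseteq> L" "sorted xs"
  shows "\<phi> x * prod_list (map \<phi> xs) =
    (if odd_letter x \<and> x \<in> set xs then 0
     else sc_scalar (insert_sign x (mset xs)) * prod_list (map \<phi> (insort x xs)))"
  using assms(3,4)
proof (induction xs)
  case (Cons y ys)
  have swap: "\<phi> x * \<phi> y = (if odd_letter x \<and> odd_letter y then - (\<phi> y * \<phi> x) else \<phi> y * \<phi> x)"
    using assms(1,2) Cons.prems unfolding respects_parity_def by auto
  show ?case
  proof (cases "x \<le> y")
    case True
    have le: "x \<le> z" if "z \<in> set (y # ys)" for z using that True Cons.prems by auto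
    have "insert_sign x (mset zs) = 1" if "\<forall>z\<in>set zs. x \<le> z" for zs
      using that by (induction zs) (auto simp: swap_sign_def leD)
    from this[of "y # ys"] have sgn: "insert_sign x (mset (y # ys)) = 1" using le by blast
    have "\<phi> x * prod_list (map \<phi> (y # ys)) = 0" if "odd_letter x" "x \<in> set (y # ys)"
    proof (cases "x = y")
      case True
      then show ?thesis using respects_parity_square[OF assms(1,2)] that
        by (simp flip: mult.assoc)
    next
      case False
      then have "x \<in> set ys" "y < x \<or> x < y" using that by auto
      then show ?thesis using Cons.prems \<open>x \<le> y\<close> by auto
    qed
    then show ?thesis using True sgn by simp
  next
    case False
    then have "y < x" by simp
    have IH: "\<phi> x * prod_list (map \<phi> ys) = (if odd_letter x \<and> x \<in> set ys then 0
     else sc_scalar (insert_sign x (mset ys)) * prod_list (map \<phi> (insort x ys)))"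
      using Cons by auto
    have "\<phi> x * prod_list (map \<phi> (y # ys)) = \<phi> x * \<phi> y * prod_list (map \<phi> ys)"
      by (simp add: mult.assoc)
    also have "\<dots> = sc_scalar (swap_sign x y) * (\<phi> y * (\<phi> x * prod_list (map \<phi> ys)))"
      unfolding swap using \<open>y < x\<close> by (simp add: swap_sign_def sc_scalar_minus mult.assoc)
    finally show ?thesis unfolding IH using \<open>y < x\<close>
      by (auto simp: scalar_left_commute[of "\<phi> y"] sc_scalar_mult mult.assoc)
  qed
qed auto

lemma sc_subst_letter_mult:
  assumes \<phi>: "respects_parity L \<phi>" and x: "x \<in> L" and f: "f \<in> carrier (free_supercomm L)"
  shows "sc_subst \<phi> (sc_letter x * f) = \<phi> x * sc_subst \<phi> f"
proof -
  have basis: "sc_subst \<phi> (sc_letter x * sc_basis M) = \<phi> x * sc_subst \<phi> (sc_basis M)"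
    if "sc_monomial M" "set_mset M \<subseteq> L" for M
  proof -
    have "\<phi> x * sc_subst \<phi> (sc_basis M) = (if odd_letter x \<and> x \<in># M then 0
     else sc_scalar (insert_sign x M) * prod_list (map \<phi> (insort x (sorted_list_of_multiset M))))"
      using prod_list_insort[OF \<phi> x, of "sorted_list_of_multiset M"] that
      by (simp add: sc_subst_basis sorted_sorted_list_of_multiset)
    also have "\<dots> = sc_subst \<phi> (sc_letter x * sc_basis M)"
    proof (cases "odd_letter x \<and> x \<in># M")
      case True
      then have "sc_basis (add_mset x M) = 0"
        by (intro supercomm_eqI) (simp add: sc_basis.rep_eq sc_monomial_add_mset)
      with True show ?thesis by (simp add: letter_mult_basis)
    next
      case False
      then have "sc_monomial (add_mset x M)" using that by (auto simp: sc_monomial_add_mset)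
      then show ?thesis unfolding letter_mult_basis sc_subst_scale using False
        by (simp add: sc_subst_basis del: if_not_P) (use False in auto)
    qed
    finally show ?thesis by simp
  qed
  have f_eq: "f = (\<Sum>M | sc_coeff f M \<noteq> 0. sc_scalar (sc_coeff f M) * sc_basis M)"
    by (rule basis_expansion) (auto simp: finite_support)
  let ?S = "{M. sc_coeff f M \<noteq> 0}"
  have "sc_subst \<phi> (sc_letter x * f) =
      sc_subst \<phi> (\<Sum>M\<in>?S. sc_scalar (sc_coeff f M) * (sc_letter x * sc_basis M))"
    by (subst f_eq) (simp only: sum_distrib_left scalar_left_commute[of "sc_letter x"])
  also have "\<dots> = (\<Sum>M\<in>?S. sc_scalar (sc_coeff f M) * (\<phi> x * sc_subst \<phi> (sc_basis M)))"
    unfolding sc_subst_sum sc_subst_scale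
    using f basis sc_coeff_monomial[of f] by (intro sum.cong) (simp_all add: in_free_supercomm)
  also have "\<dots> = \<phi> x * sc_subst \<phi> (\<Sum>M\<in>?S. sc_scalar (sc_coeff f M) * sc_basis M)"
    by (simp only: sc_subst_sum sc_subst_scale sum_distrib_left scalar_left_commute[of "\<phi> x"])
  finally show ?thesis unfolding f_eq[symmetric] .
qed

lemma sc_subst_letter: "respects_parity L \<phi> \<Longrightarrow> x \<in> L \<Longrightarrow> sc_subst \<phi> (sc_letter x) = \<phi> x"
  using sc_subst_letter_mult[of L \<phi> x 1] free_supercomm_one[of L] by simp

lemma sc_subst_mult:
  assumes \<phi>: "respects_parity L \<phi>"
    and f: "f \<in> carrier (free_supercomm L)" and g: "g \<in> carrier (free_supercomm L)"
  shows "sc_subst \<phi> (f * g) = sc_subst \<phi> f * sc_subst \<phi> g"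
  using f
proof (induction rule: free_supercomm_induct)
  case (letter x f)
  have "sc_subst \<phi> (sc_letter x * f * g) = \<phi> x * sc_subst \<phi> (f * g)"
    unfolding mult.assoc using letter g by (intro sc_subst_letter_mult[OF \<phi>] free_supercomm_mult)
  then show ?case using letter sc_subst_letter_mult[OF \<phi> letter(1,2)] by (simp add: mult.assoc)
next
  case (scale c f)
  then show ?case by (simp only: sc_subst_scale mult.assoc)
qed (simp_all add: sc_subst_add distrib_right)

lemma sc_subst_id:
  assumes "respects_parity L \<phi>" "\<And>x. x \<in> L \<Longrightarrow> \<phi> x = sc_letter x" "f \<in> carrier (free_supercomm L)"
  shows "sc_subst \<phi> f = f"
  using assms(3)
  by (induction rule: free_supercomm_induct)
    (simp_all add: sc_subst_add sc_subst_scale sc_subst_letter_mult[OF assms(1)] assms(2))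


section \<open>Peeling off a product of odd operators\<close>

text \<open>
  The operators \<open>c\<close>, \<open>d\<close> create and annihilate odd variables in rows \<open>a\<close> and columns \<open>j\<close>, and
  \<open>m\<close>, \<open>p\<close> are multiplication by and differentiation with respect to one even variable per column.
  Summing over columns gives the odd operators \<open>Dn\<close>, \<open>Up\<close> and the even operators \<open>E\<close>, \<open>U\<close> of a
  general linear Lie superalgebra.
\<close>

locale oscillators =
  fixes n :: nat
    and c d :: "nat \<Rightarrow> nat \<Rightarrow> 'v::ab_group_add \<Rightarrow> 'v"
    and p m :: "nat \<Rightarrow> 'v \<Rightarrow> 'v"
  assumes c_add: "c a j (x + y) = c a j x + c a j y"
    and d_add: "d a j (x + y) = d a j x + d a j y"
    and p_add: "p j (x + y) = p j x + p j y"
    and m_add: "m j (x + y) = m j x + m j y"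
    and cc: "c a j (c b k v) = - c b k (c a j v)"
    and dd: "d a j (d b k v) = - d b k (d a j v)"
    and dc: "d a j (c b k v) = (if a = b \<and> j = k then v else 0) - c b k (d a j v)"
    and pp: "p j (p k v) = p k (p j v)"
    and mm: "m j (m k v) = m k (m j v)"
    and pm: "p j (m k v) = m k (p j v) + (if j = k then v else 0)"
    and pc: "p j (c a k v) = c a k (p j v)"
    and pd: "p j (d a k v) = d a k (p j v)"
    and mc: "m j (c a k v) = c a k (m j v)"
    and md: "m j (d a k v) = d a k (m j v)"
begin

lemma additive_ops:
  "Modules.additive (c a j)" "Modules.additive (d a j)" "Modules.additive (p j)" "Modules.additive (m j)"
  by (simp_all add: Modules.additive_def c_add d_add p_add m_add)

lemmas op_zero [simp] = additive_ops[THEN additive.zero]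
lemmas op_minus = additive_ops[THEN additive.minus]
lemmas op_diff = additive_ops[THEN additive.diff]
lemmas op_sum = additive_ops[THEN additive.sum]
lemmas op_linear = c_add d_add p_add m_add op_minus op_diff op_sum

definition Dn :: "nat \<Rightarrow> 'v \<Rightarrow> 'v" where "Dn a v = (\<Sum>j<n. c a j (p j v))"
definition Up :: "nat \<Rightarrow> 'v \<Rightarrow> 'v" where "Up a v = (\<Sum>j<n. d a j (m j v))"
definition Cr :: "nat \<Rightarrow> 'v \<Rightarrow> 'v" where "Cr a v = (\<Sum>j<n. c a j (m j v))"
definition E :: "nat \<Rightarrow> nat \<Rightarrow> 'v \<Rightarrow> 'v" where "E a b v = (\<Sum>j<n. c a j (d b j v))"
definition U :: "'v \<Rightarrow> 'v" where "U v = (\<Sum>j<n. m j (p j v))"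

lemma additive_Dn: "Modules.additive (Dn a)"
  and additive_Up: "Modules.additive (Up a)"
  and additive_Cr: "Modules.additive (Cr a)"
  and additive_E: "Modules.additive (E a b)"
  and additive_U: "Modules.additive U"
  by (simp_all add: Modules.additive_def Dn_def Up_def Cr_def E_def U_def op_linear sum.distrib)

lemmas Op_zero [simp] =
  additive_Dn[THEN additive.zero] additive_Up[THEN additive.zero] additive_Cr[THEN additive.zero]
  additive_E[THEN additive.zero] additive_U[THEN additive.zero]
lemmas Op_minus =
  additive_Dn[THEN additive.minus] additive_Up[THEN additive.minus] additive_Cr[THEN additive.minus]
  additive_E[THEN additive.minus] additive_U[THEN additive.minus]
lemmas Op_add =
  additive_Dn[THEN additive.add] additive_Up[THEN additive.add] additive_Cr[THEN additive.add]
  additive_E[THEN additive.add] additive_U[THEN additive.add]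
lemmas Op_sum =
  additive_Dn[THEN additive.sum] additive_Up[THEN additive.sum] additive_Cr[THEN additive.sum]
  additive_E[THEN additive.sum] additive_U[THEN additive.sum]

lemma double_sum_swap_neg:
  assumes "\<And>j k. f j k = - g k j"
  shows "(\<Sum>j<n. \<Sum>k<n. f j k) = - (\<Sum>j<n. \<Sum>k<n. (g j k :: 'v))"
  unfolding assms by (subst sum.swap) (simp add: sum_negf)

lemma Dn_Dn: "Dn a (Dn b v) = - Dn b (Dn a v)"
  unfolding Dn_def op_sum
  by (rule double_sum_swap_neg) (metis cc pc pp)

lemma Up_Up: "Up a (Up b v) = - Up b (Up a v)"
  unfolding Up_def op_sum
  by (rule double_sum_swap_neg) (metis dd md mm)

lemma Cr_Cr: "Cr a (Cr b v) = - Cr b (Cr a v)"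
  unfolding Cr_def op_sum
  by (rule double_sum_swap_neg) (metis cc mc mm)

lemma m_Cr: "m j (Cr a v) = Cr a (m j v)"
  unfolding Cr_def op_sum by (simp add: mc mm)

lemma sum_if_eq_0 [simp]: "(\<Sum>k<n. if j = k then f k else (0::'v)) = (if j < n then f j else 0)"
  by simp

text \<open>In each term either the even pair or the odd pair fails to commute: the commutator of
  \<open>p j\<close> and \<open>m k\<close> leaves \<open>E a b\<close>, the anticommutator of
  \<open>d b k\<close> and \<open>c a j\<close> leaves \<open>U\<close>.\<close>

lemma Dn_Up: "Dn a (Up b v) + Up b (Dn a v) = E a b v + (if a = b then U v else 0)"
proof -
  have "Dn a (Up b v) = (\<Sum>j<n. \<Sum>k<n. c a j (d b k (m k (p j v))) + (if j = k then c a j (d b k v) else 0))"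
    unfolding Dn_def Up_def op_sum by (auto intro!: sum.cong simp: pd pm op_linear)
  also have "\<dots> = (\<Sum>j<n. \<Sum>k<n. c a j (d b k (m k (p j v)))) + E a b v"
    by (simp add: sum.distrib E_def)
  finally have 1: "Dn a (Up b v) = (\<Sum>j<n. \<Sum>k<n. c a j (d b k (m k (p j v)))) + E a b v" .
  have "Up b (Dn a v) = (\<Sum>k<n. \<Sum>j<n. (if j = k then (if a = b then m k (p j v) else 0) else 0)
     - c a j (d b k (m k (p j v))))"
    unfolding Dn_def Up_def op_sum by (auto intro!: sum.cong simp: mc dc op_linear)
  also have "\<dots> = (if a = b then U v else 0) - (\<Sum>k<n. \<Sum>j<n. c a j (d b k (m k (p j v))))"
    by (simp add: sum_subtractf U_def)
  also have "(\<Sum>k<n. \<Sum>j<n. c a j (d b k (m k (p j v)))) = (\<Sum>j<n. \<Sum>k<n. c a j (d b k (m k (p j v))))"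
    by (rule sum.swap)
  finally show ?thesis using 1 by simp
qed

text \<open>Common source of the rules for \<open>Dn\<close> and \<open>Cr\<close>: the even factor
  \<open>x k\<close> is \<open>p k\<close> or \<open>m k\<close>, and only its commuting with the
  odd operators matters.\<close>

lemma E_row:
  assumes "\<And>k a j w. x k (c a j w) = c a j (x k w)" "\<And>k a j w. x k (d a j w) = d a j (x k w)"
    and "\<And>k. Modules.additive (x k)"
  shows "E a b (\<Sum>k<n. c e k (x k v)) =
    (\<Sum>k<n. c e k (x k (E a b v))) + (if e = b then \<Sum>k<n. c a k (x k v) else 0)"
proof -
  have "E a b (\<Sum>k<n. c e k (x k v)) =
    (\<Sum>j<n. \<Sum>k<n. (if j = k then (if e = b then c a j (x k v) else 0) else 0)
     + c e k (c a j (d b j (x k v))))"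
    unfolding E_def op_sum
    by (intro sum.cong refl) (auto simp: dc op_linear cc[of a])
  also have "\<dots> = (if e = b then \<Sum>k<n. c a k (x k v) else 0) + (\<Sum>j<n. \<Sum>k<n. c e k (c a j (d b j (x k v))))"
    by (simp add: sum.distrib)
  also have "(\<Sum>j<n. \<Sum>k<n. c e k (c a j (d b j (x k v)))) = (\<Sum>k<n. c e k (x k (E a b v)))"
    unfolding E_def op_sum additive.sum[OF assms(3)] assms(1,2) by (rule sum.swap)
  finally show ?thesis by (simp add: add.commute)
qed

lemma E_Dn: "E a b (Dn e v) = Dn e (E a b v) + (if e = b then Dn a v else 0)"
  unfolding Dn_def by (rule E_row[OF pc pd additive_ops(3)])

lemma E_Cr: "E a b (Cr e v) = Cr e (E a b v) + (if e = b then Cr a v else 0)"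
  unfolding Cr_def by (rule E_row[OF mc md additive_ops(4)])

lemma E_Up: "E a b (Up e v) = Up e (E a b v) - (if e = a then Up b v else 0)"
proof -
  have cd: "c a j (d e k w) = (if e = a \<and> k = j then w else 0) - d e k (c a j w)" for j k w
    using dc[of e k a j w] by simp
  have "E a b (Up e v) = (\<Sum>j<n. \<Sum>k<n. d e k (c a j (d b j (m k v)))
     - (if j = k then (if e = a then d b j (m k v) else 0) else 0))"
    unfolding E_def Up_def op_sum
    by (intro sum.cong refl) (auto simp: dd[of b] cd op_linear)
  also have "\<dots> = (\<Sum>j<n. \<Sum>k<n. d e k (c a j (d b j (m k v)))) - (if e = a then Up b v else 0)"
    by (simp add: sum_subtractf Up_def)
  also have "(\<Sum>j<n. \<Sum>k<n. d e k (c a j (d b j (m k v)))) = Up e (E a b v)"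
    unfolding E_def Up_def op_sum by (subst sum.swap) (simp add: mc md)
  finally show ?thesis .
qed

lemma U_Dn: "U (Dn a v) + Dn a v = Dn a (U v)"
proof -
  have "Dn a (U v) = (\<Sum>j<n. \<Sum>k<n. c a j (m k (p k (p j v))) + (if j = k then c a j (p k v) else 0))"
    unfolding Dn_def U_def op_sum by (intro sum.cong refl) (auto simp: pm op_linear pp)
  also have "\<dots> = (\<Sum>j<n. \<Sum>k<n. c a j (m k (p k (p j v)))) + Dn a v"
    by (simp add: sum.distrib Dn_def)
  also have "(\<Sum>j<n. \<Sum>k<n. c a j (m k (p k (p j v)))) = U (Dn a v)"
    unfolding Dn_def U_def op_sum by (subst sum.swap) (simp add: pc mc)
  finally show ?thesis by simp
qed

lemma U_Up: "U (Up a v) = Up a (U v) + Up a v"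
proof -
  have "U (Up a v) = (\<Sum>k<n. \<Sum>j<n. d a j (m j (m k (p k v))) + (if k = j then d a j (m j v) else 0))"
    unfolding Up_def U_def op_sum by (intro sum.cong refl) (auto simp: pm md pd op_linear mm)
  also have "\<dots> = (\<Sum>k<n. \<Sum>j<n. d a j (m j (m k (p k v)))) + Up a v"
    by (simp add: sum.distrib Up_def)
  also have "(\<Sum>k<n. \<Sum>j<n. d a j (m j (m k (p k v)))) = Up a (U v)"
    unfolding Up_def U_def op_sum by (subst sum.swap) simp
  finally show ?thesis .
qed

lemma U_E: "U (E a b v) = E a b (U v)"
  unfolding U_def E_def op_sum by (subst sum.swap) (simp add: pc pd mc md)

lemma p_E: "p j (E a b v) = E a b (p j v)"
  unfolding E_def op_sum by (simp add: pc pd)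

lemma E_E: "E a b (E e f v) = E e f (E a b v) + (if e = b then E a f v else 0) - (if f = a then E e b v else 0)"
proof -
  have cd: "c a j (d f k w) = (if f = a \<and> k = j then w else 0) - d f k (c a j w)" for j k w
    using dc[of f k a j w] by simp
  have "E a b (E e f v) = (\<Sum>j<n. \<Sum>k<n. c e k (d f k (c a j (d b j v)))
     + (if j = k then (if e = b then c a j (d f k v) else 0) else 0)
     - (if j = k then (if f = a then c e k (d b j v) else 0) else 0))"
    unfolding E_def op_sum
    by (intro sum.cong refl) (auto simp: dc[of b _ e] op_linear cc[of a _ e] cd dd[of b _ f])
  also have "\<dots> = (\<Sum>j<n. \<Sum>k<n. c e k (d f k (c a j (d b j v))))
     + (if e = b then E a f v else 0) - (if f = a then E e b v else 0)"
    by (simp add: sum_subtractf sum.distrib E_def)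
  also have "(\<Sum>j<n. \<Sum>k<n. c e k (d f k (c a j (d b j v)))) = E e f (E a b v)"
    unfolding E_def op_sum by (subst sum.swap) simp
  finally show ?thesis .
qed

end

section \<open>Families of anticommuting operators\<close>

locale anticommuting =
  fixes X :: "nat \<Rightarrow> 'v::ab_group_add \<Rightarrow> 'v"
  assumes X_additive: "Modules.additive (X a)"
    and X_X: "X a (X b v) = - X b (X a v)"
    and two_torsion_free: "(v::'v) = - v \<Longrightarrow> v = 0"
begin

lemmas X_zero [simp] = X_additive[THEN additive.zero]
lemmas X_minus = X_additive[THEN additive.minus]
lemmas X_add = X_additive[THEN additive.add]

lemma X_square [simp]: "X a (X a v) = 0"
  using X_X[of a a v] by (rule two_torsion_free)

lemma foldr_X_0 [simp]: "foldr X as 0 = 0"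
  by (induction as) auto


lemma foldr_X_add: "foldr X as (v + w) = foldr X as v + foldr X as w"
  by (induction as) (auto simp: X_add)

lemma foldr_X_sum: "foldr X as (sum f A) = (\<Sum>i\<in>A. foldr X as (f i))"
  by (induction A rule: infinite_finite_induct) (auto simp: foldr_X_add)

lemma X_foldr_member: "a \<in> set as \<Longrightarrow> X a (foldr X as v) = 0"
proof (induction as)
  case (Cons b as)
  then show ?case by (cases "a = b") (auto simp: X_X[of a b])
qed simp

lemma foldr_X_not_distinct: "\<not> distinct as \<Longrightarrow> foldr X as v = 0"
  by (induction as) (auto simp: X_foldr_member)

lemma foldr_X_commute: "foldr X as (X a v) = X a (foldr X as v) \<or> foldr X as (X a v) = - X a (foldr X as v)"
  by (induction as) (auto simp: X_minus X_X[of a])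

text \<open>The order of the factors matters only up to sign, so a product known to vanish in one
  order may be peeled in another.\<close>

lemma foldr_X_rev: "foldr X (rev as) v = foldr X as v \<or> foldr X (rev as) v = - foldr X as v"
proof (induction as)
  case (Cons a as)
  have "foldr X (rev (a # as)) v = foldr X (rev as) (X a v)" by simp
  with Cons foldr_X_commute[of "rev as" a v] show ?case by (auto simp: X_minus)
qed simp

text \<open>The correction term vanishes, because its product contains \<open>X q\<close> twice.\<close>

lemma even_foldr_X:
  assumes F: "\<And>e v. F (X e v) = X e (F v) + (if e = p then s (X q v) else 0)"
    and s: "\<And>e v. s (X e v) = X e (s v)" "s 0 = 0"
    and pq: "p \<noteq> q" "q \<in> set as \<or> p \<notin> set as"
  shows "F (foldr X as v) = foldr X as (F v)"
proof (cases "distinct as")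
  case True
  have "F (foldr X as v) = foldr X as (F v) +
      (if p \<in> set as then s (foldr X (map (\<lambda>e. if e = p then q else e) as) v) else 0)"
    using True
  proof (induction as)
    case (Cons e as)
    have "map (\<lambda>e. if e = p then q else e) as = as" if "p \<notin> set as"
      using that by (intro map_idI) auto
    with Cons show ?case by (auto simp: F X_add s)
  qed simp
  moreover have "\<not> distinct (map (\<lambda>e. if e = p then q else e) as)" if p: "p \<in> set as"
  proof
    assume "distinct (map (\<lambda>e. if e = p then q else e) as)"
    then have "inj_on (\<lambda>e. if e = p then q else e) (set as)" by (simp add: distinct_map)
    from inj_onD[OF this, of p q] p pq show False by auto
  qed
  ultimately show ?thesis using foldr_X_not_distinct s(2) by auto
next
  case False
  have "F 0 = 0" using F[of q 0] pq(1) by (metis X_square X_zero add_cancel_right_right)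
  with False show ?thesis by (simp add: foldr_X_not_distinct)
qed

end

text \<open>
  The filtration \<open>F\<close> makes the raising operators \<open>E a b\<close>, \<open>a < b\<close>, nilpotent, and the assumptions
  \<open>pos\<close>, \<open>ker_sq\<close> say that the number operators \<open>E a a\<close> are semisimple and nonnegative.
\<close>

locale positive_oscillators = oscillators n c d p m
  for n c d p and m :: "nat \<Rightarrow> 'v::ab_group_add \<Rightarrow> 'v" +
  fixes r :: nat and F :: "nat \<Rightarrow> 'v set" and B :: nat
  assumes two_tf: "(v::'v) = - v \<Longrightarrow> v = 0"
    and F_0: "v \<in> F 0"
    and F_B: "v \<in> F B \<Longrightarrow> v = 0"
    and F_E: "\<lbrakk>a < b; b < r; v \<in> F w\<rbrakk> \<Longrightarrow> E a b v \<in> F (Suc w)"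
    and pos: "E a a v + (\<Sum>i<Suc s. v) = 0 \<Longrightarrow> v = 0"
    and ker_sq: "E a a (E a a v) = 0 \<Longrightarrow> E a a v = 0"
begin

sublocale Dn: anticommuting Dn
  by unfold_locales (rule Op_add | rule Dn_Dn | erule two_tf)+
sublocale Up: anticommuting Up
  by unfold_locales (rule Op_add | rule Up_Up | erule two_tf)+
sublocale Cr: anticommuting Cr
  by unfold_locales (rule Op_add | rule Cr_Cr | erule two_tf)+

lemma E_foldr_Dn: "\<lbrakk>a \<noteq> b; a \<in> set as \<or> b \<notin> set as\<rbrakk> \<Longrightarrow> E a b (foldr Dn as v) = foldr Dn as (E a b v)"
  by (rule Dn.even_foldr_X[where s = id and p = b and q = a]) (auto simp: E_Dn)

lemma E_foldr_Cr: "\<lbrakk>a \<noteq> b; a \<in> set as \<or> b \<notin> set as\<rbrakk> \<Longrightarrow> E a b (foldr Cr as v) = foldr Cr as (E a b v)"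
  by (rule Cr.even_foldr_X[where s = id and p = b and q = a]) (auto simp: E_Cr)

lemma E_foldr_Up: "\<lbrakk>a \<noteq> b; b \<in> set as \<or> a \<notin> set as\<rbrakk> \<Longrightarrow> E a b (foldr Up as v) = foldr Up as (E a b v)"
  by (rule Up.even_foldr_X[where s = uminus and p = a and q = b]) (auto simp: E_Up Op_minus)

text \<open>Take a nonzero vector of \<open>K\<close> as deep in the filtration as possible; a
  raising operator would lead to a still deeper vector of \<open>K\<close>, hence to 0.\<close>

lemma ex_highest_vector:
  assumes stable: "\<And>a b v. \<lbrakk>a < b; b < r; v \<in> K\<rbrakk> \<Longrightarrow> E a b v \<in> K"
    and "v \<in> K" "v \<noteq> 0"
  obtains w where "w \<in> K" "w \<noteq> 0" "\<And>a b. \<lbrakk>a < b; b < r\<rbrakk> \<Longrightarrow> E a b w = 0"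
proof -
  let ?Q = "\<lambda>k. \<exists>w\<in>K. w \<noteq> 0 \<and> w \<in> F k"
  have Q0: "?Q 0" using assms F_0 by blast
  have nQB: "\<not> ?Q B" using F_B by blast
  obtain k where k: "?Q k" "\<not> ?Q (Suc k)"
  proof -
    have "\<exists>k. ?Q k \<and> \<not> ?Q (Suc k)"
    proof (rule ccontr)
      assume "\<nexists>k. ?Q k \<and> \<not> ?Q (Suc k)"
      then have "?Q k" for k using Q0 by (induction k) blast+
      with nQB show False by blast
    qed
    with that show ?thesis by blast
  qed
  then obtain w where w: "w \<in> K" "w \<noteq> 0" "w \<in> F k" by blast
  have "E a b w = 0" if "a < b" "b < r" for a b
    using stable[OF that w(1)] F_E[OF that w(3)] k(2) by blast
  with w that show ?thesis by blast
qed

text \<open>Each \<open>Up\<close> raises the degree in u by one. The type of vectors carries only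
  addition, so a multiple of a vector is written as a sum of copies.\<close>

lemma U_foldr_Up: "U v = 0 \<Longrightarrow> U (foldr Up as v) = (\<Sum>i<length as. foldr Up as v)"
  by (induction as) (auto simp: U_Up Op_sum)

lemma U_foldr_Dn:
  assumes "U v = (\<Sum>i<k. v)" "length as \<le> k"
  shows "U (foldr Dn as v) = (\<Sum>i<k - length as. foldr Dn as v)"
  using assms(2)
proof (induction as)
  case (Cons a as)
  let ?w = "foldr Dn as v"
  have "k - length as = Suc (k - length (a # as))" using Cons.prems by simp
  then have "U (Dn a ?w) + Dn a ?w = (\<Sum>i<Suc (k - length (a # as)). Dn a ?w)"
    using Cons by (simp only: U_Dn) (simp add: Op_sum Op_add)
  then show ?case by simp
qed (use assms in auto)

text \<open>The outermost factor has the largest row index. Its adjoint \<open>Up k\<close> meets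
  only factors \<open>Dn b\<close> with b < k, where the commutator \<open>E b k\<close> is a
  raising operator and dies on a highest vector. So the adjoint removes the outermost factor up to
  \<open>E k k + U\<close>.\<close>

lemma peel_Dn:
  assumes "\<And>a. a < r \<Longrightarrow> Up a v = 0" "\<And>a b. \<lbrakk>a < b; b < r\<rbrakk> \<Longrightarrow> E a b v = 0"
    and "U v = (\<Sum>i<r. v)" "k \<le> r" "foldr Dn (rev [0..<k]) v = 0"
  shows "v = 0"
  using assms(4,5)
proof (induction k)
  case (Suc k)
  let ?w = "foldr Dn (rev [0..<k]) v"
  have Up0: "Up k (foldr Dn as v) = 0" if "set as \<subseteq> {..<k}" for as
    using that
  proof (induction as)
    case (Cons b as)
    have "E b k (foldr Dn as v) = foldr Dn as (E b k v)"
      using Cons.prems by (intro E_foldr_Dn) auto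
    also have "\<dots> = 0" using assms(2)[of b k] Cons.prems Suc.prems by simp
    finally show ?case using Dn_Up[of b k "foldr Dn as v"] Cons by simp
  qed (use assms(1) Suc.prems in auto)
  have "Up k ?w = 0" by (rule Up0) auto
  moreover have "Dn k ?w = 0" using Suc.prems by simp
  ultimately have "E k k ?w + U ?w = 0" using Dn_Up[of k k ?w] by simp
  \<comment> \<open>Only k < r factors have been applied to a vector of degree r, so a positive
    degree is left; it is written as a successor to fit \<open>pos\<close>.\<close>
  moreover have "U ?w = (\<Sum>i<Suc (r - Suc k). ?w)"
    using U_foldr_Dn[OF assms(3), of "rev [0..<k]"] Suc.prems by (simp add: Suc_diff_Suc)
  ultimately have "?w = 0" by (metis pos)
  then show ?case using Suc by simp
qed simp

text \<open>The hypotheses define a space stable under the raising operators. A nonzero member would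
  produce a nonzero highest vector in it, which \<open>peel_Dn\<close> excludes.\<close>

theorem Dn_injective:
  assumes "\<And>a. a < r \<Longrightarrow> Up a v = 0" "U v = (\<Sum>i<r. v)" "foldr Dn (rev [0..<r]) v = 0"
  shows "v = 0"
proof (rule ccontr)
  assume "v \<noteq> 0"
  define K where "K = {v. (\<forall>a<r. Up a v = 0) \<and> U v = (\<Sum>i<r. v) \<and> foldr Dn (rev [0..<r]) v = 0}"
  have stable: "E a b v \<in> K" if "a < b" "b < r" "v \<in> K" for a b v
  proof -
    have "Up e (E a b v) = 0" if "e < r" for e
      using E_Up[of a b e v] \<open>v \<in> K\<close> that \<open>b < r\<close> by (auto simp: K_def split: if_splits)
    moreover have "U (E a b v) = (\<Sum>i<r. E a b v)"
      using \<open>v \<in> K\<close> by (simp add: U_E K_def Op_sum)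
    moreover have "foldr Dn (rev [0..<r]) (E a b v) = 0"
      using E_foldr_Dn[of a b "rev [0..<r]" v] that by (simp add: K_def)
    ultimately show ?thesis by (simp add: K_def)
  qed
  have "v \<in> K" using assms by (simp add: K_def)
  then obtain w where "w \<in> K" "w \<noteq> 0" "\<And>a b. \<lbrakk>a < b; b < r\<rbrakk> \<Longrightarrow> E a b w = 0"
    using ex_highest_vector[OF stable] \<open>v \<noteq> 0\<close> by blast
  then show False using peel_Dn[of w r] by (auto simp: K_def)
qed

text \<open>Mirror image of \<open>peel_Dn\<close>: the outermost factor now has the smallest row
  index, so that the commutator \<open>E k b\<close> with an inner factor, k < b, is again raising.
  The vector starts in degree 0, and the degree grows with the number of factors.\<close>

lemma peel_Up:
  assumes p: "\<And>j. j < n \<Longrightarrow> p j v = 0" and "\<And>a b. \<lbrakk>a < b; b < r\<rbrakk> \<Longrightarrow> E a b v = 0"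
    and "k < r" "foldr Up [k..<r] v = 0"
  shows "E (r - 1) (r - 1) v = 0"
proof -
  have U0: "U v = 0" and Dn0: "Dn a v = 0" for a by (simp_all add: U_def Dn_def p)
  show ?thesis using assms(3,4)
  proof (induction "r - 1 - k" arbitrary: k)
    case (0 k)
    \<comment> \<open>For the innermost factor the degree is still 0. \<open>U\<close> contributes
      nothing, so only the vanishing of the number operator can be concluded, not that of v.\<close>
    then have "k = r - 1" by simp
    with 0 have "Up k v = 0" by (simp add: upt_rec)
    then show ?case using Dn_Up[of k k v] U0 Dn0 \<open>k = r - 1\<close> by simp
  next
    case (Suc s k)
    let ?w = "foldr Up [Suc k..<r] v"
    have Dn0': "Dn k (foldr Up as v) = 0" if "set as \<subseteq> {k<..<r}" for as
      using that
    proof (induction as)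
      case (Cons b as)
      have "E k b (foldr Up as v) = foldr Up as (E k b v)"
        using Cons.prems by (intro E_foldr_Up) auto
      also have "\<dots> = 0" using assms(2)[of k b] Cons.prems by simp
      finally show ?case using Dn_Up[of k b "foldr Up as v"] Cons by simp
    qed (use Dn0 in auto)
    have "Dn k ?w = 0" by (rule Dn0') auto
    moreover have "Up k ?w = 0" using Suc.prems by (simp add: upt_rec[of k])
    ultimately have "E k k ?w + U ?w = 0" using Dn_Up[of k k ?w] by simp
    moreover have "U ?w = (\<Sum>i<Suc s. ?w)"
      using U_foldr_Up[OF U0, of "[Suc k..<r]"] Suc.hyps(2) by (simp add: algebra_simps)
    ultimately have "?w = 0" by (metis pos)
    moreover have "s = r - 1 - Suc k" "Suc k < r" using Suc.hyps(2) by auto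
    ultimately show ?case using Suc.hyps(1) by blast
  qed
qed

text \<open>The kernel \<open>K\<close> may well contain highest vectors with eigenvalue 0 of
  \<open>E (r - 1) (r - 1)\<close>. The argument therefore looks for a highest vector in the image
  of that operator on \<open>K\<close>, where by semisimplicity the eigenvalue 0 does not
  occur.\<close>

theorem Up_kernel:
  assumes "r > 0" "\<And>j. j < n \<Longrightarrow> p j v = 0" "\<And>a. a < r - 1 \<Longrightarrow> E a (r - 1) v = 0"
    and "foldr Up [0..<r] v = 0"
  shows "E (r - 1) (r - 1) v = 0"
proof (rule ccontr)
  let ?l = "r - 1"
  assume nz: "E ?l ?l v \<noteq> 0"
  define K where "K = {v. (\<forall>j<n. p j v = 0) \<and> (\<forall>a<?l. E a ?l v = 0) \<and> foldr Up [0..<r] v = 0}"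
  have stable: "E a b v \<in> K" if "a < ?l" "b < r" "a \<noteq> b" "v \<in> K" for a b v
  proof -
    have "p j (E a b v) = 0" if "j < n" for j
      using \<open>v \<in> K\<close> that by (simp add: K_def p_E)
    moreover have "E e ?l (E a b v) = 0" if "e < ?l" for e
      using E_E[of a b e ?l v] \<open>v \<in> K\<close> \<open>a < ?l\<close> that by (auto simp: K_def split: if_splits)
    moreover have "foldr Up [0..<r] (E a b v) = 0"
      using E_foldr_Up[of a b "[0..<r]" v] that by (simp add: K_def)
    ultimately show ?thesis by (simp add: K_def)
  qed
  have El: "E ?l ?l v \<in> K" if "v \<in> K" for v
  proof -
    have "p j (E ?l ?l v) = 0" if "j < n" for j
      using \<open>v \<in> K\<close> that by (simp add: K_def p_E)
    moreover have "E e ?l (E ?l ?l v) = 0" if "e < ?l" for e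
      using E_E[of e ?l ?l ?l v] \<open>v \<in> K\<close> that by (auto simp: K_def)
    moreover have "foldr Up as (E ?l ?l v) = E ?l ?l (foldr Up as v) + (if ?l \<in> set as then foldr Up as v else 0)"
      if "distinct as" for as using that
      by (induction as) (auto simp: E_Up Op_add Up.foldr_X_add)
    ultimately show ?thesis using \<open>v \<in> K\<close> by (simp add: K_def)
  qed
  have stable2: "E a b w \<in> E ?l ?l ` K" if ab: "a < b" "b < r" and w: "w \<in> E ?l ?l ` K" for a b w
  proof -
    obtain v where v: "v \<in> K" "w = E ?l ?l v" using w by blast
    have "a < ?l" using ab by auto
    \<comment> \<open>The commutator with the number operator is zero or \<open>E a ?l\<close>,
      which annihilates \<open>K\<close>.\<close>
    then have "E a b w = E ?l ?l (E a b v)"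
      using E_E[of a b ?l ?l v] v(1) by (auto simp: v(2) K_def)
    moreover have "E a b v \<in> K" using stable[of a b v] ab v \<open>a < ?l\<close> by auto
    ultimately show ?thesis by blast
  qed
  have "v \<in> K" using assms by (simp add: K_def)
  then have "E ?l ?l v \<in> E ?l ?l ` K" by blast
  from ex_highest_vector[OF stable2 this nz]
  obtain w where w: "w \<in> E ?l ?l ` K" "w \<noteq> 0" "\<And>a b. \<lbrakk>a < b; b < r\<rbrakk> \<Longrightarrow> E a b w = 0" by blast
  then obtain u where u: "u \<in> K" "w = E ?l ?l u" by blast
  have "w \<in> K" using El u by simp
  then have "E ?l ?l w = 0" using peel_Up[of w 0] w(3) assms(1) by (simp add: K_def)
  then have "w = 0" using ker_sq u(2) by simp
  with w(2) show False by simp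
qed

end

subsection \<open>Parity\<close>

inductive has_parity :: "'g::superletter set \<Rightarrow> bool \<Rightarrow> 'g supercomm \<Rightarrow> bool" for L where
  has_parity_zero: "has_parity L e 0"
| has_parity_one: "has_parity L False 1"
| has_parity_letter: "\<lbrakk>x \<in> L; has_parity L e f\<rbrakk> \<Longrightarrow> has_parity L (e \<noteq> odd_letter x) (sc_letter x * f)"
| has_parity_add: "\<lbrakk>has_parity L e f; has_parity L e g\<rbrakk> \<Longrightarrow> has_parity L e (f + g)"

lemma has_parity_sum: "(\<And>i. i \<in> A \<Longrightarrow> has_parity L e (f i)) \<Longrightarrow> has_parity L e (sum f A)"
  by (induction A rule: infinite_finite_induct) (auto intro: has_parity.intros)

lemma has_parity_of_nat: "has_parity L e f \<Longrightarrow> has_parity L e (of_nat k * f)"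
  by (induction k) (auto intro: has_parity.intros simp: distrib_right)

lemma has_parity_carrier: "has_parity L e f \<Longrightarrow> f \<in> carrier (free_supercomm L)"
  by (induction rule: has_parity.induct)
    (auto intro: free_supercomm_closed free_supercomm_letter)

lemma has_parity_mono: "has_parity L e f \<Longrightarrow> L \<subseteq> L' \<Longrightarrow> has_parity L' e f"
proof (induction rule: has_parity.induct)
  case (has_parity_letter x e f)
  then show ?case by (intro has_parity.has_parity_letter) auto
qed (auto intro: has_parity.intros)

lemma letter_mult_has_parity:
  assumes "has_parity L e f"
  shows "sc_letter x * f = (if odd_letter x \<and> e then - (f * sc_letter x) else f * sc_letter x)"
  using assms
proof (induction rule: has_parity.induct)
  case (has_parity_letter y e f)
  have "sc_letter x * (sc_letter y * f) = (if odd_letter x \<and> odd_letter y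
     then - (sc_letter y * (sc_letter x * f)) else sc_letter y * (sc_letter x * f))"
    by (rule letter_supercommute_left)
  then show ?case unfolding has_parity_letter.IH by (auto simp: mult.assoc)
qed (auto simp: distrib_left distrib_right)

lemma has_parity_supercommute:
  assumes "has_parity L e f" "has_parity L' e' g"
  shows "f * g = (if e \<and> e' then - (g * f) else g * f)"
  using assms(1)
proof (induction rule: has_parity.induct)
  case (has_parity_letter x e f)
  have "sc_letter x * f * g = sc_letter x * (f * g)" by (rule mult.assoc)
  also have "\<dots> = (if e \<and> e' then - (sc_letter x * g * f) else sc_letter x * g * f)"
    unfolding has_parity_letter.IH by (auto simp: mult.assoc)
  finally show ?case unfolding letter_mult_has_parity[OF assms(2)]
    by (auto simp: mult.assoc split: if_splits)
qed (auto simp: distrib_left distrib_right)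

lemma respects_parityI:
  assumes "\<And>x. x \<in> L \<Longrightarrow> has_parity L' (odd_letter x) (\<phi> x)"
  shows "respects_parity L \<phi>"
  unfolding respects_parity_def by (intro ballI has_parity_supercommute[where L = L' and L' = L'] assms)

lemma has_parity_letterI: "x \<in> L \<Longrightarrow> has_parity L (odd_letter x) (sc_letter x)"
  using has_parity_letter[of x L False 1] has_parity_one[of L] by simp

lemma deriv_has_parity_mult:
  assumes "has_parity L e f" "x \<notin> L"
  shows "sc_deriv x (f * g) = (if odd_letter x \<and> e then - (f * sc_deriv x g) else f * sc_deriv x g)"
  using assms(1)
proof (induction rule: has_parity.induct)
  case (has_parity_letter y e f)
  then have "x \<noteq> y" using assms(2) by auto
  from sc_deriv_letter_mult_other[OF this, of "f * g"] show ?case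
    unfolding mult.assoc has_parity_letter.IH by auto
qed (auto simp: distrib_left distrib_right sc_deriv_add)

subsection \<open>Gradings\<close>

definition wt_mset :: "('a \<Rightarrow> nat) \<Rightarrow> 'a multiset \<Rightarrow> nat" where
  "wt_mset wt M = (\<Sum>x\<in>#M. wt x)"

lemma wt_mset_simps [simp]:
  "wt_mset wt {#} = 0" "wt_mset wt (add_mset x M) = wt x + wt_mset wt M"
  "wt_mset wt (A + B) = wt_mset wt A + wt_mset wt B"
  by (simp_all add: wt_mset_def)

definition homogeneous :: "('g \<Rightarrow> nat) \<Rightarrow> nat \<Rightarrow> 'g::superletter supercomm \<Rightarrow> bool" where
  "homogeneous wt k f \<longleftrightarrow> (\<forall>M. sc_coeff f M \<noteq> 0 \<longrightarrow> wt_mset wt M = k)"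

lemma homogeneous_0 [simp]: "homogeneous wt k 0"
  by (simp add: homogeneous_def)

lemma homogeneous_1 [simp]: "homogeneous wt 0 1"
  by (simp add: homogeneous_def one_supercomm.rep_eq)

lemma homogeneous_letter: "homogeneous wt (wt x) (sc_letter x)"
  by (simp add: homogeneous_def sc_letter.rep_eq)

lemma homogeneous_add: "\<lbrakk>homogeneous wt k f; homogeneous wt k g\<rbrakk> \<Longrightarrow> homogeneous wt k (f + g)"
  unfolding homogeneous_def by (metis sc_coeff_add add.right_neutral)

lemma homogeneous_minus: "homogeneous wt k f \<Longrightarrow> homogeneous wt k (- f)"
  by (simp add: homogeneous_def)

lemma homogeneous_diff: "\<lbrakk>homogeneous wt k f; homogeneous wt k g\<rbrakk> \<Longrightarrow> homogeneous wt k (f - g)"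
  using homogeneous_add[OF _ homogeneous_minus, of wt k f g] by simp

lemma homogeneous_scale: "homogeneous wt k f \<Longrightarrow> homogeneous wt k (sc_scalar c * f)"
  by (simp add: homogeneous_def)

lemma homogeneous_of_nat: "homogeneous wt k f \<Longrightarrow> homogeneous wt k (of_nat c * f)"
  using homogeneous_scale[of wt k f "of_nat c"] by (simp only: sc_scalar_of_nat)

lemma homogeneous_sum: "(\<And>i. i \<in> A \<Longrightarrow> homogeneous wt k (f i)) \<Longrightarrow> homogeneous wt k (sum f A)"
  by (induction A rule: infinite_finite_induct) (auto intro: homogeneous_add)

lemma sc_coeff_times_nonzero:
  assumes "sc_coeff (f * g) M \<noteq> 0"
  obtains A B where "M = A + B" "sc_coeff f A \<noteq> 0" "sc_coeff g B \<noteq> 0"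
proof -
  have "(\<Sum>(A, B)\<in>splittings M. koszul_sign A B * sc_coeff f A * sc_coeff g B) \<noteq> 0"
    using assms unfolding sc_coeff_times by meson
  then obtain q where "q \<in> splittings M"
    "(case q of (A, B) \<Rightarrow> koszul_sign A B * sc_coeff f A * sc_coeff g B) \<noteq> 0"
    by (meson sum.not_neutral_contains_not_neutral)
  then show ?thesis using that by (auto simp: splittings_def)
qed

lemma homogeneous_mult:
  assumes "homogeneous wt k f" "homogeneous wt l g"
  shows "homogeneous wt (k + l) (f * g)"
  unfolding homogeneous_def
proof (intro allI impI)
  fix M assume "sc_coeff (f * g) M \<noteq> 0"
  then obtain A B where "M = A + B" "sc_coeff f A \<noteq> 0" "sc_coeff g B \<noteq> 0"
    by (rule sc_coeff_times_nonzero)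
  then show "wt_mset wt M = k + l" using assms by (simp add: homogeneous_def)
qed

lemma homogeneous_deriv:
  assumes "homogeneous wt k f" shows "homogeneous wt (k - wt x) (sc_deriv x f)"
  unfolding homogeneous_def
proof (intro allI impI)
  fix M assume "sc_coeff (sc_deriv x f) M \<noteq> 0"
  then have "sc_coeff f (add_mset x M) \<noteq> 0" by (auto simp: sc_coeff_deriv)
  then have "wt x + wt_mset wt M = k" using assms unfolding homogeneous_def by fastforce
  then show "wt_mset wt M = k - wt x" by simp
qed


lift_definition graded_part :: "('g \<Rightarrow> nat) \<Rightarrow> nat \<Rightarrow> 'g::superletter supercomm \<Rightarrow> 'g supercomm"
  is "\<lambda>wt k f M. if wt_mset wt M = k then f M else 0"
proof -
  fix wt :: "'g \<Rightarrow> nat" and k and f :: "'g multiset \<Rightarrow> complex"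
  assume *: "finite {M. f M \<noteq> 0} \<and> (\<forall>M. f M \<noteq> 0 \<longrightarrow> sc_monomial M)"
  have "{M. (if wt_mset wt M = k then f M else 0) \<noteq> 0} \<subseteq> {M. f M \<noteq> 0}" by auto
  with * show "finite {M. (if wt_mset wt M = k then f M else 0) \<noteq> 0} \<and>
    (\<forall>M. (if wt_mset wt M = k then f M else 0) \<noteq> 0 \<longrightarrow> sc_monomial M)"
    by (auto intro: finite_subset)
qed

lemma homogeneous_graded_part: "homogeneous wt k (graded_part wt k f)"
  by (simp add: homogeneous_def graded_part.rep_eq)

lemma graded_part_add: "graded_part wt k (f + g) = graded_part wt k f + graded_part wt k g"
  by (rule supercomm_eqI) (simp add: graded_part.rep_eq)

lemma graded_part_scale: "graded_part wt k (sc_scalar c * f) = sc_scalar c * graded_part wt k f"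
  by (rule supercomm_eqI) (simp add: graded_part.rep_eq)

lemma graded_part_0 [simp]: "graded_part wt k 0 = 0"
  by (rule supercomm_eqI) (simp add: graded_part.rep_eq)

lemma graded_part_1: "graded_part wt k 1 = (if k = 0 then 1 else 0)"
  by (rule supercomm_eqI) (auto simp: graded_part.rep_eq one_supercomm.rep_eq)

lemma graded_part_carrier:
  "f \<in> carrier (free_supercomm L) \<Longrightarrow> graded_part wt k f \<in> carrier (free_supercomm L)"
  by (simp add: in_free_supercomm graded_part.rep_eq)

lemma graded_part_mult:
  assumes "homogeneous wt k g"
  shows "graded_part wt d (g * f) = (if k \<le> d then g * graded_part wt (d - k) f else 0)"
proof (rule supercomm_eqI)
  fix M
  have A: "wt_mset wt A = k" if "sc_coeff g A \<noteq> 0" for A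
    using assms that by (simp add: homogeneous_def)
  have "(if wt_mset wt M = d then sc_coeff (g * f) M else 0) =
      (if k \<le> d then sc_coeff (g * graded_part wt (d - k) f) M else 0)"
  proof (cases "sc_monomial M")
    case True
    have "(if wt_mset wt M = d then koszul_sign A B * sc_coeff g A * sc_coeff f B else 0) =
      (if k \<le> d then koszul_sign A B * sc_coeff g A * sc_coeff (graded_part wt (d - k) f) B else 0)"
      if "(A, B) \<in> splittings M" for A B
      using that A[of A] by (cases "sc_coeff g A = 0") (auto simp: splittings_def graded_part.rep_eq)
    then have "(\<Sum>(A, B)\<in>splittings M. if wt_mset wt M = d then koszul_sign A B * sc_coeff g A * sc_coeff f B else 0)
      = (\<Sum>(A, B)\<in>splittings M.
          if k \<le> d then koszul_sign A B * sc_coeff g A * sc_coeff (graded_part wt (d - k) f) B else 0)"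
      by (intro sum.cong) auto
    then show ?thesis using True by (auto simp: sc_coeff_times)
  qed (simp add: sc_coeff_times)
  then show "sc_coeff (graded_part wt d (g * f)) M =
      sc_coeff (if k \<le> d then g * graded_part wt (d - k) f else 0) M"
    by (simp add: graded_part.rep_eq)
qed

lemma sum_graded_parts: "\<exists>D. f = (\<Sum>k\<le>D. graded_part wt k f)"
proof -
  let ?S = "wt_mset wt ` {M. sc_coeff f M \<noteq> 0}"
  \<comment> \<open>For f = 0 the maximum of the empty set is unspecified, but then every graded
    part is 0.\<close>
  have "f = (\<Sum>k\<le>Max ?S. graded_part wt k f)"
  proof (rule supercomm_eqI)
    fix M
    have "wt_mset wt M \<le> Max ?S" if "sc_coeff f M \<noteq> 0"
      using that finite_support[of f] by (intro Max_ge) auto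
    then show "sc_coeff f M = sc_coeff (\<Sum>k\<le>Max ?S. graded_part wt k f) M"
      by (auto simp: sc_coeff_sum graded_part.rep_eq)
  qed
  then show ?thesis by blast
qed

lemma graded_part_subst:
  assumes \<phi>: "respects_parity L \<phi>" "\<And>x. x \<in> L \<Longrightarrow> homogeneous wt' (wt x) (\<phi> x)"
    and "f \<in> carrier (free_supercomm L)"
  shows "sc_subst \<phi> (graded_part wt d f) = graded_part wt' d (sc_subst \<phi> f)"
  using assms(3)
proof (induction arbitrary: d rule: free_supercomm_induct)
  case (letter x f)
  then show ?case
    using graded_part_mult[OF homogeneous_letter[of wt x], of d f]
      graded_part_mult[OF \<phi>(2)[OF letter(1)], of d "sc_subst \<phi> f"]
      sc_subst_letter_mult[OF \<phi>(1) letter(1)] graded_part_carrier[OF letter(2)]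
    by simp
qed (simp_all add: graded_part_add graded_part_scale sc_subst_add sc_subst_scale graded_part_1)

subsection \<open>Inner products\<close>

definition pairing ::
  "('g multiset \<Rightarrow> real) \<Rightarrow> 'g::superletter supercomm \<Rightarrow> 'g supercomm \<Rightarrow> complex" where
  "pairing W f g = (\<Sum>M | sc_coeff f M \<noteq> 0. of_real (W M) * cnj (sc_coeff f M) * sc_coeff g M)"

lemma pairing_sum:
  assumes "finite S" "{M. sc_coeff f M \<noteq> 0} \<subseteq> S"
  shows "pairing W f g = (\<Sum>M\<in>S. of_real (W M) * cnj (sc_coeff f M) * sc_coeff g M)"
  unfolding pairing_def by (rule sum.mono_neutral_left) (use assms in auto)

lemma pairing_add_right: "pairing W f (g + h) = pairing W f g + pairing W f h"
  by (simp add: pairing_def algebra_simps sum.distrib)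


lemma pairing_diff_right: "pairing W f (g - h) = pairing W f g - pairing W f h"
  by (simp add: pairing_def algebra_simps sum_subtractf)

lemma pairing_0_right [simp]: "pairing W f 0 = 0"
  by (simp add: pairing_def)

lemma pairing_0_left [simp]: "pairing W 0 f = 0"
  by (simp add: pairing_def)

lemma pairing_sum_right: "pairing W f (sum g A) = (\<Sum>i\<in>A. pairing W f (g i))"
  by (induction A rule: infinite_finite_induct) (auto simp: pairing_add_right)

lemma pairing_scale_right: "pairing W f (sc_scalar c * g) = c * pairing W f g"
  by (simp add: pairing_def sum_distrib_left mult_ac)

lemma pairing_add_left: "pairing W (f + g) h = pairing W f h + pairing W g h"
proof -
  let ?S = "{M. sc_coeff f M \<noteq> 0} \<union> {M. sc_coeff g M \<noteq> 0}"
  have S: "finite ?S" using finite_support by auto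
  show ?thesis
    by (subst (1 2 3) pairing_sum[OF S]) (auto simp: algebra_simps sum.distrib)
qed

lemma pairing_scale_left: "pairing W (sc_scalar c * f) g = cnj c * pairing W f g"
proof -
  have S: "finite {M. sc_coeff f M \<noteq> 0}" by (rule finite_support)
  show ?thesis
    by (subst (1 2) pairing_sum[OF S]) (auto simp: sum_distrib_left mult_ac)
qed

lemma pairing_minus_left: "pairing W (- f) g = - pairing W f g"
  using pairing_scale_left[of W "-1" f g] by (simp add: sc_scalar_minus)

lemma pairing_sum_left: "pairing W (sum f A) g = (\<Sum>i\<in>A. pairing W (f i) g)"
  by (induction A rule: infinite_finite_induct) (auto simp: pairing_add_left)

lemma pairing_self_eq_0:
  assumes W: "\<And>M. W M > 0" and "pairing W f f = 0" shows "f = 0"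
proof -
  have sq: "cnj z * z = of_real ((cmod z)\<^sup>2)" for z
    by (metis complex_norm_square mult.commute)
  have "pairing W f f = of_real (\<Sum>M | sc_coeff f M \<noteq> 0. W M * (cmod (sc_coeff f M))\<^sup>2)"
    unfolding pairing_def of_real_sum
    by (intro sum.cong refl) (simp only: mult.assoc sq of_real_mult)
  then have "(\<Sum>M | sc_coeff f M \<noteq> 0. W M * (cmod (sc_coeff f M))\<^sup>2) = 0" using assms(2) by (metis of_real_eq_0_iff)
  then have "\<forall>M\<in>{M. sc_coeff f M \<noteq> 0}. W M * (cmod (sc_coeff f M))\<^sup>2 = 0"
    by (subst (asm) sum_nonneg_eq_0_iff) (auto simp: finite_support W less_imp_le)
  then have "sc_coeff f M = 0" for M using W[of M] by (cases "sc_coeff f M = 0") auto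
  then show ?thesis by (intro supercomm_eqI) simp
qed

text \<open>Gram-Schmidt by induction on the admissible monomials: the elements of \<open>I\<close>
  whose coefficient at one chosen monomial vanishes form a subspace of codimension at most
  one.\<close>

lemma orthogonal_decomposition:
  assumes "finite S" and W: "\<And>M. W M > 0"
    and I: "0 \<in> I" "\<And>f g. \<lbrakk>f \<in> I; g \<in> I\<rbrakk> \<Longrightarrow> f + g \<in> I" "\<And>c f. f \<in> I \<Longrightarrow> sc_scalar c * f \<in> I"
    and S: "\<And>f. f \<in> I \<Longrightarrow> {M. sc_coeff f M \<noteq> 0} \<subseteq> S"
  shows "\<exists>y\<in>I. \<forall>w\<in>I. pairing W w (f - y) = 0"
  using assms(1) I S
proof (induction S arbitrary: I f)
  case empty
  then have "w = 0" if "w \<in> I" for w using that by (intro supercomm_eqI) auto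
  then have "\<forall>w\<in>I. pairing W w (f - 0) = 0" by (metis pairing_0_left)
  then show ?case using empty(1) by blast
next
  case (insert s S)
  have diff: "g - h \<in> I" if "g \<in> I" "h \<in> I" for g h
    using insert.prems(2)[OF that(1) insert.prems(3)[OF that(2), of "-1"]]
    by (simp add: sc_scalar_minus)
  let ?I0 = "{f \<in> I. sc_coeff f s = 0}"
  have IH: "\<exists>y\<in>?I0. \<forall>w\<in>?I0. pairing W w (g - y) = 0" for g
  proof (rule insert.IH)
    show "{M. sc_coeff h M \<noteq> 0} \<subseteq> S" if "h \<in> ?I0" for h
      using insert.prems(4)[of h] that by auto
  qed (use insert.prems in auto)
  show ?case
  proof (cases "?I0 = I")
    case True
    then show ?thesis using IH by simp
  next
    case False
    then obtain g where g: "g \<in> I" "sc_coeff g s \<noteq> 0" by auto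
    obtain yg where yg: "yg \<in> ?I0" "\<And>w. w \<in> ?I0 \<Longrightarrow> pairing W w (g - yg) = 0" using IH by blast
    obtain y1 where y1: "y1 \<in> ?I0" "\<And>w. w \<in> ?I0 \<Longrightarrow> pairing W w (f - y1) = 0" using IH by blast
    \<comment> \<open>The part of g orthogonal to \<open>?I0\<close>; together with
      \<open>?I0\<close> it spans \<open>I\<close>, so projecting onto \<open>I\<close> needs one
      further coefficient \<open>t\<close>.\<close>
    define e where "e = g - yg"
    have e: "e \<in> I" "sc_coeff e s \<noteq> 0" using g yg diff by (auto simp: e_def)
    then have ee: "pairing W e e \<noteq> 0" using pairing_self_eq_0[where W = W and f = e] W by auto
    define t where "t = pairing W e (f - y1) / pairing W e e"
    let ?y = "y1 + sc_scalar t * e"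
    have f_y: "f - ?y = (f - y1) - sc_scalar t * e" by simp
    have "pairing W w (f - ?y) = 0" if w: "w \<in> I" for w
    proof -
      define u where "u = sc_coeff w s / sc_coeff e s"
      define w0 where "w0 = w - sc_scalar u * e"
      have w0: "w0 \<in> ?I0" using diff[OF w insert.prems(3)[OF e(1)]] e(2)
        by (simp add: w0_def u_def)
      have "w = w0 + sc_scalar u * e" by (simp add: w0_def)
      then have "pairing W w (f - ?y) = pairing W w0 (f - ?y) + cnj u * pairing W e (f - ?y)"
        by (simp only: pairing_add_left pairing_scale_left)
      moreover have "pairing W w0 (f - ?y) = 0"
        unfolding f_y pairing_diff_right pairing_scale_right
        using y1(2)[OF w0] yg(2)[OF w0] by (simp add: e_def pairing_diff_right)
      moreover have "pairing W e (f - ?y) = 0"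
        unfolding f_y pairing_diff_right pairing_scale_right using ee by (simp add: t_def pairing_diff_right)
      ultimately show ?thesis by simp
    qed
    moreover have "?y \<in> I" using y1 e insert.prems by simp
    ultimately show ?thesis by blast
  qed
qed

text \<open>The weights for which the derivatives are adjoint to the letters, up to the scales \<open>c x\<close>.\<close>

definition mono_weight :: "('g \<Rightarrow> real) \<Rightarrow> 'g multiset \<Rightarrow> real" where
  "mono_weight c M = (\<Prod>x\<in>#M. c x) * (\<Prod>x\<in>set_mset M. fact (count M x))"

lemma mono_weight_pos: "(\<And>x. c x > 0) \<Longrightarrow> mono_weight c M > 0"
proof -
  assume c: "\<And>x. c x > 0"
  have "(\<Prod>x\<in>#M. c x) > 0" by (induction M) (simp_all add: c)
  then show ?thesis by (simp add: mono_weight_def prod_pos)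
qed

lemma prod_fact_count_add_mset:
  "(\<Prod>y\<in>set_mset (add_mset x M). fact (count (add_mset x M) y) :: 'b::{semiring_char_0, comm_semiring_1}) =
     of_nat (Suc (count M x)) * (\<Prod>y\<in>set_mset M. fact (count M y))"
proof -
  have eq: "(\<Prod>y\<in>set_mset M - {x}. fact (count (add_mset x M) y) :: 'b)
      = (\<Prod>y\<in>set_mset M - {x}. fact (count M y))"
    by (intro prod.cong) auto
  have "(\<Prod>y\<in>set_mset (add_mset x M). fact (count (add_mset x M) y) :: 'b) =
      fact (count (add_mset x M) x) * (\<Prod>y\<in>set_mset M - {x}. fact (count (add_mset x M) y))"
    by (simp only: set_mset_add_mset_insert prod.insert_remove finite_set_mset)
  also have "\<dots> = fact (Suc (count M x)) * (\<Prod>y\<in>set_mset M - {x}. fact (count M y))"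
    unfolding eq by (simp del: fact_Suc)
  also have "\<dots> = of_nat (Suc (count M x)) * (fact (count M x) * (\<Prod>y\<in>set_mset M - {x}. fact (count M y)))"
    by (simp only: fact_Suc mult.assoc)
  also have "fact (count M x) * (\<Prod>y\<in>set_mset M - {x}. fact (count M y)) =
      (\<Prod>y\<in>set_mset M. fact (count M y) :: 'b)"
    by (cases "x \<in># M") (simp_all add: prod.remove not_in_iff)
  finally show ?thesis .
qed

lemma mono_weight_add_mset:
  "mono_weight c (add_mset x M) = mono_weight c M * (c x * of_nat (Suc (count M x)))"
  unfolding mono_weight_def prod_fact_count_add_mset by (simp add: algebra_simps)

text \<open>The factor by which the weight grows when x is adjoined is \<open>c x\<close> times the
  multiplicity factor of the derivative, and the two signs agree.\<close>

lemma pairing_letter_mult: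
  "pairing (mono_weight c) (sc_letter x * f) g = of_real (c x) * pairing (mono_weight c) f (sc_deriv x g)"
proof -
  let ?W = "mono_weight c"
  let ?S = "{M. sc_coeff f M \<noteq> 0}"
  have S: "finite ?S" by (rule finite_support)
  have "pairing ?W (sc_letter x * f) g = (\<Sum>M\<in>add_mset x ` ?S.
      of_real (?W M) * cnj (sc_coeff (sc_letter x * f) M) * sc_coeff g M)"
  proof (rule pairing_sum)
    show "{M. sc_coeff (sc_letter x * f) M \<noteq> 0} \<subseteq> add_mset x ` ?S"
    proof
      fix M assume "M \<in> {M. sc_coeff (sc_letter x * f) M \<noteq> 0}"
      then have "x \<in># M" "sc_coeff f (M - {#x#}) \<noteq> 0"
        by (auto simp: sc_coeff_letter_mult split: if_splits)
      then show "M \<in> add_mset x ` ?S" by (intro image_eqI[of _ _ "M - {#x#}"]) auto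
    qed
  qed (use S in auto)
  also have "\<dots> = (\<Sum>M\<in>?S. of_real (?W (add_mset x M)) *
      cnj (sc_coeff (sc_letter x * f) (add_mset x M)) * sc_coeff g (add_mset x M))"
    by (subst sum.reindex) (auto simp: inj_on_def)
  also have "\<dots> = (\<Sum>M\<in>?S. of_real (c x) * (of_real (?W M) * cnj (sc_coeff f M) * sc_coeff (sc_deriv x g) M))"
  proof (rule sum.cong[OF refl])
    fix M
    have cnj: "cnj (insert_sign x M) = insert_sign x M"
      by (induction M) (auto simp: swap_sign_def)
    show "of_real (?W (add_mset x M)) *
        cnj (sc_coeff (sc_letter x * f) (add_mset x M)) * sc_coeff g (add_mset x M)
      = of_real (c x) * (of_real (?W M) * cnj (sc_coeff f M) * sc_coeff (sc_deriv x g) M)"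
      using sc_coeff_monomial[of g "add_mset x M"]
      by (cases "sc_coeff g (add_mset x M) = 0")
        (simp_all add: sc_coeff_letter_mult_add_mset sc_coeff_deriv cnj mono_weight_add_mset)
  qed
  also have "\<dots> = of_real (c x) * pairing ?W f (sc_deriv x g)"
    by (simp add: pairing_def sum_distrib_left)
  finally show ?thesis .
qed

section \<open>Rows of odd letters\<close>

lemma sum_fun_apply: "(\<Sum>i\<in>A. f i) x = (\<Sum>i\<in>A. f i x)"
  by (induction A rule: infinite_finite_induct) auto

lemma sum_count_eq_sum_mset:
  fixes n :: nat
  assumes "set_mset N \<subseteq> {..<n}"
  shows "(\<Sum>j<n. of_nat (count N j) * f j) = (\<Sum>j\<in>#N. f j :: 'a::semiring_1)"
  using assms
proof (induction N)
  case (add x N)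
  have "(\<Sum>j<n. of_nat (count (add_mset x N) j) * f j)
      = (\<Sum>j<n. (if j = x then f j else 0) + of_nat (count N j) * f j)"
    by (intro sum.cong) (auto simp: distrib_right)
  also have "\<dots> = f x + (\<Sum>j<n. of_nat (count N j) * f j)"
    using add.prems by (simp add: sum.distrib)
  finally show ?case using add by simp
qed simp

lemma sum_mset_cong: "(\<And>j. j \<in># N \<Longrightarrow> f j = g j) \<Longrightarrow> (\<Sum>j\<in>#N. f j) = (\<Sum>j\<in>#N. g j)"
  by (intro arg_cong[of _ _ sum_mset] image_mset_cong)

lemma additive_sum_mset:
  "Modules.additive g \<Longrightarrow> g (\<Sum>j\<in>#N. f j) = (\<Sum>j\<in>#N. g (f j))"
  by (induction N) (auto simp: additive.add additive.zero)

text \<open>The commutator of d/du_j with multiplication by u_k, read off on the coefficients of an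
  exponential series.\<close>

lemma mult_add_mset_diff_single:
  fixes G :: "'a multiset \<Rightarrow> 'b::ring_1"
  shows "of_nat (count (add_mset j N) k) * G (add_mset j N - {#k#}) =
     of_nat (count N k) * G (add_mset j (N - {#k#})) + (if j = k then G N else 0)"
proof (cases "k \<in># N")
  case True
  then show ?thesis by (auto simp: distrib_right)
next
  case False
  then show ?thesis by (auto simp: not_in_iff)
qed

lemma in_msets_simps:
  "{#} \<in> msets n k \<longleftrightarrow> k = 0"
  "add_mset j N \<in> msets n (Suc k) \<longleftrightarrow> j < n \<and> N \<in> msets n k"
  by (auto simp: msets_def)

lemma msets_diff_single: "\<lbrakk>N \<in> msets n (Suc k); j \<in># N\<rbrakk> \<Longrightarrow> N - {#j#} \<in> msets n k"
  by (metis in_msets_simps(2) insert_DiffM)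

lemma finite_msets [simp]: "finite (msets n k)"
  unfolding msets_def using finite_multisets_of_size[of "{..<n}" k] by (simp add: multisets_of_size_def)

lemma mult_of_nat_left_commute: "x * (of_nat k * y) = of_nat k * (x * y :: 'a::semiring_1)"
  by (metis mult.assoc mult_of_nat_commute)

locale letter_rows =
  fixes b :: "nat \<Rightarrow> nat \<Rightarrow> 'g::superletter" and n r :: nat
  assumes b_inject: "b a j = b a' j' \<longleftrightarrow> a = a' \<and> j = j'"
    and b_odd [simp]: "odd_letter (b a j)"
begin

text \<open>Row a has weight r - a, so moving a letter up from row b to row a < b gains b - a. This
  grading makes the raising operators nilpotent.\<close>

definition potential :: "'g multiset \<Rightarrow> nat" where
  "potential M = (\<Sum>a<r. \<Sum>j<n. (r - a) * count M (b a j))"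

lemma potential_add_mset:
  assumes "a < r" "j < n"
  shows "potential (add_mset (b a j) M) = potential M + (r - a)"
proof -
  have "potential (add_mset (b a j) M) =
      (\<Sum>a'<r. \<Sum>j'<n. (r - a') * count M (b a' j') + (if j' = j then if a' = a then r - a' else 0 else 0))"
    unfolding potential_def by (intro sum.cong refl) (auto simp: b_inject)
  also have "\<dots> = potential M + (r - a)"
    using assms by (simp add: sum.distrib potential_def)
  finally show ?thesis .
qed

lemma potential_bounded:
  assumes "sc_monomial M" shows "potential M \<le> r * (n * r)"
proof -
  have "potential M \<le> (\<Sum>a<r. \<Sum>j<n. r)"
    unfolding potential_def
  proof (intro sum_mono)
    fix a j
    have "count M (b a j) \<le> 1" using assms b_odd unfolding sc_monomial_def by blast
    then have "(r - a) * count M (b a j) \<le> r * 1" by (intro mult_le_mono) auto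
    then show "(r - a) * count M (b a j) \<le> r" by simp
  qed
  also have "\<dots> = r * (n * r)" by simp
  finally show ?thesis .
qed

text \<open>A function G on multisets stands for the series with terms G(N) u^N / N!. In this
  normalisation d/du_j is a plain shift, and multiplication by u_j picks up the multiplicity of
  j.\<close>

abbreviation "create a j G \<equiv> (\<lambda>N::nat multiset. sc_letter (b a j) * (G N :: 'g supercomm))"
abbreviation "annihilate a j G \<equiv> (\<lambda>N::nat multiset. sc_deriv (b a j) (G N :: 'g supercomm))"
abbreviation "shift j G \<equiv> (\<lambda>N::nat multiset. G (add_mset j N) :: 'g supercomm)"
abbreviation "unshift j G \<equiv> (\<lambda>N::nat multiset. of_nat (count N j) * G (N - {#j#}) :: 'g supercomm)"

lemma oscillators: "oscillators create annihilate shift unshift"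
proof
  fix a a' j k and v :: "nat multiset \<Rightarrow> 'g supercomm"
  show "create a j (create a' k v) = - create a' k (create a j v)"
    using letter_supercommute_left[of "b a j" "b a' k"] by (simp add: fun_eq_iff)
  show "annihilate a j (annihilate a' k v) = - annihilate a' k (annihilate a j v)"
    using sc_deriv_commute[of "b a j" "b a' k"] by (simp add: fun_eq_iff)
  show "annihilate a j (create a' k v) = (if a = a' \<and> j = k then v else 0) - create a' k (annihilate a j v)"
    using sc_deriv_letter_mult_same[of "b a j"] sc_deriv_letter_mult_other[of "b a j" "b a' k"]
    by (auto simp: fun_eq_iff b_inject)
  show "shift j (unshift k v) = unshift k (shift j v) + (if j = k then v else 0)"
  proof
    fix N
    show "shift j (unshift k v) N = (unshift k (shift j v) + (if j = k then v else 0)) N"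
      using mult_add_mset_diff_single[of j N k v] by (cases "j = k") (simp_all add: add_mset_commute)
  qed
  show "unshift j (unshift k v) = unshift k (unshift j v)"
  proof (cases "j = k")
    case False
    show ?thesis
    proof
      fix N
      have "unshift j (unshift k v) N = of_nat (count N j) * (of_nat (count N k) * v (N - {#j#} - {#k#}))"
        using False by simp
      also have "\<dots> = of_nat (count N k) * (of_nat (count N j) * v (N - {#k#} - {#j#}))"
        by (subst mult_of_nat_left_commute) (simp only: diff_right_commute)
      finally show "unshift j (unshift k v) N = unshift k (unshift j v) N" using False by simp
    qed
  qed simp
qed (simp_all add: fun_eq_iff distrib_left sc_deriv_add add_mset_commute sc_deriv_of_nat_mult
    mult_of_nat_left_commute[of "sc_letter _"])

sublocale oscillators n create annihilate shift unshift
  by (rule oscillators)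

lemma E_apply: "E a a' v N = (\<Sum>j<n. sc_letter (b a j) * sc_deriv (b a' j) (v N))"
  by (simp add: E_def sum_fun_apply)

lemma Dn_apply: "Dn a v N = (\<Sum>j<n. sc_letter (b a j) * v (add_mset j N))"
  by (simp add: Dn_def sum_fun_apply)

lemma Up_apply_valid:
  assumes "set_mset N \<subseteq> {..<n}"
  shows "Up a v N = (\<Sum>j\<in>#N. sc_deriv (b a j) (v (N - {#j#})))"
  using sum_count_eq_sum_mset[OF assms, of "\<lambda>j. sc_deriv (b a j) (v (N - {#j#}))"]
  by (simp add: Up_def sum_fun_apply sc_deriv_of_nat_mult)

lemma Up_apply: "Up a v N = (\<Sum>j<n. of_nat (count N j) * sc_deriv (b a j) (v (N - {#j#})))"
  by (simp add: Up_def sum_fun_apply sc_deriv_of_nat_mult)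

lemma Cr_apply: "Cr a v N = (\<Sum>j<n. of_nat (count N j) * (sc_letter (b a j) * v (N - {#j#})))"
  by (simp add: Cr_def sum_fun_apply mult_of_nat_left_commute[of "sc_letter _"])

lemma Cr_apply_valid:
  assumes "set_mset N \<subseteq> {..<n}"
  shows "Cr a v N = (\<Sum>j\<in>#N. sc_letter (b a j) * v (N - {#j#}))"
  using sum_count_eq_sum_mset[OF assms, of "\<lambda>j. sc_letter (b a j) * v (N - {#j#})"]
  by (simp add: Cr_apply)

lemma sc_coeff_E_same:
  "sc_coeff (E a a v N) M = of_nat (\<Sum>j<n. count M (b a j)) * sc_coeff (v N) M"
  by (simp add: E_apply sc_coeff_sum letter_mult_deriv_same sum_distrib_right)

definition Fil :: "nat \<Rightarrow> (nat multiset \<Rightarrow> 'g supercomm) set" where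
  "Fil w = {v. \<forall>N M. sc_coeff (v N) M \<noteq> 0 \<longrightarrow> w \<le> potential M}"

text \<open>The potential is bounded because no odd letter repeats, so sufficiently many raising
  operators give 0. On a monomial \<open>E a a\<close> counts the letters of row a; its eigenvalues
  are natural numbers, whence \<open>pos\<close> and \<open>ker_sq\<close>.\<close>

lemma positive_oscillators:
  "positive_oscillators n create annihilate shift unshift r Fil (Suc (r * (n * r)))"
proof (rule positive_oscillators.intro[OF oscillators], unfold_locales)
  fix v :: "nat multiset \<Rightarrow> 'g supercomm" and a a' w s
  show "v = 0" if "v = - v"
  proof
    fix N
    have "v N = - v N" using that by (metis uminus_apply)
    then show "v N = 0 N" by (simp add: supercomm_self_neg)
  qed
  show "v \<in> Fil 0" by (simp add: Fil_def)
  show "v = 0" if v: "v \<in> Fil (Suc (r * (n * r)))"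
  proof (intro ext supercomm_eqI)
    fix N M
    have "\<not> Suc (r * (n * r)) \<le> potential M" if "sc_coeff (v N) M \<noteq> 0"
      using potential_bounded[of M] sc_coeff_monomial[OF that] by auto
    then show "sc_coeff (v N) M = sc_coeff (0 N) M"
      using v by (auto simp: Fil_def)
  qed
  show "E a a' v \<in> Fil (Suc w)" if aa: "a < a'" "a' < r" and v: "v \<in> Fil w"
    unfolding Fil_def
  proof (safe)
    fix N M assume "sc_coeff (E a a' v N) M \<noteq> 0"
    then have "(\<Sum>j<n. sc_coeff (sc_letter (b a j) * sc_deriv (b a' j) (v N)) M) \<noteq> 0"
      by (simp add: E_apply sc_coeff_sum)
    then obtain j where j: "j < n" "sc_coeff (sc_letter (b a j) * sc_deriv (b a' j) (v N)) M \<noteq> 0"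
      by (metis (no_types, lifting) lessThan_iff sum.not_neutral_contains_not_neutral)
    then have M: "b a j \<in># M" "sc_coeff (sc_deriv (b a' j) (v N)) (M - {#b a j#}) \<noteq> 0"
      by (auto simp: sc_coeff_letter_mult split: if_splits)
    then obtain M' where M': "M = add_mset (b a j) M'" by (metis insert_DiffM)
    then have "sc_coeff (v N) (add_mset (b a' j) M') \<noteq> 0" using M by (auto simp: sc_coeff_deriv)
    then have "w \<le> potential (add_mset (b a' j) M')" using v by (auto simp: Fil_def)
    then show "Suc w \<le> potential M"
      using aa j by (simp add: M' potential_add_mset)
  qed
  show "v = 0" if "E a a v + (\<Sum>i<Suc s. v) = 0"
  proof (intro ext supercomm_eqI)
    fix N M
    have "sc_coeff ((E a a v + (\<Sum>i<Suc s. v)) N) M = of_nat ((\<Sum>j<n. count M (b a j)) + Suc s) * sc_coeff (v N) M"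
      unfolding plus_fun_apply sc_coeff_add sc_coeff_E_same sum_fun_apply sc_coeff_sum
      by (simp add: algebra_simps)
    then have "of_nat ((\<Sum>j<n. count M (b a j)) + Suc s) * sc_coeff (v N) M = 0"
      unfolding that by simp
    then have "sc_coeff (v N) M = 0"
      by (metis add_Suc_right mult_eq_0_iff of_nat_neq_0)
    then show "sc_coeff (v N) M = sc_coeff (0 N) M" by simp
  qed
  show "E a a v = 0" if "E a a (E a a v) = 0"
  proof (intro ext supercomm_eqI)
    fix N M
    have "sc_coeff (E a a (E a a v) N) M = 0" unfolding that by simp
    then show "sc_coeff (E a a v N) M = sc_coeff (0 N) M" by (auto simp: sc_coeff_E_same)
  qed
qed

sublocale positive_oscillators n create annihilate shift unshift r Fil "Suc (r * (n * r))"
  by (rule positive_oscillators)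

section \<open>The coefficients of a product of odd row operators\<close>

definition point :: "'g supercomm \<Rightarrow> nat multiset \<Rightarrow> 'g supercomm" where
  "point f = (\<lambda>N. if N = {#} then f else 0)"

text \<open>The value at N is the coefficient of u^N / N! in the product of the odd elements sum_j
  b_aj u_j over a in \<open>as\<close>. For all rows, \<theta> included, this is q_N.\<close>

definition qhat :: "nat list \<Rightarrow> nat multiset \<Rightarrow> 'g supercomm" where
  "qhat as = foldr Cr as (point 1)"

lemma qhat_Nil: "qhat [] N = (if N = {#} then 1 else 0)"
  by (simp add: qhat_def point_def)

lemma qhat_Cons: "qhat (a # as) N = (\<Sum>j<n. of_nat (count N j) * (sc_letter (b a j) * qhat as (N - {#j#})))"
  by (simp add: qhat_def Cr_apply)

lemma qhat_Cons_valid: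
  "set_mset N \<subseteq> {..<n} \<Longrightarrow> qhat (a # as) N = (\<Sum>j\<in>#N. sc_letter (b a j) * qhat as (N - {#j#}))"
  by (simp add: qhat_def Cr_apply_valid)

lemma foldr_Cr_point: "foldr Cr as (point f) N = qhat as N * f"
proof (induction as arbitrary: N)
  case Nil
  then show ?case by (simp add: qhat_Nil point_def)
next
  case (Cons a as)
  then show ?case by (simp add: Cr_apply qhat_Cons sum_distrib_right mult.assoc)
qed

lemma qhat_nonzero: "qhat as N \<noteq> 0 \<Longrightarrow> N \<in> msets n (length as)"
proof (induction as arbitrary: N)
  case Nil
  then show ?case by (auto simp: qhat_Nil in_msets_simps split: if_splits)
next
  case (Cons a as)
  then obtain j where j: "j < n" "of_nat (count N j) * (sc_letter (b a j) * qhat as (N - {#j#})) \<noteq> 0"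
    unfolding qhat_Cons by (metis (no_types, lifting) lessThan_iff sum.not_neutral_contains_not_neutral)
  then have "count N j \<noteq> 0" "qhat as (N - {#j#}) \<noteq> 0" by (metis mult_zero_left of_nat_0, metis mult_zero_right)
  then have "j \<in># N" "N - {#j#} \<in> msets n (length as)" using Cons.IH by (auto simp: not_in_iff)
  then show ?case using j in_msets_simps(2)[of j "N - {#j#}" n "length as"] by simp
qed

lemma qhat_eq_0: "N \<notin> msets n (length as) \<Longrightarrow> qhat as N = 0"
  using qhat_nonzero by blast

definition row_letters :: "nat set \<Rightarrow> 'g set" where
  "row_letters A = {b a j | a j. a \<in> A \<and> j < n}"

lemma has_parity_qhat: "set as \<subseteq> A \<Longrightarrow> has_parity (row_letters A) (odd (length as)) (qhat as N)"
proof (induction as arbitrary: N)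
  case Nil
  then show ?case by (auto simp: qhat_Nil intro: has_parity.intros)
next
  case (Cons a as)
  have "has_parity (row_letters A) (odd (length as) \<noteq> odd_letter (b a j)) (sc_letter (b a j) * qhat as (N - {#j#}))"
    if "j < n" for j
    using Cons that by (intro has_parity.intros Cons.IH) (auto simp: row_letters_def)
  then show ?case unfolding qhat_Cons by (intro has_parity_sum has_parity_of_nat) simp
qed

lemma qhat_carrier: "set as \<subseteq> A \<Longrightarrow> qhat as N \<in> carrier (free_supercomm (row_letters A))"
  by (rule has_parity_carrier[OF has_parity_qhat])

text \<open>Differentiating \<open>qhat\<close> would replace its row a' by row a, which it already
  contains if it contains a' at all. The result has a repeated odd factor and vanishes, so only f is
  differentiated. For the \<theta> row as a' this is the invariance of q_N.\<close>

lemma E_qhat: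
  assumes "a \<noteq> a'" "a \<in> set as \<or> a' \<notin> set as"
  shows "(\<Sum>j<n. sc_letter (b a j) * sc_deriv (b a' j) (qhat as N * f)) =
     qhat as N * (\<Sum>j<n. sc_letter (b a j) * sc_deriv (b a' j) f)"
proof -
  have "E a a' (point f) = point (\<Sum>j<n. sc_letter (b a j) * sc_deriv (b a' j) f)"
    by (auto simp: fun_eq_iff E_apply point_def)
  then show ?thesis
    using fun_cong[OF E_foldr_Cr[OF assms, of "point f"], of N]
    by (simp add: E_apply foldr_Cr_point)
qed

text \<open>The left-hand side is a coefficient of \<open>Cr a\<close> applied to a product that
  already contains \<open>Cr a\<close>.\<close>

lemma qhat_linear_relation:
  assumes "a \<in> set as" "set_mset N \<subseteq> {..<n}"
  shows "(\<Sum>j\<in>#N. sc_letter (b a j) * qhat as (N - {#j#})) = 0"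
  using fun_cong[OF Cr.X_foldr_member[OF assms(1), of "point 1"], of N]
  by (simp add: Cr_apply_valid[OF assms(2)] qhat_def)

text \<open>
  The variable row entry is moved to the right, where it meets the factors \<open>X j\<close>.
\<close>

lemma qhat_exchange:
  assumes "\<And>a. a \<in> set as \<Longrightarrow> (\<Sum>j\<in>#N'. sc_letter (b a j) * X j) = 0"
    and "set_mset N \<subseteq> {..<n}" "set_mset N' \<subseteq> {..<n}"
  shows "(\<Sum>j\<in>#N'. qhat as (add_mset j N) * X j) = 0"
  using assms(1,2)
proof (induction as arbitrary: N)
  case Nil
  then show ?case by (simp add: qhat_Nil)
next
  case (Cons a as)
  have comm: "sc_letter (b a j) * qhat as N = (if odd (length as) then - (qhat as N * sc_letter (b a j))
     else qhat as N * sc_letter (b a j))" for j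
    using letter_mult_has_parity[OF has_parity_qhat[OF order_refl, of as N], of "b a j"] by auto
  have "(\<Sum>j\<in>#N'. sc_letter (b a j) * qhat as N * X j) =
      (if odd (length as) then - (qhat as N * (\<Sum>j\<in>#N'. sc_letter (b a j) * X j))
       else qhat as N * (\<Sum>j\<in>#N'. sc_letter (b a j) * X j))"
    unfolding comm by (induction N') (auto simp: algebra_simps)
  also have "\<dots> = 0" using Cons.prems(1)[of a] by simp
  finally have 1: "(\<Sum>j\<in>#N'. sc_letter (b a j) * qhat as N * X j) = 0" .
  have "(\<Sum>j\<in>#N'. qhat (a # as) (add_mset j N) * X j) =
     (\<Sum>j\<in>#N'. sc_letter (b a j) * qhat as N * X j +
        (\<Sum>i\<in>#N. sc_letter (b a i) * (qhat as (add_mset j (N - {#i#})) * X j)))"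
  proof (intro sum_mset_cong)
    fix j assume "j \<in># N'"
    then have valid: "set_mset (add_mset j N) \<subseteq> {..<n}" using Cons.prems(2) assms(3) by auto
    have "(\<Sum>i\<in>#N. sc_letter (b a i) * qhat as (add_mset j N - {#i#})) * X j =
        (\<Sum>i\<in>#N. sc_letter (b a i) * (qhat as (add_mset j (N - {#i#})) * X j))"
      unfolding sum_mset_distrib_right
      by (intro sum_mset_cong) (auto simp: mult.assoc)
    then show "qhat (a # as) (add_mset j N) * X j = sc_letter (b a j) * qhat as N * X j +
        (\<Sum>i\<in>#N. sc_letter (b a i) * (qhat as (add_mset j (N - {#i#})) * X j))"
      by (simp add: qhat_Cons_valid[OF valid] distrib_right)
  qed
  also have "\<dots> = (\<Sum>j\<in>#N'. \<Sum>i\<in>#N. sc_letter (b a i) * (qhat as (add_mset j (N - {#i#})) * X j))"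
    by (simp add: sum_mset.distrib 1)
  also have "\<dots> = (\<Sum>i\<in>#N. \<Sum>j\<in>#N'. sc_letter (b a i) * (qhat as (add_mset j (N - {#i#})) * X j))"
    by (rule sum_mset.swap)
  also have "\<dots> = (\<Sum>i\<in>#N. sc_letter (b a i) * (\<Sum>j\<in>#N'. qhat as (add_mset j (N - {#i#})) * X j))"
    by (simp add: sum_mset_distrib_left image_mset.compositionality comp_def)
  also have "\<dots> = (\<Sum>i\<in>#N. 0)"
  proof (intro sum_mset_cong)
    fix i assume "i \<in># N"
    have "set_mset (N - {#i#}) \<subseteq> {..<n}" using Cons.prems(2) by (meson in_diffD subset_iff)
    then show "sc_letter (b a i) * (\<Sum>j\<in>#N'. qhat as (add_mset j (N - {#i#})) * X j) = 0"
      using Cons by simp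
  qed
  finally show ?case by simp
qed

text \<open>The exchange argument with the second factor as X j: what each row entry meets there is
  a linear relation.\<close>

lemma qhat_quadratic_relation:
  assumes "set_mset N1 \<subseteq> {..<n}" "set_mset N2 \<subseteq> {..<n}"
  shows "(\<Sum>j\<in>#N2. qhat as (add_mset j N1) * qhat as (N2 - {#j#})) = 0"
  using assms by (intro qhat_exchange qhat_linear_relation)

text \<open>Only the odd letters change sides. Multiplication by u_j stays where it is, so
  \<open>Up\<close> turns into \<open>Cr\<close> and not into \<open>Dn\<close>; as usual for
  adjoints the order is reversed.\<close>

lemma pairing_foldr_Up:
  "pairing (mono_weight (\<lambda>_. 1)) f (foldr Up as (point h) N) =
     pairing (mono_weight (\<lambda>_. 1)) (foldr Cr (rev as) (point f) N) h"
proof (induction as arbitrary: f N)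
  case Nil
  then show ?case by (simp add: point_def)
next
  case (Cons a as)
  let ?p = "pairing (mono_weight (\<lambda>_. 1))"
  have of_nat: "?p f (of_nat k * g) = of_nat k * ?p f g" "?p (of_nat k * f) g = of_nat k * ?p f g" for k f g
    using pairing_scale_right[of _ f "of_nat k" g] pairing_scale_left[of _ "of_nat k" f g]
    by (simp_all add: sc_scalar_of_nat)
  have "?p f (foldr Up (a # as) (point h) N) =
      (\<Sum>j<n. of_nat (count N j) * ?p (sc_letter (b a j) * f) (foldr Up as (point h) (N - {#j#})))"
    by (simp add: Up_apply pairing_sum_right of_nat pairing_letter_mult)
  also have "\<dots> = ?p (\<Sum>j<n. unshift j (foldr Cr (rev as) (point (sc_letter (b a j) * f))) N) h"
    unfolding Cons.IH by (simp add: pairing_sum_left of_nat)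
  also have "(\<Sum>j<n. unshift j (foldr Cr (rev as) (point (sc_letter (b a j) * f))) N) =
      foldr Cr (rev as) (\<Sum>j<n. create a j (unshift j (point f))) N"
  proof -
    \<comment> \<open>Multiplication by u_j commutes with every \<open>Cr\<close>, so it can be
      carried inside to the letter and form the innermost factor \<open>Cr a\<close>.\<close>
    have m: "unshift j (foldr Cr as v) = foldr Cr as (unshift j v)" for j as v
    proof (induction as)
      case (Cons e as)
      then show ?case using m_Cr[of j e "foldr Cr as v"] by simp
    qed simp
    have "unshift j (point (sc_letter (b a j) * f)) = create a j (unshift j (point f))" for j
      by (auto simp: fun_eq_iff point_def mult_of_nat_left_commute[of "sc_letter _"])
    then have "unshift j (foldr Cr (rev as) (point (sc_letter (b a j) * f))) =
        foldr Cr (rev as) (create a j (unshift j (point f)))" for j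
      using m[of j "rev as" "point (sc_letter (b a j) * f)"] by simp
    then show ?thesis by (simp add: Cr.foldr_X_sum sum_fun_apply fun_eq_iff)
  qed
  finally show ?case by (simp add: Cr_def[of a "point f"])
qed

end

text \<open>Sort the orderings of N by their first entry j; then N! equals the multiplicity of j
  times (N - j)!, which turns the sum over distinct entries into a sum with multiplicity. The row
  offset k is there for the iteration.\<close>

lemma q_elem_rec:
  fixes \<beta> :: "nat \<Rightarrow> nat \<Rightarrow> 'g::superletter supercomm"
  defines "Q \<equiv> \<lambda>k N. of_nat (\<Prod>j\<in>set_mset N. fact (count N j)) *
     (\<Sum>xs\<in>permutations_of_multiset N. prod_list (map (\<lambda>i. \<beta> (k + i) (xs ! i)) [0..<size N]))"
  assumes "N \<noteq> {#}"
  shows "Q k N = (\<Sum>j\<in>#N. \<beta> k j * Q (Suc k) (N - {#j#}))"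
proof -
  let ?P = "\<lambda>k xs. prod_list (map (\<lambda>i. \<beta> (k + i) (xs ! i)) [0..<length xs])"
  let ?c = "\<lambda>N. (\<Prod>j\<in>set_mset N. fact (count N j) :: nat)"
  have Q: "Q k N = of_nat (?c N) * (\<Sum>xs\<in>permutations_of_multiset N. ?P k xs)" for k N
    unfolding Q_def
    by (intro arg_cong2[of _ _ _ _ "(*)"] sum.cong refl)
      (metis length_finite_permutations_of_multiset)
  have P: "?P k (j # xs) = \<beta> k j * ?P (Suc k) xs" for k j xs
  proof -
    have "[0..<length (j # xs)] = 0 # map Suc [0..<length xs]"
      by (simp add: map_Suc_upt upt_conv_Cons del: upt_Suc)
    then show ?thesis by (simp add: comp_def del: upt_Suc)
  qed
  have "(\<Sum>xs\<in>permutations_of_multiset N. ?P k xs) =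
      (\<Sum>j\<in>set_mset N. \<Sum>xs\<in>(#) j ` permutations_of_multiset (N - {#j#}). ?P k xs)"
    unfolding permutations_of_multiset_nonempty[OF assms(2)]
    by (rule sum.UNION_disjoint) auto
  also have "\<dots> = (\<Sum>j\<in>set_mset N. \<beta> k j * (\<Sum>xs\<in>permutations_of_multiset (N - {#j#}). ?P (Suc k) xs))"
    by (intro sum.cong refl) (simp add: sum.reindex P sum_distrib_left del: upt_Suc list.size)
  finally have "Q k N = (\<Sum>j\<in>set_mset N. of_nat (?c N) * (\<beta> k j *
      (\<Sum>xs\<in>permutations_of_multiset (N - {#j#}). ?P (Suc k) xs)))"
    unfolding Q by (simp add: sum_distrib_left)
  also have "\<dots> = (\<Sum>j\<in>set_mset N. of_nat (count N j) * (\<beta> k j * Q (Suc k) (N - {#j#})))"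
  proof (intro sum.cong refl)
    fix j assume "j \<in># N"
    then obtain N' where N': "N = add_mset j N'" by (metis insert_DiffM)
    have c: "?c N = count N j * ?c (N - {#j#})"
      unfolding N' prod_fact_count_add_mset by simp
    show "of_nat (?c N) * (\<beta> k j * (\<Sum>xs\<in>permutations_of_multiset (N - {#j#}). ?P (Suc k) xs)) =
        of_nat (count N j) * (\<beta> k j * Q (Suc k) (N - {#j#}))"
      unfolding Q c of_nat_mult
      by (simp add: mult.assoc mult_of_nat_left_commute[of "\<beta> k j"])
  qed
  also have "\<dots> = (\<Sum>j\<in>#N. \<beta> k j * Q (Suc k) (N - {#j#}))"
  proof -
    \<comment> \<open>An artificial number of columns, large enough for N, since the conversion to
      sums with multiplicity works on an initial segment.\<close>
    have "set_mset N \<subseteq> {..<Suc (Max (set_mset N))}" using assms(2) by (auto simp: less_Suc_eq_le)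
    from sum_count_eq_sum_mset[OF this, of "\<lambda>j. \<beta> k j * Q (Suc k) (N - {#j#})", symmetric]
    show ?thesis
      by (simp only:) (rule sum.mono_neutral_left, use assms(2) in \<open>auto simp: not_in_iff less_Suc_eq_le\<close>)
  qed
  finally show ?thesis .
qed

section \<open>Invariants of the shifts\<close>

definition torus_row :: "nat \<Rightarrow> nat \<Rightarrow> nat \<Rightarrow> torus_letter" where
  "torus_row m a j = (if a = m then Theta j else Alpha a j)"

lemma torus_row_simps [simp]:
  "torus_row m m j = Theta j" "a < m \<Longrightarrow> torus_row m a j = Alpha a j"
  by (simp_all add: torus_row_def)

interpretation torus: letter_rows "torus_row m" n "Suc m" for m n
  by unfold_locales (auto simp: torus_row_def odd_letter_torus_letter_def)

abbreviation torus_qhat :: "nat \<Rightarrow> nat \<Rightarrow> nat list \<Rightarrow> nat multiset \<Rightarrow> torus_letter supercomm" where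
  "torus_qhat m n \<equiv> letter_rows.qhat (torus_row m) n"

lemma odd_torus_letter [simp]: "odd_letter (x :: torus_letter)"
  by (simp add: odd_letter_torus_letter_def)

lemma q_elem_eq_qhat:
  assumes "N \<in> msets n (Suc m)"
  shows "q_elem m N = torus_qhat m n [0..<Suc m] N"
proof -
  let ?\<beta> = "\<lambda>k j. sc_letter (torus_row m k j)"
  define Q where "Q = (\<lambda>k N. of_nat (\<Prod>j\<in>set_mset N. fact (count N j)) *
     (\<Sum>xs\<in>permutations_of_multiset N. prod_list (map (\<lambda>i. ?\<beta> (k + i) (xs ! i)) [0..<size N])))"
  \<comment> \<open>Generalised to the rows from k on, as many as N has entries, so that removing
    the first row and one entry is an instance of the same claim.\<close>
  have "Q k N = torus_qhat m n [k..<k + size N] N" if "set_mset N \<subseteq> {..<n}" for k N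
    using that
  proof (induction "size N" arbitrary: k N)
    case 0
    then show ?case by (simp add: Q_def torus.qhat_Nil)
  next
    case (Suc s)
    then have "N \<noteq> {#}" by auto
    from q_elem_rec[OF this, of ?\<beta> k] have "Q k N = (\<Sum>j\<in>#N. ?\<beta> k j * Q (Suc k) (N - {#j#}))"
      by (simp only: Q_def)
    also have "\<dots> = (\<Sum>j\<in>#N. ?\<beta> k j * torus_qhat m n [Suc k..<k + size N] (N - {#j#}))"
    proof (intro sum_mset_cong)
      fix j assume j: "j \<in># N"
      then have "s = size (N - {#j#})" "set_mset (N - {#j#}) \<subseteq> {..<n}"
        using Suc by (auto simp: size_Diff_singleton dest: in_diffD)
      moreover have "k + size N = Suc k + size (N - {#j#})" using Suc.hyps(2) \<open>s = _\<close> by simp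
      ultimately show "?\<beta> k j * Q (Suc k) (N - {#j#}) =
          ?\<beta> k j * torus_qhat m n [Suc k..<k + size N] (N - {#j#})"
        using Suc.hyps(1)[of "N - {#j#}" "Suc k"] by (simp only:)
    qed
    also have "\<dots> = torus_qhat m n (k # [Suc k..<k + size N]) N"
      using Suc.prems by (simp add: torus.qhat_Cons_valid)
    also have "k # [Suc k..<k + size N] = [k..<k + size N]"
      using Suc.hyps(2) by (simp add: upt_conv_Cons)
    finally show ?case .
  qed
  from this[of N 0] assms have "Q 0 N = torus_qhat m n [0..<Suc m] N" by (simp add: msets_def)
  moreover have "q_elem m N = Q 0 N"
  proof -
    have size: "size N = Suc m" using assms by (simp add: msets_def)
    have "map (\<lambda>i. ?\<beta> (0 + i) (xs ! i)) [0..<Suc m] =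
        map (\<lambda>k. alpha_elem k (xs ! k)) [0..<m] @ [theta_elem (xs ! m)]" for xs by simp
    then show ?thesis
      unfolding q_elem_def Q_def size by (simp only: prod_list.append prod_list.Cons prod_list.Nil mult_1_right)
  qed
  ultimately show ?thesis by simp
qed

text \<open>In the language of rows this is the operator \<open>E i m\<close>, which raises from the
  \<theta> row \<open>m\<close> to row i. Invariants are thus partial highest vectors.\<close>

definition row_derivation :: "nat \<Rightarrow> nat \<Rightarrow> torus_letter supercomm \<Rightarrow> torus_letter supercomm" where
  "row_derivation n i f = (\<Sum>j<n. alpha_elem i j * sc_deriv (Theta j) f)"

definition theta_wt :: "torus_letter \<Rightarrow> nat" where
  "theta_wt x = (case x of Alpha _ _ \<Rightarrow> 0 | Theta _ \<Rightarrow> 1)"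

lemma theta_wt_simps [simp]: "theta_wt (Alpha i j) = 0" "theta_wt (Theta j) = 1"
  by (simp_all add: theta_wt_def)

definition theta_deg_le :: "nat \<Rightarrow> torus_letter supercomm \<Rightarrow> bool" where
  "theta_deg_le D f \<longleftrightarrow> (\<forall>M. sc_coeff f M \<noteq> 0 \<longrightarrow> wt_mset theta_wt M \<le> D)"

lemma theta_deg_le_deriv: "theta_deg_le D f \<Longrightarrow> theta_deg_le (D - theta_wt x) (sc_deriv x f)"
  unfolding theta_deg_le_def
proof (intro allI impI)
  fix M assume D: "\<forall>M. sc_coeff f M \<noteq> 0 \<longrightarrow> wt_mset theta_wt M \<le> D" and "sc_coeff (sc_deriv x f) M \<noteq> 0"
  then have "sc_coeff f (add_mset x M) \<noteq> 0" by (auto simp: sc_coeff_deriv)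
  with D have "theta_wt x + wt_mset theta_wt M \<le> D" by (metis wt_mset_simps(2))
  then show "wt_mset theta_wt M \<le> D - theta_wt x" by simp
qed

lemma theta_deg_le_0: "theta_deg_le D 0"
  by (simp add: theta_deg_le_def)

lemma theta_deg_le_add: "\<lbrakk>theta_deg_le D f; theta_deg_le D g\<rbrakk> \<Longrightarrow> theta_deg_le D (f + g)"
  unfolding theta_deg_le_def by (metis sc_coeff_add add.right_neutral)

lemma theta_deg_le_sum: "(\<And>i. i \<in> A \<Longrightarrow> theta_deg_le D (f i)) \<Longrightarrow> theta_deg_le D (sum f A)"
  by (induction A rule: infinite_finite_induct) (auto intro: theta_deg_le_add theta_deg_le_0)

lemma theta_deg_le_scale: "theta_deg_le D f \<Longrightarrow> theta_deg_le D (sc_scalar c * f)"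
  by (simp add: theta_deg_le_def)

lemma theta_deg_le_of_nat: "theta_deg_le D f \<Longrightarrow> theta_deg_le D (of_nat c * f)"
  using theta_deg_le_scale[of D f "of_nat c"] by (simp only: sc_scalar_of_nat)

lemma theta_deg_le_alpha_mult: "theta_deg_le D f \<Longrightarrow> theta_deg_le D (alpha_elem i j * f)"
  unfolding theta_deg_le_def
proof (intro allI impI)
  fix M assume D: "\<forall>M. sc_coeff f M \<noteq> 0 \<longrightarrow> wt_mset theta_wt M \<le> D" and "sc_coeff (alpha_elem i j * f) M \<noteq> 0"
  then have "Alpha i j \<in># M" "sc_coeff f (M - {#Alpha i j#}) \<noteq> 0"
    by (auto simp: sc_coeff_letter_mult split: if_splits)
  then obtain N where "M = add_mset (Alpha i j) N" "sc_coeff f N \<noteq> 0"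
    by (metis insert_DiffM)
  with D show "wt_mset theta_wt M \<le> D" by simp
qed

lemma theta_deg_le_row_derivation: "theta_deg_le D f \<Longrightarrow> theta_deg_le (D - 1) (row_derivation n i f)"
  unfolding row_derivation_def
  by (intro theta_deg_le_sum theta_deg_le_alpha_mult) (metis theta_deg_le_deriv theta_wt_simps(2))

lemma row_derivation_theta_free: "theta_deg_le 0 f \<Longrightarrow> row_derivation n i f = 0"
proof -
  assume *: "theta_deg_le 0 f"
  have "sc_deriv (Theta j) f = 0" for j
  proof (rule supercomm_eqI)
    fix M
    have "sc_coeff f (add_mset (Theta j) M) = 0"
      using * unfolding theta_deg_le_def
      by (metis wt_mset_simps(2) theta_wt_simps(2) le_zero_eq add_is_0 one_neq_zero)
    then show "sc_coeff (sc_deriv (Theta j) f) M = sc_coeff 0 M" by (simp add: sc_coeff_deriv)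
  qed
  then show ?thesis by (simp add: row_derivation_def)
qed

lemma row_derivation_add: "row_derivation n i (f + g) = row_derivation n i f + row_derivation n i g"
  by (simp add: row_derivation_def sc_deriv_add distrib_left sum.distrib)

lemma row_derivation_scale: "row_derivation n i (sc_scalar c * f) = sc_scalar c * row_derivation n i f"
  by (simp add: row_derivation_def sc_deriv_scalar_mult scalar_left_commute[of "alpha_elem _ _"] sum_distrib_left)

lemma row_derivation_0 [simp]: "row_derivation n i 0 = 0"
  by (simp add: row_derivation_def)

lemma row_derivation_1 [simp]: "row_derivation n i 1 = 0"
  by (simp add: row_derivation_def)


lemma row_derivation_diff: "row_derivation n i (f - g) = row_derivation n i f - row_derivation n i g"
  using row_derivation_add[of n i "f - g" g] by simp


lemma row_derivation_alpha_mult: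
  "row_derivation n i (alpha_elem k l * f) = alpha_elem k l * row_derivation n i f"
  unfolding row_derivation_def sum_distrib_left
  using letter_supercommute_left[of "Alpha i _" "Alpha k l"]
  by (intro sum.cong refl) (simp add: sc_deriv_letter_mult_other)

lemma row_derivation_theta_mult:
  assumes "l < n"
  shows "row_derivation n i (theta_elem l * f) = alpha_elem i l * f + theta_elem l * row_derivation n i f"
proof -
  have "alpha_elem i j * sc_deriv (Theta j) (theta_elem l * f) =
      (if j = l then alpha_elem i l * f else 0) + theta_elem l * (alpha_elem i j * sc_deriv (Theta j) f)" for j
    using letter_supercommute_left[of "Alpha i j" "Theta l" "sc_deriv (Theta j) f"]
    by (cases "j = l") (simp_all add: sc_deriv_letter_mult_same sc_deriv_letter_mult_other right_diff_distrib)
  then show ?thesis using assms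
    by (simp add: row_derivation_def sum.distrib sum_distrib_left)
qed

subsection \<open>The shift is the exponential of the derivation\<close>

abbreviation row_shift :: "nat \<Rightarrow> torus_letter supercomm \<Rightarrow> torus_letter supercomm" where
  "row_shift i \<equiv> sc_subst (shift_theta i)"

lemma shift_theta_simps [simp]:
  "shift_theta i (Alpha k l) = alpha_elem k l"
  "shift_theta i (Theta j) = theta_elem j + alpha_elem i j"
  by (simp_all add: shift_theta_def)

lemma respects_parity_shift: "respects_parity UNIV (shift_theta i)"
proof (rule respects_parityI)
  fix x
  show "has_parity UNIV (odd_letter x) (shift_theta i x)"
  proof -
    have "has_parity UNIV True (sc_letter y)" for y :: torus_letter
      using has_parity_letterI[of y UNIV] by simp
    then show ?thesis by (cases x) (auto intro: has_parity_add)
  qed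
qed

lemma funpow_row_derivation:
  "(row_derivation n i ^^ p) (alpha_elem k l * f) = alpha_elem k l * (row_derivation n i ^^ p) f"
  "l < n \<Longrightarrow> (row_derivation n i ^^ Suc p) (theta_elem l * f) =
     theta_elem l * (row_derivation n i ^^ Suc p) f + of_nat (Suc p) * (alpha_elem i l * (row_derivation n i ^^ p) f)"
  "(row_derivation n i ^^ p) 0 = 0"
  "(row_derivation n i ^^ p) (f + g) = (row_derivation n i ^^ p) f + (row_derivation n i ^^ p) g"
  "(row_derivation n i ^^ p) (sc_scalar c * f) = sc_scalar c * (row_derivation n i ^^ p) f"
proof -
  show *: "(row_derivation n i ^^ p) (alpha_elem k l * f) = alpha_elem k l * (row_derivation n i ^^ p) f" for p k l f
    by (induction p) (simp_all add: row_derivation_alpha_mult)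
  show "(row_derivation n i ^^ Suc p) (theta_elem l * f) =
     theta_elem l * (row_derivation n i ^^ Suc p) f + of_nat (Suc p) * (alpha_elem i l * (row_derivation n i ^^ p) f)"
    if "l < n"
  proof (induction p)
    case 0
    then show ?case using row_derivation_theta_mult[OF that] by (simp add: add.commute)
  next
    case (Suc p)
    have of_nat: "row_derivation n i (of_nat k * g) = of_nat k * row_derivation n i g" for k g
      using row_derivation_scale[of n i "of_nat k" g] by (simp only: sc_scalar_of_nat)
    have "(row_derivation n i ^^ Suc (Suc p)) (theta_elem l * f) =
        row_derivation n i ((row_derivation n i ^^ Suc p) (theta_elem l * f))" by simp
    then show ?case unfolding Suc.IH row_derivation_add of_nat row_derivation_theta_mult[OF that]
        row_derivation_alpha_mult
      by (simp add: algebra_simps)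
  qed
  show "(row_derivation n i ^^ p) 0 = 0" by (induction p) simp_all
  show "(row_derivation n i ^^ p) (f + g) = (row_derivation n i ^^ p) f + (row_derivation n i ^^ p) g"
    by (induction p) (simp_all add: row_derivation_add)
  show "(row_derivation n i ^^ p) (sc_scalar c * f) = sc_scalar c * (row_derivation n i ^^ p) f"
    by (induction p) (simp_all add: row_derivation_scale)
qed

lemma funpow_row_derivation_sum:
  "(row_derivation n i ^^ p) (sum f A) = (\<Sum>a\<in>A. (row_derivation n i ^^ p) (f a))"
  by (induction A rule: infinite_finite_induct) (auto simp: funpow_row_derivation)

text \<open>The derivation D sends \<theta>_l to \<alpha>_il and \<alpha>_il to 0. Hence D^(p+1) of
  \<theta>_l f has just two terms, and after division by (p+1)! they sum to (\<theta>_l +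
  \<alpha>_il) exp(D) f.\<close>

lemma row_shift_eq_exp:
  assumes "f \<in> carrier (E_algebra m n)" "\<And>p. p > K \<Longrightarrow> (row_derivation n i ^^ p) f = 0"
  shows "row_shift i f = (\<Sum>p\<le>K. sc_scalar (1 / fact p) * (row_derivation n i ^^ p) f)"
proof -
  let ?D = "row_derivation n i"
  let ?exp = "\<lambda>K f. \<Sum>p\<le>K. sc_scalar (1 / fact p) * (?D ^^ p) f"
  have exp_mono: "?exp K' f = ?exp K f" if "\<And>p. p > K \<Longrightarrow> (?D ^^ p) f = 0" "K \<le> K'" for K K' f
    by (rule sum.mono_neutral_right) (use that in auto)
  have shift: "row_shift i (sc_letter x * f) = shift_theta i x * row_shift i f" for x f
    by (rule sc_subst_letter_mult[OF respects_parity_shift]) (auto simp: in_free_supercomm)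
  \<comment> \<open>The truncation order must vary in the induction, because a factor \<theta> can
    raise it by one; the given \<open>K\<close> is compared with the one obtained only at the
    end.\<close>
  have "\<exists>K. (\<forall>p>K. (?D ^^ p) f = 0) \<and> row_shift i f = ?exp K f"
    using assms(1)
  proof (induction rule: free_supercomm_induct)
    case scalar
    have "(?D ^^ p) 1 = 0" if "p > 0" for p
      using that by (cases p) (simp_all add: funpow_Suc_right funpow_row_derivation del: funpow.simps)
    then show ?case by (intro exI[of _ 0]) simp
  next
    case (add f g)
    then obtain K L where K: "\<forall>p>K. (?D ^^ p) f = 0" "row_shift i f = ?exp K f"
      and L: "\<forall>p>L. (?D ^^ p) g = 0" "row_shift i g = ?exp L g" by blast
    have "row_shift i f = ?exp (max K L) f" "row_shift i g = ?exp (max K L) g"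
      using exp_mono[of K f "max K L"] exp_mono[of L g "max K L"] K L by auto
    then show ?case using K L
      by (intro exI[of _ "max K L"])
        (simp add: funpow_row_derivation sc_subst_add distrib_left sum.distrib)
  next
    case (scale c f)
    then obtain K where K: "\<forall>p>K. (?D ^^ p) f = 0" "row_shift i f = ?exp K f" by blast
    then show ?case
      by (intro exI[of _ K]) (auto simp: funpow_row_derivation sc_subst_scale sum_distrib_left
          scalar_left_commute[of "sc_scalar c"] intro!: sum.cong)
  next
    case (letter x f)
    then obtain K where K: "\<forall>p>K. (?D ^^ p) f = 0" "row_shift i f = ?exp K f" by blast
    show ?case
    proof (cases x)
      case (Alpha k l)
      then show ?thesis using K
        by (intro exI[of _ K]) (simp add: funpow_row_derivation shift sum_distrib_left
            scalar_left_commute[of "alpha_elem _ _"])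
    next
      case (Theta l)
      then have l: "l < n" using letter(1) by (auto simp: torus_letters_def)
      have 0: "(?D ^^ p) (theta_elem l * f) = 0" if "p > Suc K" for p
        using K(1) that funpow_row_derivation(2)[OF l, where i = i and p = "p - 1" and f = f] by (cases p) auto
      have fact_eq: "sc_scalar (1 / fact (Suc p)) * (of_nat (Suc p) * g) = sc_scalar (1 / fact p) * g" for p g
      proof -
        have "sc_scalar (1 / fact (Suc p)) * (of_nat (Suc p) * g) =
            sc_scalar (1 / fact (Suc p)) * (sc_scalar (of_nat (Suc p)) * g)"
          by (simp only: sc_scalar_of_nat)
        also have "\<dots> = sc_scalar (1 / fact (Suc p) * of_nat (Suc p)) * g"
          by (simp only: sc_scalar_mult mult.assoc)
        also have "1 / fact (Suc p) * of_nat (Suc p) = (1 / fact p :: complex)"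
          by (simp add: field_simps del: of_nat_Suc)
        finally show ?thesis .
      qed
      have "?exp (Suc K) (theta_elem l * f) = theta_elem l * f +
          (\<Sum>p\<le>K. sc_scalar (1 / fact (Suc p)) * (?D ^^ Suc p) (theta_elem l * f))"
        by (subst sum.atMost_Suc_shift) simp
      also have "\<dots> = theta_elem l * f +
          (\<Sum>p\<le>K. theta_elem l * (sc_scalar (1 / fact (Suc p)) * (?D ^^ Suc p) f) +
             alpha_elem i l * (sc_scalar (1 / fact p) * (?D ^^ p) f))"
        unfolding funpow_row_derivation(2)[OF l] distrib_left fact_eq
          scalar_left_commute[of "theta_elem l"] scalar_left_commute[of "alpha_elem i l"] ..
      also have "\<dots> = theta_elem l * (f + (\<Sum>p\<le>K. sc_scalar (1 / fact (Suc p)) * (?D ^^ Suc p) f)) +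
          alpha_elem i l * ?exp K f"
        by (simp only: sum.distrib sum_distrib_left distrib_left add.assoc)
      also have "f + (\<Sum>p\<le>K. sc_scalar (1 / fact (Suc p)) * (?D ^^ Suc p) f) = ?exp (Suc K) f"
        by (subst sum.atMost_Suc_shift) simp
      also have "?exp (Suc K) f = ?exp K f" using exp_mono[of K f "Suc K"] K by simp
      finally have "row_shift i (theta_elem l * f) = ?exp (Suc K) (theta_elem l * f)"
        using K(2) by (simp add: shift distrib_right)
      then show ?thesis using 0 Theta by blast
    qed
  qed
  then obtain L where L: "\<forall>p>L. (?D ^^ p) f = 0" "row_shift i f = ?exp L f" by blast
  have "?exp L f = ?exp (max K L) f" using exp_mono[of L f "max K L"] L(1) by simp
  moreover have "?exp K f = ?exp (max K L) f" using exp_mono[of K f "max K L"] assms(2) by simp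
  ultimately show ?thesis using L(2) by simp
qed

lemma theta_deg_le_exists: "\<exists>D. theta_deg_le D f"
proof -
  let ?S = "wt_mset theta_wt ` {M. sc_coeff f M \<noteq> 0}"
  have "theta_deg_le (Max ?S) f" unfolding theta_deg_le_def
    using finite_support[of f] by (intro allI impI Max_ge) auto
  then show ?thesis by blast
qed

lemma theta_deg_le_funpow: "theta_deg_le D f \<Longrightarrow> theta_deg_le (D - p) ((row_derivation n i ^^ p) f)"
proof (induction p)
  case (Suc p)
  from theta_deg_le_row_derivation[OF Suc.IH[OF Suc.prems]] show ?case by simp
qed simp

lemma row_derivation_nilpotent:
  assumes "theta_deg_le D f" "p > D" shows "(row_derivation n i ^^ p) f = 0"
proof -
  obtain q where p: "p = Suc q" "D \<le> q" using assms(2) by (cases p) auto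
  have "theta_deg_le 0 ((row_derivation n i ^^ q) f)"
    using theta_deg_le_funpow[OF assms(1), of q] p(2) by simp
  then show ?thesis by (simp add: p row_derivation_theta_free)
qed

lemma row_shift_fixed_iff:
  assumes f: "f \<in> carrier (E_algebra m n)"
  shows "row_shift i f = f \<longleftrightarrow> row_derivation n i f = 0"
proof
  let ?D = "row_derivation n i"
  obtain K where K: "theta_deg_le K f" using theta_deg_le_exists by blast
  note nil = row_derivation_nilpotent[OF K, of _ n i]
  note exp = row_shift_eq_exp[OF f nil, of K, simplified]
  show "row_shift i f = f" if 0: "?D f = 0"
  proof -
    have "(?D ^^ p) f = 0" if "p \<noteq> 0" for p
      using that by (cases p) (simp_all add: funpow_Suc_right 0 funpow_row_derivation del: funpow.simps)
    then have "(\<Sum>p\<le>K. sc_scalar (1 / fact p) * (?D ^^ p) f) =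
        (\<Sum>p\<in>{0}. sc_scalar (1 / fact p) * (?D ^^ p) f)"
      by (intro sum.mono_neutral_right) auto
    then show ?thesis using exp by simp
  qed
  show "?D f = 0" if fixed: "row_shift i f = f"
  proof (rule ccontr)
    assume nz: "?D f \<noteq> 0"
    define P where "P = {p. (?D ^^ p) f \<noteq> 0}"
    have "P \<subseteq> {..K}" using nil by (auto simp: P_def not_le[symmetric])
    then have fin: "finite P" by (rule finite_subset) simp
    have "1 \<in> P" using nz by (simp add: P_def)
    define p where "p = Max P"
    have "p \<in> P" "p \<ge> 1" using fin \<open>1 \<in> P\<close> Max_in[of P] Max_ge[of P 1] unfolding p_def by blast+
    then have "1 \<le> K" using \<open>P \<subseteq> {..K}\<close> by auto
    have gt: "(?D ^^ q) f = 0" if "q > p" for q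
      using Max_ge[OF fin, of q] that unfolding p_def[symmetric] by (auto simp: P_def)
    \<comment> \<open>With p the last power that does not kill f, apply the power p - 1 to exp(D) f
      = f. Only the terms of order 0 and 1 survive, and they force the p-th power to vanish
      too.\<close>
    have "(?D ^^ (p - 1)) f = (\<Sum>q\<le>K. sc_scalar (1 / fact q) * (?D ^^ (p - 1 + q)) f)"
      by (subst (1) fixed[symmetric], subst exp)
        (simp add: funpow_row_derivation_sum funpow_row_derivation(5) funpow_add)
    also have "\<dots> = (\<Sum>q\<in>{0, 1}. sc_scalar (1 / fact q) * (?D ^^ (p - 1 + q)) f)"
    proof (rule sum.mono_neutral_right)
      show "\<forall>q\<in>{..K} - {0, 1}. sc_scalar (1 / fact q) * (?D ^^ (p - 1 + q)) f = 0"
      proof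
        fix q assume "q \<in> {..K} - {0, 1}"
        then have "p < p - 1 + q" using \<open>p \<ge> 1\<close> by auto
        then show "sc_scalar (1 / fact q) * (?D ^^ (p - 1 + q)) f = 0" by (simp only: gt mult_zero_right)
      qed
    qed (use \<open>1 \<le> K\<close> in auto)
    also have "\<dots> = (?D ^^ (p - 1)) f + (?D ^^ p) f" using \<open>p \<ge> 1\<close> by simp
    finally have "(?D ^^ p) f = 0" by simp
    then show False using \<open>p \<in> P\<close> by (simp add: P_def)
  qed
qed

text \<open>The shift is unitriangular for the \<theta>-degree: every term of the exponential except
  the identity lowers it.\<close>

lemma row_shift_basis:
  assumes "set_mset M' \<subseteq> torus_letters m n" "wt_mset theta_wt M' \<le> wt_mset theta_wt M"
  shows "sc_coeff (row_shift i (sc_basis M')) M = sc_coeff (sc_basis M') M"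
proof -
  let ?D = "row_derivation n i" and ?f = "sc_basis M'" and ?K = "wt_mset theta_wt M'"
  have f: "?f \<in> carrier (E_algebra m n)" using assms by (auto simp: in_free_supercomm sc_basis.rep_eq split: if_splits)
  have K: "theta_deg_le ?K ?f" by (auto simp: theta_deg_le_def sc_basis.rep_eq split: if_splits)
  have "sc_coeff ((?D ^^ p) ?f) M = 0" if "p \<in> {..?K} - {0}" for p
  proof -
    have "theta_deg_le (?K - p) ((?D ^^ p) ?f)" by (rule theta_deg_le_funpow[OF K])
    moreover have "\<not> wt_mset theta_wt M \<le> ?K - p" using assms(2) that by auto
    ultimately show ?thesis unfolding theta_deg_le_def by blast
  qed
  then have "(\<Sum>p\<le>?K. sc_coeff (sc_scalar (1 / fact p) * (?D ^^ p) ?f) M) =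
      (\<Sum>p\<in>{0}. sc_coeff (sc_scalar (1 / fact p) * (?D ^^ p) ?f) M)"
    by (intro sum.mono_neutral_right) auto
  then show ?thesis
    using row_shift_eq_exp[OF f row_derivation_nilpotent[OF K], of ?K i] by (simp add: sc_coeff_sum)
qed

subsection \<open>Generation of the invariants\<close>

definition invariants :: "nat \<Rightarrow> nat \<Rightarrow> torus_letter supercomm set" where
  "invariants m n = {f \<in> carrier (E_algebra m n). \<forall>i<m. row_derivation n i f = 0}"

lemma finite_bounded_multisets:
  assumes "finite A" shows "finite {M. set_mset M \<subseteq> A \<and> (\<forall>x. count M x \<le> k)}"
proof (rule finite_subset)
  show "{M. set_mset M \<subseteq> A \<and> (\<forall>x. count M x \<le> k)} \<subseteq> (\<Union>s\<le>card A * k. multisets_of_size A s)"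
  proof
    fix M assume M: "M \<in> {M. set_mset M \<subseteq> A \<and> (\<forall>x. count M x \<le> k)}"
    have "size M = (\<Sum>x\<in>set_mset M. count M x)" by (simp add: size_multiset_overloaded_eq)
    also have "\<dots> \<le> (\<Sum>x\<in>set_mset M. k)" using M by (intro sum_mono) auto
    also have "\<dots> \<le> card A * k" using M assms by (simp add: card_mono)
    finally show "M \<in> (\<Union>s\<le>card A * k. multisets_of_size A s)" using M by (simp add: multisets_of_size_def)
  qed
  show "finite (\<Union>s\<le>card A * k. multisets_of_size A s)" using assms by blast
qed

lemma finite_torus_letters: "finite (torus_letters m n)"
proof -
  have "torus_letters m n = (\<lambda>(i, j). Alpha i j) ` ({..<m} \<times> {..<n}) \<union> Theta ` {..<n}"
    by (auto simp: torus_letters_def)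
  then show ?thesis by simp
qed

lemma finite_torus_monomials: "finite {M. set_mset M \<subseteq> torus_letters m n \<and> sc_monomial M}"
  using finite_bounded_multisets[OF finite_torus_letters, of m n 1]
  by (simp add: sc_monomial_def)

lemma row_letters_torus:
  "letter_rows.row_letters (torus_row m) n {..<Suc m} = torus_letters m n"
  by (auto simp: torus.row_letters_def torus_row_def torus_letters_def less_Suc_eq)

lemma q_elem_carrier: "N \<in> msets n (Suc m) \<Longrightarrow> q_elem m N \<in> carrier (E_algebra m n)"
  using torus.qhat_carrier[of "[0..<Suc m]" "{..<Suc m}" m n N]
  by (simp add: q_elem_eq_qhat row_letters_torus atLeast0LessThan del: upt_Suc)

lemma row_derivation_q_elem_mult:
  assumes "i < m" "N \<in> msets n (Suc m)"
  shows "row_derivation n i (q_elem m N * f) = q_elem m N * row_derivation n i f"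
  using torus.E_qhat[of i m "[0..<Suc m]" m n N f] assms
  by (simp add: row_derivation_def q_elem_eq_qhat torus_row_def)

text \<open>
  A complement of the subalgebra generated by the given elements, orthogonal for the inner product
  that makes the monomials orthonormal, is stable under the adjoints of the \<open>q\<^sub>N\<close>; by induction on
  the \<open>\<theta>\<close>-degree these adjoints kill it, and then it is free of \<open>\<theta>\<close>.
\<close>

theorem invariants_generated:
  assumes S: "S \<subseteq> invariants m n"
    and S0: "\<And>f. f \<in> carrier (free_supercomm {Alpha i j | i j. i < m \<and> j < n}) \<Longrightarrow> f \<in> S"
    and S1: "\<And>f g. \<lbrakk>f \<in> S; g \<in> S\<rbrakk> \<Longrightarrow> f + g \<in> S" "\<And>c f. f \<in> S \<Longrightarrow> sc_scalar c * f \<in> S"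
    and S2: "\<And>N f. \<lbrakk>N \<in> msets n (Suc m); f \<in> S\<rbrakk> \<Longrightarrow> q_elem m N * f \<in> S"
  shows "invariants m n \<subseteq> S"
proof
  let ?p = "pairing (mono_weight (\<lambda>_. 1))"
  let ?T = "{M. set_mset M \<subseteq> torus_letters m n \<and> sc_monomial M}"
  let ?as = "[0..<Suc m]"
  have W: "mono_weight (\<lambda>_. 1) M > 0" for M :: "torus_letter multiset" by (rule mono_weight_pos) simp
  have theta_free: "z = 0" if "z \<in> carrier (E_algebra m n)" "theta_deg_le 0 z" "\<And>w. w \<in> S \<Longrightarrow> ?p w z = 0" for z
  proof -
    have "x \<in> {Alpha i j | i j. i < m \<and> j < n}" if "sc_coeff z M \<noteq> 0" "x \<in># M" for x M
    proof -
      have "x \<in> torus_letters m n" using \<open>z \<in> _\<close> that by (auto simp: in_free_supercomm)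
      moreover have "wt_mset theta_wt M = 0" using \<open>theta_deg_le 0 z\<close> that by (simp add: theta_deg_le_def)
      with that(2) have "theta_wt x = 0" by (metis insert_DiffM wt_mset_simps(2) add_is_0)
      ultimately show ?thesis by (auto simp: torus_letters_def)
    qed
    then have "z \<in> S" by (intro S0) (auto simp: in_free_supercomm)
    then have "?p z z = 0" using that by blast
    then show "z = 0" using pairing_self_eq_0[where W = "mono_weight (\<lambda>_. 1)" and f = z] W by blast
  qed
  have claim: "z = 0" if "z \<in> invariants m n" "theta_deg_le D z" "\<And>w. w \<in> S \<Longrightarrow> ?p w z = 0" for D z
    using that
  proof (induction D arbitrary: z)
    case 0
    then show ?case using theta_free by (auto simp: invariants_def)
  next
    case (Suc D)
    have E0: "torus.E n m i m (torus.point z) = 0" if "i < m" for i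
      using Suc.prems(1) that
      unfolding fun_eq_iff torus.E_apply
      by (auto simp: torus.point_def invariants_def row_derivation_def torus_row_def)
    \<comment> \<open>Up to sign these coefficients are the adjoints of multiplication by q_N
      applied to z. They are again invariant and orthogonal to \<open>S\<close>, and of smaller
      \<theta>-degree, so the induction hypothesis applies.\<close>
    have "foldr (torus.Up n m) ?as (torus.point z) N = 0" for N
    proof (rule Suc.IH)
      have closed: "foldr (torus.Up n m) as (torus.point z) N \<in> carrier (E_algebra m n)" for as N
        using Suc.prems(1)
        by (induction as arbitrary: N)
          (auto simp: torus.Up_apply torus.point_def invariants_def free_supercomm_zero
            intro!: free_supercomm_sum free_supercomm_of_nat_mult free_supercomm_deriv)
      moreover have "row_derivation n i (foldr (torus.Up n m) ?as (torus.point z) N) = 0" if "i < m" for i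
      proof -
        have "torus.E n m i m (foldr (torus.Up n m) ?as (torus.point z)) = 0"
          using that torus.E_foldr_Up[where a = i and b = m and as = ?as and v = "torus.point z"] by (simp add: E0 del: upt_Suc)
        from fun_cong[OF this, of N] show ?thesis using that
          unfolding torus.E_apply by (simp add: row_derivation_def torus_row_def del: upt_Suc)
      qed
      ultimately show "foldr (torus.Up n m) ?as (torus.point z) N \<in> invariants m n" by (simp add: invariants_def del: upt_Suc)
      have low: "theta_deg_le D (torus.Up n m m (torus.point z) N)" for N
        unfolding torus.Up_apply
      proof (intro theta_deg_le_sum theta_deg_le_of_nat)
        fix j
        show "theta_deg_le D (sc_deriv (torus_row m m j) (torus.point z (N - {#j#})))"
          using theta_deg_le_deriv[OF Suc.prems(2), of "Theta j"] by (simp add: torus_row_def torus.point_def theta_deg_le_0)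
      qed
      have deriv: "theta_deg_le D f \<Longrightarrow> theta_deg_le D (sc_deriv x f)" for x f
        using theta_deg_le_deriv[of D f x] unfolding theta_deg_le_def by (meson diff_le_self le_trans)
      have "theta_deg_le D (foldr (torus.Up n m) as (torus.Up n m m (torus.point z)) N)" for as N
      proof (induction as arbitrary: N)
        case (Cons a as)
        then show ?case
          by (auto simp: torus.Up_apply intro!: theta_deg_le_sum theta_deg_le_of_nat deriv)
      qed (simp add: low)
      \<comment> \<open>The innermost factor belongs to the \<theta> row and removes one \<theta>;
        the remaining factors differentiate by \<alpha> and do not raise the degree.\<close>
      from this[of "[0..<m]"] show "theta_deg_le D (foldr (torus.Up n m) ?as (torus.point z) N)" by simp
      fix w assume w: "w \<in> S"
      have "torus_qhat m n ?as N * w = 0 \<or> torus_qhat m n ?as N * w \<in> S"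
      proof (cases "N \<in> msets n (Suc m)")
        case True
        then show ?thesis using S2[OF True w] by (simp add: q_elem_eq_qhat del: upt_Suc)
      next
        case False
        then show ?thesis using torus.qhat_eq_0[where N = N and as = ?as and n = n and m = m] by (simp del: upt_Suc)
      qed
      then have "?p (torus_qhat m n ?as N * w) z = 0" using Suc.prems(3) by auto
      moreover have "foldr (torus.Cr n m) (rev ?as) (torus.point w) N = torus_qhat m n ?as N * w \<or>
          foldr (torus.Cr n m) (rev ?as) (torus.point w) N = - (torus_qhat m n ?as N * w)"
        using torus.Cr.foldr_X_rev[where as = ?as and v = "torus.point w" and n = n and m = m]
      proof
        assume "foldr (torus.Cr n m) (rev ?as) (torus.point w) = foldr (torus.Cr n m) ?as (torus.point w)"
        from fun_cong[OF this, of N] show ?thesis by (simp only: torus.foldr_Cr_point simp_thms)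
      next
        assume "foldr (torus.Cr n m) (rev ?as) (torus.point w) = - foldr (torus.Cr n m) ?as (torus.point w)"
        from fun_cong[OF this, of N] show ?thesis
          by (simp only: torus.foldr_Cr_point uminus_apply simp_thms)
      qed
      ultimately show "?p w (foldr (torus.Up n m) ?as (torus.point z) N) = 0"
        unfolding torus.pairing_foldr_Up
        by (elim disjE) (simp_all only: pairing_minus_left minus_zero)
    qed
    then have "foldr (torus.Up n m) ?as (torus.point z) = 0" by (auto simp: fun_eq_iff)
    \<comment> \<open>As a series in u, \<open>point z\<close> is constant, and invariance of z
      supplies the vanishing of \<open>E i m\<close>. The conclusion says that the number of letters
      \<theta> in z is zero.\<close>
    then have "torus.E n m m m (torus.point z) = 0"
      using torus.Up_kernel[where m = m and n = n and v = "torus.point z"] E0 by (auto simp: torus.point_def fun_eq_iff)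
    then have E: "of_nat (\<Sum>j<n. count M (Theta j)) * sc_coeff z M = 0" for M
      using torus.sc_coeff_E_same[where m = m and n = n and a = m and v = "torus.point z" and N = "{#}" and M = M] by (simp add: torus.point_def torus_row_def)
    have "theta_deg_le 0 z" unfolding theta_deg_le_def
    proof (intro allI impI)
      fix M assume M: "sc_coeff z M \<noteq> 0"
      then have "(\<Sum>j<n. count M (Theta j)) = 0" using E[of M] by (metis mult_eq_0_iff of_nat_eq_0_iff)
      then have cnt: "count M (Theta j) = 0" if "j < n" for j using that by simp
      have "theta_wt x = 0" if "x \<in># M" for x
      proof -
        have "x \<in> torus_letters m n" using Suc.prems(1) M that by (auto simp: invariants_def in_free_supercomm)
        then show ?thesis using cnt that by (auto simp: torus_letters_def not_in_iff[symmetric])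
      qed
      then show "wt_mset theta_wt M \<le> 0" by (simp add: wt_mset_def)
    qed
    then show ?case using theta_free Suc.prems by (auto simp: invariants_def)
  qed
  fix f assume f: "f \<in> invariants m n"
  have "\<exists>y\<in>S. \<forall>w\<in>S. ?p w (f - y) = 0"
  proof (rule orthogonal_decomposition[OF finite_torus_monomials[of m n] W])
    show "{M. sc_coeff g M \<noteq> 0} \<subseteq> ?T" if "g \<in> S" for g
      using S that sc_coeff_monomial by (auto simp: invariants_def in_free_supercomm)
    show "0 \<in> S" by (rule S0) (rule free_supercomm_zero)
  qed (use S1 in auto)
  then obtain y where y: "y \<in> S" "\<And>w. w \<in> S \<Longrightarrow> ?p w (f - y) = 0" by blast
  have "f - y \<in> invariants m n"
    using f S y(1) by (auto simp: invariants_def row_derivation_diff intro!: free_supercomm_diff)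
  moreover obtain D where "theta_deg_le D (f - y)" using theta_deg_le_exists by blast
  ultimately have "f - y = 0" using claim y(2) by blast
  then show "f \<in> S" using y(1) by simp
qed

section \<open>The relations among the generators\<close>

definition mset_fact :: "'a multiset \<Rightarrow> nat" where
  "mset_fact N = (\<Prod>j\<in>set_mset N. fact (count N j))"

lemma mset_fact_empty [simp]: "mset_fact {#} = 1"
  by (simp add: mset_fact_def)

lemma mset_fact_add_mset: "mset_fact (add_mset j N) = Suc (count N j) * mset_fact N"
  unfolding mset_fact_def prod_fact_count_add_mset by simp

lemma mset_fact_pos: "mset_fact N > 0"
  by (simp add: mset_fact_def prod_pos)

section \<open>Expansion of products of the operators \<open>Dn\<close>\<close>

context letter_rows
begin

lemma U_apply: "U v N = (\<Sum>j<n. of_nat (count N j) * v N)"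
  unfolding U_def sum_fun_apply
proof (intro sum.cong refl)
  fix j
  show "unshift j (shift j v) N = of_nat (count N j) * v N"
    by (cases "j \<in># N") (auto simp: not_in_iff)
qed

text \<open>Put d/du_j for u_j in the series defining \<open>qhat\<close>: the product of the
  \<open>Dn a\<close> is the differential operator with coefficients qhat(M) / M!.\<close>

lemma foldr_Dn_apply:
  "foldr Dn as h K =
     (\<Sum>M\<in>msets n (length as). sc_scalar (1 / of_nat (mset_fact M)) * (qhat as M * h (M + K)))"
proof (induction as arbitrary: K)
  case Nil
  have "msets n 0 = {{#}}" by (auto simp: msets_def)
  then show ?case by (simp add: qhat_Nil)
next
  case (Cons a as)
  let ?l = "length as"
  let ?s = "\<lambda>M. sc_scalar (1 / of_nat (mset_fact M))"
  have step: "(\<Sum>M\<in>msets n ?l. ?s M * (sc_letter (b a j) * qhat as M * h (add_mset j (M + K)))) =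
      (\<Sum>M\<in>msets n (Suc ?l). ?s M * (of_nat (count M j) * (sc_letter (b a j) * qhat as (M - {#j#})) * h (M + K)))"
    if "j < n" for j
  proof -
    have s: "?s (add_mset j M) * (of_nat (count (add_mset j M) j) * y) = ?s M * y" for M and y :: "'g supercomm"
    proof -
      have "?s (add_mset j M) * (of_nat (count (add_mset j M) j) * y) =
          sc_scalar (1 / of_nat (mset_fact (add_mset j M)) * of_nat (Suc (count M j))) * y"
        by (simp only: sc_scalar_mult sc_scalar_of_nat mult.assoc count_add_mset simp_thms if_True)
      also have "1 / of_nat (mset_fact (add_mset j M)) * of_nat (Suc (count M j)) = (1 / of_nat (mset_fact M) :: complex)"
        unfolding mset_fact_add_mset of_nat_mult using mset_fact_pos[of M]
        by (simp add: field_simps del: of_nat_Suc)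
      finally show ?thesis .
    qed
    have "(\<Sum>M\<in>msets n (Suc ?l). ?s M * (of_nat (count M j) * (sc_letter (b a j) * qhat as (M - {#j#})) * h (M + K)))
        = (\<Sum>M\<in>add_mset j ` msets n ?l. ?s M * (of_nat (count M j) * (sc_letter (b a j) * qhat as (M - {#j#})) * h (M + K)))"
    proof (rule sum.mono_neutral_right)
      show "add_mset j ` msets n ?l \<subseteq> msets n (Suc ?l)" using that by (auto simp: in_msets_simps)
      show "\<forall>M\<in>msets n (Suc ?l) - add_mset j ` msets n ?l.
          ?s M * (of_nat (count M j) * (sc_letter (b a j) * qhat as (M - {#j#})) * h (M + K)) = 0"
      proof
        fix M assume M: "M \<in> msets n (Suc ?l) - add_mset j ` msets n ?l"
        then have "j \<notin># M" using msets_diff_single[of M n ?l j] by (metis DiffE image_eqI insert_DiffM)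
        then have "count M j = 0" by (simp add: not_in_iff)
        then show "?s M * (of_nat (count M j) * (sc_letter (b a j) * qhat as (M - {#j#})) * h (M + K)) = 0"
          by simp
      qed
    qed simp
    also have "\<dots> = (\<Sum>M\<in>msets n ?l. ?s (add_mset j M) * (of_nat (count (add_mset j M) j) *
        (sc_letter (b a j) * qhat as M * h (add_mset j (M + K)))))"
      by (subst sum.reindex) (auto simp: inj_on_def mult.assoc)
    finally show ?thesis unfolding s ..
  qed
  have "foldr Dn (a # as) h K = (\<Sum>j<n. \<Sum>M\<in>msets n ?l. ?s M * (sc_letter (b a j) * qhat as M * h (add_mset j (M + K))))"
    unfolding foldr.simps comp_apply Dn_apply Cons.IH sum_distrib_left
    by (simp add: scalar_left_commute[of "sc_letter _"] mult.assoc)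
  also have "\<dots> = (\<Sum>j<n. \<Sum>M\<in>msets n (Suc ?l). ?s M * (of_nat (count M j) * (sc_letter (b a j) * qhat as (M - {#j#})) * h (M + K)))"
    by (intro sum.cong refl step) simp
  also have "\<dots> = (\<Sum>M\<in>msets n (length (a # as)). ?s M * (qhat (a # as) M * h (M + K)))"
    by (subst sum.swap) (simp add: qhat_Cons sum_distrib_right sum_distrib_left)
  finally show ?case .
qed

lemma foldr_Dn_exchange:
  assumes "\<And>K. (\<Sum>j\<in>#N. G j (add_mset j K)) = 0"
  shows "(\<Sum>j\<in>#N. foldr Dn as (G j) (add_mset j K)) = 0"
proof (induction as arbitrary: K)
  case (Cons a as)
  have "(\<Sum>j\<in>#N. foldr Dn (a # as) (G j) (add_mset j K)) =
      (\<Sum>j\<in>#N. \<Sum>i<n. sc_letter (b a i) * foldr Dn as (G j) (add_mset j (add_mset i K)))"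
    by (simp add: Dn_apply add_mset_commute)
  also have "\<dots> = (\<Sum>i<n. sc_letter (b a i) * (\<Sum>j\<in>#N. foldr Dn as (G j) (add_mset j (add_mset i K))))"
    by (induction N) (simp_all add: sum.distrib distrib_left)
  also have "\<dots> = 0" by (simp add: Cons.IH)
  finally show ?case .
qed (use assms in simp)

text \<open>Moving the derivative by the letter in row a, column j past \<open>Dn a\<close> leaves a
  shift by j, and the shifts add up to 0 by the last hypothesis. In the application the two
  hypotheses on G come from the linear and from the quadratic relations.\<close>

lemma deriv_foldr_Dn:
  assumes "set_mset N \<subseteq> {..<n}"
    and "\<And>K. (\<Sum>j\<in>#N. sc_deriv (b a j) (G j K)) = 0" "\<And>K. (\<Sum>j\<in>#N. G j (add_mset j K)) = 0"
  shows "(\<Sum>j\<in>#N. sc_deriv (b a j) (foldr Dn as (G j) K)) = 0"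
proof (induction as arbitrary: K)
  case (Cons e as)
  let ?H = "\<lambda>j. foldr Dn as (G j)"
  have deriv: "sc_deriv (b a j) (sc_letter (b e i) * f) =
      (if e = a then if i = j then f else 0 else 0) - sc_letter (b e i) * sc_deriv (b a j) f" for i j f
    using sc_deriv_letter_mult_same[of "b a j" f] sc_deriv_letter_mult_other[of "b a j" "b e i" f]
    by (auto simp: b_inject)
  have "(\<Sum>j\<in>#N. sc_deriv (b a j) (foldr Dn (e # as) (G j) K)) =
     (\<Sum>j\<in>#N. (if e = a then ?H j (add_mset j K) else 0) -
        (\<Sum>i<n. sc_letter (b e i) * sc_deriv (b a j) (?H j (add_mset i K))))"
  proof (intro sum_mset_cong)
    fix j assume "j \<in># N"
    then have "j < n" using assms(1) by auto
    then show "sc_deriv (b a j) (foldr Dn (e # as) (G j) K) = (if e = a then ?H j (add_mset j K) else 0) -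
        (\<Sum>i<n. sc_letter (b e i) * sc_deriv (b a j) (?H j (add_mset i K)))"
      by (auto simp: Dn_apply sc_deriv_sum deriv sum_subtractf)
  qed
  also have "\<dots> = (if e = a then \<Sum>j\<in>#N. ?H j (add_mset j K) else 0) -
      (\<Sum>i<n. sc_letter (b e i) * (\<Sum>j\<in>#N. sc_deriv (b a j) (?H j (add_mset i K))))"
    by (induction N) (simp_all add: sum.distrib distrib_left)
  also have "\<dots> = 0" using foldr_Dn_exchange[of G N, OF assms(3)] by (simp add: Cons.IH)
  finally show ?case .
qed (use assms in simp)

end

lemma homogeneous_zero_weight:
  assumes "f \<in> carrier (free_supercomm L)" "\<And>x. x \<in> L \<Longrightarrow> wt x = 0"
  shows "homogeneous wt 0 f"
  using assms by (auto simp: homogeneous_def in_free_supercomm wt_mset_def)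

lemma sc_deriv_homogeneous_0:
  assumes "homogeneous wt 0 f" "wt x > 0" shows "sc_deriv x f = 0"
proof (rule supercomm_eqI)
  fix M
  have "sc_coeff f (add_mset x M) = 0" using assms unfolding homogeneous_def by fastforce
  then show "sc_coeff (sc_deriv x f) M = sc_coeff 0 M" by (simp add: sc_coeff_deriv)
qed

section \<open>Contractions and partial evaluation\<close>

interpretation gen: letter_rows GenAlpha n "Suc m" for m n
  by unfold_locales (auto simp: odd_letter_gen_letter_def)

abbreviation gen_qhat :: "nat \<Rightarrow> nat list \<Rightarrow> nat multiset \<Rightarrow> gen_letter supercomm" where
  "gen_qhat n \<equiv> letter_rows.qhat GenAlpha n"

lemma odd_gen_letter [simp]: "odd_letter (GenAlpha i j)" "odd_letter (GenQ N) \<longleftrightarrow> odd (size N)"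
  by (simp_all add: odd_letter_gen_letter_def)

text \<open>The letter \<open>GenAlpha m j\<close>, which is not one of the generators, plays the role of \<open>\<theta>\<^sub>j\<close>.\<close>

definition ext_letters :: "nat \<Rightarrow> nat \<Rightarrow> gen_letter set" where
  "ext_letters m n = {GenAlpha i j | i j. i < Suc m \<and> j < n} \<union> {GenQ N | N. N \<in> msets n (Suc m)}"

definition q_wt :: "gen_letter \<Rightarrow> nat" where
  "q_wt x = (case x of GenAlpha _ _ \<Rightarrow> 0 | GenQ _ \<Rightarrow> 1)"

lemma q_wt_simps [simp]: "q_wt (GenAlpha i j) = 0" "q_wt (GenQ N) = 1"
  by (simp_all add: q_wt_def)

text \<open>The factor N! makes the contractions of z the coefficients of an exponential series.
  With the scales chosen for the inner product below, it also makes contraction the adjoint of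
  multiplication by \<open>GenQ N\<close>.\<close>

definition contraction :: "nat multiset \<Rightarrow> gen_letter supercomm \<Rightarrow> gen_letter supercomm" where
  "contraction N z = of_nat (mset_fact N) * sc_deriv (GenQ N) z"

lemma additive_contraction: "Modules.additive (contraction N)"
  by (simp add: Modules.additive_def contraction_def sc_deriv_add distrib_left)

lemmas contraction_0 [simp] = additive_contraction[THEN additive.zero]
lemmas contraction_sum_mset = additive_sum_mset[OF additive_contraction]

lemma contraction_carrier:
  "f \<in> carrier (free_supercomm L) \<Longrightarrow> contraction N f \<in> carrier (free_supercomm L)"
  by (simp add: contraction_def free_supercomm_of_nat_mult free_supercomm_deriv)

lemma contraction_deriv:
  "sc_deriv (GenAlpha a j) (contraction N z) =
     (if odd (size N) then - contraction N (sc_deriv (GenAlpha a j) z) else contraction N (sc_deriv (GenAlpha a j) z))"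
  using sc_deriv_commute[of "GenAlpha a j" "GenQ N" z]
  by (simp add: contraction_def sc_deriv_of_nat_mult)

lemma contraction_contraction:
  "contraction N (contraction M z) =
     (if odd (size N) \<and> odd (size M) then - contraction M (contraction N z) else contraction M (contraction N z))"
  using sc_deriv_commute[of "GenQ N" "GenQ M" z]
  by (simp add: contraction_def sc_deriv_of_nat_mult mult_of_nat_left_commute[of "of_nat (mset_fact M)"])

text \<open>
  By adjointness of letters and contractions, this is orthogonality to all multiples of the
  relations, including linear relations for the row of the \<open>\<theta>\<^sub>j\<close>.
\<close>

definition orthogonal_to_relations :: "nat \<Rightarrow> nat \<Rightarrow> gen_letter supercomm \<Rightarrow> bool" where
  "orthogonal_to_relations m n z \<longleftrightarrow>
     (\<forall>a<Suc m. \<forall>N\<in>msets n (Suc (Suc m)).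
        (\<Sum>j\<in>#N. sc_deriv (GenAlpha a j) (contraction (N - {#j#}) z)) = 0) \<and>
     (\<forall>N1\<in>msets n m. \<forall>N2\<in>msets n (Suc (Suc m)).
        (\<Sum>j\<in>#N2. contraction (N2 - {#j#}) (contraction (add_mset j N1) z)) = 0)"

definition contractions :: "nat \<Rightarrow> nat \<Rightarrow> gen_letter supercomm \<Rightarrow> nat multiset \<Rightarrow> gen_letter supercomm" where
  "contractions m n z = (\<lambda>N. if N \<in> msets n (Suc m) then contraction N z else 0)"

text \<open>The even derivation that sends the symbol \<open>GenQ M\<close> to its value and kills
  the letters \<open>GenAlpha\<close>: one symbol at a time is evaluated, in all possible
  ways.\<close>

definition evaluate_one :: "nat \<Rightarrow> nat \<Rightarrow> gen_letter supercomm \<Rightarrow> gen_letter supercomm" where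
  "evaluate_one m n z = (\<Sum>M\<in>msets n (Suc m). gen_qhat n [0..<Suc m] M * sc_deriv (GenQ M) z)"

lemma scalar_inverse_mset_fact:
  "sc_scalar (1 / of_nat (mset_fact M)) * (f * contraction M z) = f * sc_deriv (GenQ M) z"
proof -
  have "sc_scalar (1 / of_nat (mset_fact M)) * (of_nat (mset_fact M) * y) = y" for y :: "gen_letter supercomm"
    using mset_fact_pos[of M]
    by (simp flip: sc_scalar_of_nat mult.assoc sc_scalar_mult)
  then show ?thesis unfolding contraction_def by (simp add: mult_of_nat_left_commute[of f])
qed

lemma evaluate_one_eq_foldr: "evaluate_one m n z = foldr (gen.Dn n) [0..<Suc m] (contractions m n z) {#}"
  unfolding gen.foldr_Dn_apply evaluate_one_def
  by (intro sum.cong) (simp_all add: contractions_def scalar_inverse_mset_fact del: upt_Suc)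

text \<open>The contractions form a series of degree m + 1 in u. Orthogonality to the linear
  relations says that every \<open>Up a\<close> kills it, the \<theta> row included, and
  \<open>evaluate_one\<close> is its image under the product of all \<open>Dn\<close>. So
  \<open>Dn_injective\<close> applies.\<close>

lemma contractions_injective:
  assumes "orthogonal_to_relations m n z" "evaluate_one m n z = 0"
  shows "contractions m n z = 0"
proof (rule gen.Dn_injective[where m = m and n = n])
  let ?v = "contractions m n z"
  show "gen.Up n a ?v = 0" if "a < Suc m" for a
  proof
    fix N
    show "gen.Up n a ?v N = 0 N"
    proof (cases "N \<in> msets n (Suc (Suc m))")
      case True
      then have "gen.Up n a ?v N = (\<Sum>j\<in>#N. sc_deriv (GenAlpha a j) (?v (N - {#j#})))"
        by (intro gen.Up_apply_valid) (auto simp: msets_def)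
      also have "\<dots> = (\<Sum>j\<in>#N. sc_deriv (GenAlpha a j) (contraction (N - {#j#}) z))"
        using msets_diff_single[OF True]
        by (intro sum_mset_cong) (simp add: contractions_def)
      finally show ?thesis using assms(1) that True by (simp add: orthogonal_to_relations_def)
    next
      case False
      have "of_nat (count N j) * sc_deriv (GenAlpha a j) (?v (N - {#j#})) = 0" if "j < n" for j
      proof (cases "j \<in># N")
        case True
        then have "N - {#j#} \<notin> msets n (Suc m)"
          using False that in_msets_simps(2)[of j "N - {#j#}" n "Suc m"] by simp
        then show ?thesis by (simp add: contractions_def)
      qed (simp add: not_in_iff)
      then show ?thesis by (simp add: gen.Up_apply)
    qed
  qed
  show "gen.U n ?v = (\<Sum>i<Suc m. ?v)"
  proof
    fix N
    have "gen.U n ?v N = of_nat (\<Sum>j<n. count N j) * ?v N"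
      by (simp add: gen.U_apply sum_distrib_right)
    also have "\<dots> = of_nat (Suc m) * ?v N"
    proof (cases "N \<in> msets n (Suc m)")
      case True
      then have "(\<Sum>j<n. count N j) = Suc m"
        using sum_count_eq_sum_mset[of N n "\<lambda>_. 1 :: nat"] by (simp add: msets_def)
      then show ?thesis by simp
    qed (simp add: contractions_def)
    finally show "gen.U n ?v N = (\<Sum>i<Suc m. ?v) N" by (subst sum_fun_apply) (simp only: sum_constant card_lessThan)
  qed
  have "foldr (gen.Dn n) [0..<Suc m] ?v = 0"
  proof
    fix K
    show "foldr (gen.Dn n) [0..<Suc m] ?v K = 0 K"
    proof (cases "K = {#}")
      case True
      then show ?thesis using assms(2) by (simp add: evaluate_one_eq_foldr del: upt_Suc)
    next
      case False
      \<comment> \<open>The product of m + 1 operators \<open>Dn\<close> lowers the degree to 0, so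
        only the coefficient at \<open>{#}\<close> can survive.\<close>
      have "?v (M + K) = 0" if "M \<in> msets n (Suc m)" for M
        using False that by (auto simp: contractions_def msets_def)
      then show ?thesis by (simp add: gen.foldr_Dn_apply del: upt_Suc)
    qed
  qed
  then show "foldr (gen.Dn n) (rev [0..<Suc m]) ?v = 0"
    using gen.Dn.foldr_X_rev[where as = "[0..<Suc m]" and v = ?v and n = n]
    by (auto simp del: upt_Suc)
qed

lemma has_parity_gen_qhat:
  "has_parity {GenAlpha i j | i j. i < Suc m \<and> j < n} (odd (Suc m)) (gen_qhat n [0..<Suc m] N)"
proof -
  have "letter_rows.row_letters GenAlpha n {..<Suc m} = {GenAlpha i j | i j. i < Suc m \<and> j < n}"
    by (auto simp: gen.row_letters_def)
  then show ?thesis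
    using gen.has_parity_qhat[of "[0..<Suc m]" "{..<Suc m}" n N] by (simp add: atLeast0LessThan del: upt_Suc)
qed

lemma gen_qhat_carrier: "gen_qhat n [0..<Suc m] N \<in> carrier (free_supercomm {GenAlpha i j | i j. i < Suc m \<and> j < n})"
  by (rule has_parity_carrier[OF has_parity_gen_qhat])

lemma evaluate_one_add: "evaluate_one m n (y + z) = evaluate_one m n y + evaluate_one m n z"
  by (simp add: evaluate_one_def sc_deriv_add distrib_left sum.distrib del: upt_Suc)

lemma additive_evaluate_one: "Modules.additive (evaluate_one m n)"
  by (simp add: Modules.additive_def evaluate_one_add)

text \<open>The value of \<open>GenQ M\<close> contains no symbol and has the parity of
  \<open>GenQ M\<close>; the sign from passing the value cancels the sign from exchanging the two
  derivatives.\<close>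

lemma contraction_evaluate_one:
  assumes "N \<in> msets n (Suc m)"
  shows "contraction N (evaluate_one m n z) = evaluate_one m n (contraction N z)"
proof -
  have "sc_deriv (GenQ N) (gen_qhat n [0..<Suc m] M * sc_deriv (GenQ M) z) =
      gen_qhat n [0..<Suc m] M * sc_deriv (GenQ M) (sc_deriv (GenQ N) z)" if "M \<in> msets n (Suc m)" for M
    using deriv_has_parity_mult[OF has_parity_gen_qhat[of m n M], of "GenQ N" "sc_deriv (GenQ M) z"]
      sc_deriv_commute[of "GenQ N" "GenQ M" z] assms that
    by (auto simp: msets_def simp del: upt_Suc)
  then show ?thesis
    by (simp add: contraction_def evaluate_one_def sc_deriv_sum sc_deriv_of_nat_mult sum_distrib_left
        mult_of_nat_left_commute[of "letter_rows.qhat _ _ _ _"] del: upt_Suc)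
qed

lemma sum_mset_uniform_sign:
  "(\<Sum>j\<in>#N. if P then - f j else f j) = (if P then - (\<Sum>j\<in>#N. f j) else (\<Sum>j\<in>#N. f j :: 'a::ab_group_add))"
  by (induction N) auto

text \<open>For the quadratic relations, contractions simply commute with
  \<open>evaluate_one\<close>. For the linear ones, a derivative also hits the \<alpha> and \<theta>
  in the newly inserted values, and the extra terms vanish by orthogonality to the quadratic
  relations.\<close>

lemma orthogonal_evaluate_one:
  assumes "orthogonal_to_relations m n z"
  shows "orthogonal_to_relations m n (evaluate_one m n z)"
  unfolding orthogonal_to_relations_def
proof (intro conjI allI impI ballI)
  let ?T = "evaluate_one m n"
  fix N1 N2 assume N: "N1 \<in> msets n m" "N2 \<in> msets n (Suc (Suc m))"
  have "(\<Sum>j\<in>#N2. contraction (N2 - {#j#}) (contraction (add_mset j N1) (?T z))) =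
      (\<Sum>j\<in>#N2. ?T (contraction (N2 - {#j#}) (contraction (add_mset j N1) z)))"
  proof (intro sum_mset_cong)
    fix j assume j: "j \<in># N2"
    then have "add_mset j N1 \<in> msets n (Suc m)" "N2 - {#j#} \<in> msets n (Suc m)"
      using N msets_diff_single[OF N(2) j] by (auto simp: in_msets_simps) (auto simp: msets_def)
    then show "contraction (N2 - {#j#}) (contraction (add_mset j N1) (?T z)) =
        ?T (contraction (N2 - {#j#}) (contraction (add_mset j N1) z))"
      by (simp add: contraction_evaluate_one)
  qed
  also have "\<dots> = ?T (\<Sum>j\<in>#N2. contraction (N2 - {#j#}) (contraction (add_mset j N1) z))"
    by (simp add: additive_sum_mset[OF additive_evaluate_one])
  also have "\<dots> = 0"
    using assms N by (simp add: orthogonal_to_relations_def additive.zero[OF additive_evaluate_one])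
  finally show "(\<Sum>j\<in>#N2. contraction (N2 - {#j#}) (contraction (add_mset j N1) (?T z))) = 0" .
next
  let ?T = "evaluate_one m n"
  fix a N assume a: "a < Suc m" and N: "N \<in> msets n (Suc (Suc m))"
  \<comment> \<open>The series of second contractions, with j fixed by the linear relation. The
    condition on \<open>?G j (add_mset j K)\<close> is then, up to a uniform sign, the quadratic
    relation for K and N.\<close>
  let ?G = "\<lambda>j. contractions m n (contraction (N - {#j#}) z)"
  have size: "size (N - {#j#}) = Suc m" if "j \<in># N" for j
    using msets_diff_single[OF N that] by (simp add: msets_def)
  have "(\<Sum>j\<in>#N. sc_deriv (GenAlpha a j) (contraction (N - {#j#}) (?T z))) =
      (\<Sum>j\<in>#N. sc_deriv (GenAlpha a j) (foldr (gen.Dn n) [0..<Suc m] (?G j) {#}))"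
    using msets_diff_single[OF N]
    by (intro sum_mset_cong)
      (simp add: contraction_evaluate_one flip: evaluate_one_eq_foldr del: upt_Suc)
  also have "\<dots> = 0"
  proof (rule gen.deriv_foldr_Dn)
    show "set_mset N \<subseteq> {..<n}" using N by (simp add: msets_def)
    fix K
    show "(\<Sum>j\<in>#N. sc_deriv (GenAlpha a j) (?G j K)) = 0"
    proof (cases "K \<in> msets n (Suc m)")
      case True
      then have "(\<Sum>j\<in>#N. sc_deriv (GenAlpha a j) (?G j K)) =
          (\<Sum>j\<in>#N. if odd (size K) then - contraction K (sc_deriv (GenAlpha a j) (contraction (N - {#j#}) z))
             else contraction K (sc_deriv (GenAlpha a j) (contraction (N - {#j#}) z)))"
        by (simp add: contractions_def contraction_deriv)
      also have "\<dots> = 0"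
        unfolding sum_mset_uniform_sign contraction_sum_mset[symmetric]
        using assms a N by (simp add: orthogonal_to_relations_def)
      finally show ?thesis .
    qed (simp add: contractions_def)
    show "(\<Sum>j\<in>#N. ?G j (add_mset j K)) = 0"
    proof (cases "K \<in> msets n m")
      case True
      have "(\<Sum>j\<in>#N. ?G j (add_mset j K)) =
          (\<Sum>j\<in>#N. if odd (Suc m) then - contraction (N - {#j#}) (contraction (add_mset j K) z)
             else contraction (N - {#j#}) (contraction (add_mset j K) z))"
      proof (intro sum_mset_cong)
        fix j assume j: "j \<in># N"
        then have jK: "add_mset j K \<in> msets n (Suc m)" using True N by (auto simp: in_msets_simps) (auto simp: msets_def)
        have "size (add_mset j K) = Suc m" using True by (simp add: msets_def)
        then show "?G j (add_mset j K) = (if odd (Suc m) then - contraction (N - {#j#}) (contraction (add_mset j K) z)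
             else contraction (N - {#j#}) (contraction (add_mset j K) z))"
          using jK size[OF j] contraction_contraction[of "add_mset j K" "N - {#j#}" z]
          by (simp add: contractions_def)
      qed
      also have "\<dots> = 0"
        unfolding sum_mset_uniform_sign
        using assms True N by (simp add: orthogonal_to_relations_def)
      finally show ?thesis .
    next
      case False
      then have "?G j (add_mset j K) = 0" for j by (simp add: contractions_def in_msets_simps)
      then show ?thesis by simp
    qed
  qed
  finally show "(\<Sum>j\<in>#N. sc_deriv (GenAlpha a j) (contraction (N - {#j#}) (?T z))) = 0" .
qed

subsection \<open>Evaluation of the generators\<close>

text \<open>Evaluation with values in the algebra of the symbols itself, \<theta>_j being the letter
  \<open>GenAlpha m j\<close>, so that a partially evaluated polynomial can be evaluated
  further.\<close>

definition ext_value :: "nat \<Rightarrow> nat \<Rightarrow> gen_letter \<Rightarrow> gen_letter supercomm" where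
  "ext_value m n x = (case x of GenAlpha i j \<Rightarrow> sc_letter x | GenQ N \<Rightarrow> gen_qhat n [0..<Suc m] N)"

lemma ext_value_simps [simp]:
  "ext_value m n (GenAlpha i j) = sc_letter (GenAlpha i j)"
  "ext_value m n (GenQ N) = gen_qhat n [0..<Suc m] N"
  by (simp_all add: ext_value_def del: upt_Suc)

lemma respects_parity_ext_value: "respects_parity UNIV (ext_value m n)"
proof (rule respects_parityI)
  fix x
  show "has_parity UNIV (odd_letter x) (ext_value m n x)"
  proof (cases x)
    case (GenQ N)
    show ?thesis
    proof (cases "N \<in> msets n (Suc m)")
      case True
      then show ?thesis
        using has_parity_mono[OF has_parity_gen_qhat[of m n N], of UNIV] by (simp add: GenQ msets_def del: upt_Suc)
    next
      \<comment> \<open>A symbol indexed by a multiset outside the admissible range has value 0,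
        which has either parity.\<close>
      case False
      then show ?thesis using gen.qhat_eq_0[of N n "[0..<Suc m]"]
        by (simp add: GenQ has_parity_zero del: upt_Suc)
    qed
  qed (metis UNIV_I ext_value_simps(1) has_parity_letterI)
qed

lemma sc_subst_ext_value_mult:
  "sc_subst (ext_value m n) (f * g) = sc_subst (ext_value m n) f * sc_subst (ext_value m n) g"
  by (rule sc_subst_mult[OF respects_parity_ext_value carrier_UNIV carrier_UNIV])

lemma sc_subst_ext_value_alpha:
  assumes "f \<in> carrier (free_supercomm {GenAlpha i j | i j. i < Suc m \<and> j < n})"
  shows "sc_subst (ext_value m n) f = f"
  using respects_parity_ext_value[of m n]
  by (intro sc_subst_id[OF _ _ assms]) (auto simp: respects_parity_def)

lemma wt_mset_ext_letters:
  "set_mset K \<subseteq> ext_letters m n \<Longrightarrow> wt_mset q_wt K = (\<Sum>M\<in>msets n (Suc m). count K (GenQ M))"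
proof (induction K)
  case (add x K)
  have "(\<Sum>M\<in>msets n (Suc m). count (add_mset x K) (GenQ M)) =
      (\<Sum>M\<in>msets n (Suc m). (if x = GenQ M then 1 else 0) + count K (GenQ M))"
    by (intro sum.cong refl) auto
  also have "\<dots> = (\<Sum>M\<in>msets n (Suc m). if x = GenQ M then 1 else 0) + wt_mset q_wt K"
    using add by (simp add: sum.distrib)
  also have "(\<Sum>M\<in>msets n (Suc m). if x = GenQ M then 1 else 0) = q_wt x"
    using add.prems by (auto simp: ext_letters_def)
  finally show ?case by simp
qed simp

lemma euler:
  assumes "z \<in> carrier (free_supercomm (ext_letters m n))" "homogeneous q_wt d z"
  shows "(\<Sum>M\<in>msets n (Suc m). sc_letter (GenQ M) * sc_deriv (GenQ M) z) = of_nat d * z"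
proof (rule supercomm_eqI)
  fix K
  have "(\<Sum>M\<in>msets n (Suc m). of_nat (count K (GenQ M)) * sc_coeff z K) = of_nat d * sc_coeff z K"
  proof (cases "sc_coeff z K = 0")
    case False
    then have "d = (\<Sum>M\<in>msets n (Suc m). count K (GenQ M))"
      using assms wt_mset_ext_letters[of K m n] by (auto simp: in_free_supercomm homogeneous_def)
    then show ?thesis by (simp add: sum_distrib_right)
  qed simp
  then show "sc_coeff (\<Sum>M\<in>msets n (Suc m). sc_letter (GenQ M) * sc_deriv (GenQ M) z) K =
      sc_coeff (of_nat d * z) K"
    by (simp add: sc_coeff_sum letter_mult_deriv_same sc_coeff_of_nat_mult)
qed

text \<open>After full evaluation the value of \<open>GenQ M\<close> and the symbol itself coincide,
  so \<open>evaluate_one\<close> becomes the Euler operator of the symbols.\<close>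

lemma sc_subst_evaluate_one:
  assumes "z \<in> carrier (free_supercomm (ext_letters m n))" "homogeneous q_wt d z"
  shows "sc_subst (ext_value m n) (evaluate_one m n z) = of_nat d * sc_subst (ext_value m n) z"
proof -
  let ?\<phi> = "sc_subst (ext_value m n)"
  have "?\<phi> (evaluate_one m n z) = (\<Sum>M\<in>msets n (Suc m). gen_qhat n [0..<Suc m] M * ?\<phi> (sc_deriv (GenQ M) z))"
    by (simp add: evaluate_one_def sc_subst_sum sc_subst_ext_value_mult
        sc_subst_ext_value_alpha[OF gen_qhat_carrier] del: upt_Suc)
  also have "\<dots> = ?\<phi> (\<Sum>M\<in>msets n (Suc m). sc_letter (GenQ M) * sc_deriv (GenQ M) z)"
    by (simp add: sc_subst_sum sc_subst_ext_value_mult sc_subst_letter[OF respects_parity_ext_value] del: upt_Suc)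
  also have "\<dots> = of_nat d * ?\<phi> z"
    unfolding euler[OF assms] using sc_subst_scale[of _ "of_nat d" z] by (simp only: sc_scalar_of_nat)
  finally show ?thesis .
qed

text \<open>Induction on the number of symbols: \<open>evaluate_one\<close> lowers it and preserves
  orthogonality and vanishing value. If its result is 0, all derivatives by symbols vanish by
  \<open>contractions_injective\<close>, and Euler's identity with the nonzero factor d + 1 gives z
  = 0.\<close>

theorem ext_value_injective:
  assumes "z \<in> carrier (free_supercomm (ext_letters m n))" "homogeneous q_wt d z"
    and "orthogonal_to_relations m n z" "sc_subst (ext_value m n) z = 0"
  shows "z = 0"
  using assms
proof (induction d arbitrary: z)
  case 0
  have "z \<in> carrier (free_supercomm {GenAlpha i j | i j. i < Suc m \<and> j < n})"
    unfolding in_free_supercomm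
  proof (intro allI impI subsetI)
    fix M x assume M: "sc_coeff z M \<noteq> 0" and x: "x \<in># M"
    have "wt_mset q_wt M = 0" using 0(2) M by (simp add: homogeneous_def)
    then have "q_wt x = 0" using x by (metis insert_DiffM wt_mset_simps(2) add_is_0)
    moreover have "x \<in> ext_letters m n" using 0(1) M x by (auto simp: in_free_supercomm)
    ultimately show "x \<in> {GenAlpha i j | i j. i < Suc m \<and> j < n}" by (auto simp: ext_letters_def)
  qed
  from sc_subst_ext_value_alpha[OF this] 0(4) show ?case by (rule trans[OF sym])
next
  case (Suc d)
  let ?T = "evaluate_one m n z"
  have sub: "{GenAlpha i j | i j. i < Suc m \<and> j < n} \<subseteq> ext_letters m n" by (auto simp: ext_letters_def)
  have "?T = 0"
  proof (rule Suc.IH)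
    show "?T \<in> carrier (free_supercomm (ext_letters m n))"
      unfolding evaluate_one_def using gen_qhat_carrier free_supercomm_mono[OF sub] Suc.prems(1)
      by (intro free_supercomm_sum free_supercomm_mult free_supercomm_deriv) blast+
    show "homogeneous q_wt d ?T"
      unfolding evaluate_one_def
    proof (rule homogeneous_sum)
      fix M
      have "homogeneous q_wt 0 (gen_qhat n [0..<Suc m] M)"
        by (rule homogeneous_zero_weight[OF gen_qhat_carrier]) auto
      moreover have "homogeneous q_wt d (sc_deriv (GenQ M) z)"
        using homogeneous_deriv[OF Suc.prems(2), of "GenQ M"] by simp
      ultimately show "homogeneous q_wt d (gen_qhat n [0..<Suc m] M * sc_deriv (GenQ M) z)"
        using homogeneous_mult by fastforce
    qed
    show "orthogonal_to_relations m n ?T" by (rule orthogonal_evaluate_one[OF Suc.prems(3)])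
    show "sc_subst (ext_value m n) ?T = 0"
      using sc_subst_evaluate_one[OF Suc.prems(1,2)] Suc.prems(4) by simp
  qed
  then have "contractions m n z = 0" by (rule contractions_injective[OF Suc.prems(3)])
  from fun_cong[OF this] have *: "contractions m n z M = 0" for M by simp
  have "contraction M z = 0" if "M \<in> msets n (Suc m)" for M
    using *[of M] that by (simp add: contractions_def)
  then have "sc_deriv (GenQ M) z = 0" if "M \<in> msets n (Suc m)" for M
    using scalar_inverse_mset_fact[of M 1 z] that by simp
  then have "of_nat (Suc d) * z = 0" using euler[OF Suc.prems(1,2)] by simp
  then have "of_nat (Suc d) * sc_coeff z K = 0" for K
    by (metis sc_coeff_0 sc_coeff_of_nat_mult)
  then show ?case by (intro supercomm_eqI) (simp del: of_nat_Suc)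
qed

definition torus_embedding :: "nat \<Rightarrow> torus_letter \<Rightarrow> gen_letter supercomm" where
  "torus_embedding m x = (case x of Alpha i j \<Rightarrow> sc_letter (GenAlpha i j) | Theta j \<Rightarrow> sc_letter (GenAlpha m j))"

lemma respects_parity_torus_embedding: "respects_parity UNIV (torus_embedding m)"
proof (rule respects_parityI)
  fix x
  show "has_parity UNIV (odd_letter x) (torus_embedding m x)"
    using has_parity_letterI[of "GenAlpha _ _" UNIV]
    by (cases x) (simp_all add: torus_embedding_def odd_letter_torus_letter_def)
qed

lemma torus_embedding_qhat:
  "sc_subst (torus_embedding m) (torus_qhat m n as N) = gen_qhat n as N"
proof (induction as arbitrary: N)
  case Nil
  then show ?case by (simp add: torus.qhat_Nil gen.qhat_Nil)
next
  case (Cons a as)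
  have of_nat: "sc_subst \<phi> (of_nat k * f) = of_nat k * sc_subst \<phi> f" for \<phi> :: "torus_letter \<Rightarrow> gen_letter supercomm" and k f
    using sc_subst_scale[of \<phi> "of_nat k" f] by (simp only: sc_scalar_of_nat)
  have row: "torus_embedding m (torus_row m a j) = sc_letter (GenAlpha a j)" for j
    by (simp add: torus_embedding_def torus_row_def)
  show ?case
    unfolding torus.qhat_Cons gen.qhat_Cons sc_subst_sum of_nat
      sc_subst_letter_mult[OF respects_parity_torus_embedding UNIV_I carrier_UNIV] row Cons.IH ..
qed

lemma gen_value_simps [simp]:
  "gen_value m (GenAlpha i j) = alpha_elem i j" "gen_value m (GenQ N) = q_elem m N"
  by (simp_all add: gen_value_def)

lemma has_parity_q_elem: "N \<in> msets n (Suc m) \<Longrightarrow> has_parity (torus_letters m n) (odd (Suc m)) (q_elem m N)"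
  using torus.has_parity_qhat[of "[0..<Suc m]" "{..<Suc m}" m n N]
  by (simp add: q_elem_eq_qhat row_letters_torus atLeast0LessThan del: upt_Suc)

lemma respects_parity_gen_value: "respects_parity (gen_letters m n) (gen_value m)"
proof (rule respects_parityI)
  fix x assume "x \<in> gen_letters m n"
  then consider i j where "x = GenAlpha i j" "i < m" "j < n" | N where "x = GenQ N" "N \<in> msets n (Suc m)"
    by (auto simp: gen_letters_def)
  then show "has_parity (torus_letters m n) (odd_letter x) (gen_value m x)"
  proof cases
    case 1
    then have "Alpha i j \<in> torus_letters m n" by (auto simp: torus_letters_def)
    from has_parity_letterI[OF this] show ?thesis by (simp add: 1)
  next
    case 2
    then show ?thesis using has_parity_q_elem[of N n m] by (simp add: msets_def)
  qed
qed

lemma ext_value_eq_embedding: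
  assumes "z \<in> carrier (gen_algebra m n)"
  shows "sc_subst (ext_value m n) z = sc_subst (torus_embedding m) (sc_subst (gen_value m) z)"
  using assms
proof (induction rule: free_supercomm_induct)
  case (letter x f)
  have x: "sc_subst (torus_embedding m) (gen_value m x) = ext_value m n x"
  proof -
    from letter(1) consider i j where "x = GenAlpha i j" "i < m" "j < n" | N where "x = GenQ N" "N \<in> msets n (Suc m)"
      by (auto simp: gen_letters_def)
    then show ?thesis
    proof cases
      case 1
      then show ?thesis
        by (simp add: sc_subst_letter[OF respects_parity_torus_embedding] torus_embedding_def)
    next
      case 2
      then show ?thesis by (simp add: q_elem_eq_qhat torus_embedding_qhat del: upt_Suc)
    qed
  qed
  have "sc_subst (torus_embedding m) (gen_value m x * sc_subst (gen_value m) f) =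
      ext_value m n x * sc_subst (ext_value m n) f"
    unfolding letter.IH x[symmetric]
    by (rule sc_subst_mult[OF respects_parity_torus_embedding carrier_UNIV carrier_UNIV])
  then show ?case
    unfolding sc_subst_letter_mult[OF respects_parity_gen_value letter(1,2)]
      sc_subst_letter_mult[OF respects_parity_ext_value UNIV_I carrier_UNIV] ..
qed (simp_all add: sc_subst_add sc_subst_scale)

subsection \<open>Orthogonal complement of the relations\<close>

text \<open>Chosen so that the adjoint of multiplication by \<open>GenQ N\<close> is exactly
  \<open>contraction N\<close>, with its factor N!.\<close>

definition gen_scale :: "gen_letter \<Rightarrow> real" where
  "gen_scale x = (case x of GenAlpha _ _ \<Rightarrow> 1 | GenQ N \<Rightarrow> of_nat (mset_fact N))"

lemma gen_scale_simps [simp]: "gen_scale (GenAlpha i j) = 1" "gen_scale (GenQ N) = of_nat (mset_fact N)"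
  by (simp_all add: gen_scale_def)

abbreviation gen_pairing :: "gen_letter supercomm \<Rightarrow> gen_letter supercomm \<Rightarrow> complex" where
  "gen_pairing \<equiv> pairing (mono_weight gen_scale)"

lemma gen_scale_pos: "gen_scale x > 0"
  using mset_fact_pos by (cases x) auto

lemma gen_pairing_alpha: "gen_pairing (sc_letter (GenAlpha i j) * f) g = gen_pairing f (sc_deriv (GenAlpha i j) g)"
  by (simp add: pairing_letter_mult)

lemma gen_pairing_q: "gen_pairing (sc_letter (GenQ N) * f) g = gen_pairing f (contraction N g)"
  using pairing_scale_right[of "mono_weight gen_scale" f "of_nat (mset_fact N)" "sc_deriv (GenQ N) g"]
  by (simp add: pairing_letter_mult contraction_def sc_scalar_of_nat)

lemma homogeneous_contraction: "homogeneous q_wt k f \<Longrightarrow> homogeneous q_wt (k - 1) (contraction N f)"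
  using homogeneous_deriv[of q_wt k f "GenQ N"] by (simp add: contraction_def homogeneous_of_nat)

lemma contraction_homogeneous_0: "homogeneous q_wt 0 f \<Longrightarrow> contraction N f = 0"
  by (simp add: contraction_def sc_deriv_homogeneous_0)

text \<open>The degree has to be fixed: for odd m the symbols \<open>GenQ N\<close> are even and may
  be repeated at will.\<close>

lemma finite_gen_monomials: "finite {M. set_mset M \<subseteq> gen_letters m n \<and> sc_monomial M \<and> wt_mset q_wt M = d}"
proof (rule finite_subset)
  have "gen_letters m n = (\<lambda>(i, j). GenAlpha i j) ` ({..<m} \<times> {..<n}) \<union> GenQ ` msets n (m + 1)"
    by (auto simp: gen_letters_def)
  then have "finite (gen_letters m n)" by simp
  then show "finite {M. set_mset M \<subseteq> gen_letters m n \<and> (\<forall>x. count M x \<le> Suc d)}"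
    by (rule finite_bounded_multisets)
  show "{M. set_mset M \<subseteq> gen_letters m n \<and> sc_monomial M \<and> wt_mset q_wt M = d} \<subseteq>
      {M. set_mset M \<subseteq> gen_letters m n \<and> (\<forall>x. count M x \<le> Suc d)}"
  proof safe
    fix M :: "gen_letter multiset" and x assume M: "sc_monomial M"
    show "count M x \<le> Suc (wt_mset q_wt M)"
    proof (cases x)
      case (GenAlpha i j)
      then have "count M x \<le> 1" using M by (simp add: sc_monomial_def)
      then show ?thesis by simp
    next
      case (GenQ N)
      have "count M x \<le> wt_mset q_wt M" by (induction M) (auto simp: GenQ)
      then show ?thesis by simp
    qed
  qed
qed

lemma gen_letters_ext: "gen_letters m n \<subseteq> ext_letters m n"
  by (auto simp: gen_letters_def ext_letters_def)

text \<open>Subtract from x its projection to the degree d part of \<open>J\<close>. The remainder z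
  still evaluates to 0 and is orthogonal to all multiples of relations in its degree, hence is 0 by
  \<open>ext_value_injective\<close>.\<close>

theorem kernel_contained:
  assumes J: "J \<subseteq> carrier (gen_algebra m n)" "0 \<in> J"
      "\<And>f g. \<lbrakk>f \<in> J; g \<in> J\<rbrakk> \<Longrightarrow> f + g \<in> J"
      "\<And>f g. \<lbrakk>f \<in> J; g \<in> carrier (gen_algebra m n)\<rbrakk> \<Longrightarrow> f * g \<in> J"
    and rel: "supertorus_relations m n \<subseteq> J"
    and ker: "\<And>y. y \<in> J \<Longrightarrow> sc_subst (gen_value m) y = 0"
    and x: "x \<in> carrier (gen_algebra m n)" "homogeneous q_wt d x" "sc_subst (gen_value m) x = 0"
  shows "x \<in> J"
proof -
  let ?C = "carrier (gen_algebra m n)"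
  define Jd where "Jd = {f \<in> J. homogeneous q_wt d f}"
  have W: "mono_weight gen_scale M > 0" for M by (rule mono_weight_pos) (rule gen_scale_pos)
  have scale: "sc_scalar c * f \<in> J" if "f \<in> J" for c f
    using J(4)[OF that free_supercomm_scalar[of c]] by (simp add: scalar_central)
  have "\<exists>y\<in>Jd. \<forall>w\<in>Jd. gen_pairing w (x - y) = 0"
  proof (rule orthogonal_decomposition[OF finite_gen_monomials[of m n d] W])
    show "{M. sc_coeff f M \<noteq> 0} \<subseteq> {M. set_mset M \<subseteq> gen_letters m n \<and> sc_monomial M \<and> wt_mset q_wt M = d}"
      if "f \<in> Jd" for f
    proof -
      have "f \<in> ?C" using that J(1) by (auto simp: Jd_def)
      then show ?thesis using that sc_coeff_monomial[of f] by (auto simp: Jd_def in_free_supercomm homogeneous_def)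
    qed
  qed (use J(2,3) scale in \<open>auto simp: Jd_def intro: homogeneous_add homogeneous_scale\<close>)
  then obtain y where y: "y \<in> Jd" and perp: "\<And>w. w \<in> Jd \<Longrightarrow> gen_pairing w (x - y) = 0" by blast
  define z where "z = x - y"
  have z: "z \<in> ?C" "homogeneous q_wt d z"
    using x y J(1) by (auto simp: z_def Jd_def intro: free_supercomm_diff homogeneous_diff)
  have "sc_subst (gen_value m) x = sc_subst (gen_value m) z + sc_subst (gen_value m) y"
    using sc_subst_add[of "gen_value m" z y] by (simp add: z_def)
  then have z0: "sc_subst (gen_value m) z = 0" using x(3) ker[of y] y by (simp add: Jd_def)
  text \<open>Testing against \<open>\<rho> * R\<close>, where \<open>R\<close> is the adjoint of \<open>\<rho>\<close> applied to \<open>z\<close>.\<close>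
  have test: "R = 0" if "\<rho> \<in> J" "homogeneous q_wt k \<rho>" "R \<in> ?C" "homogeneous q_wt (d - k) R" "k \<le> d"
    "gen_pairing (\<rho> * R) z = gen_pairing R R" for \<rho> R k
  proof -
    have "\<rho> * R \<in> Jd"
      using J(4)[OF that(1,3)] homogeneous_mult[OF that(2,4)] that(5) by (simp add: Jd_def)
    then have "gen_pairing R R = 0" using perp that(6) by (simp add: z_def)
    then show ?thesis using pairing_self_eq_0[where W = "mono_weight gen_scale" and f = R] W by blast
  qed
  have sum_mset_homogeneous: "homogeneous q_wt k (\<Sum>j\<in>#N. f j)" if "\<And>j. j \<in># N \<Longrightarrow> homogeneous q_wt k (f j)"
    for k N and f :: "nat \<Rightarrow> _"
    using that by (induction N) (auto intro: homogeneous_add)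
  have pair_left: "gen_pairing ((\<Sum>j\<in>#N. f j) * R) z = (\<Sum>j\<in>#N. gen_pairing (f j * R) z)" for N R and f :: "nat \<Rightarrow> _"
    by (induction N) (auto simp: distrib_right pairing_add_left)
  have pair_right: "(\<Sum>j\<in>#N. gen_pairing R (f j)) = gen_pairing R (\<Sum>j\<in>#N. f j)" for N R and f :: "nat \<Rightarrow> _"
    by (induction N) (auto simp: pairing_add_right)
  have "orthogonal_to_relations m n z"
    unfolding orthogonal_to_relations_def
  proof (intro conjI allI impI ballI)
    fix a N assume a: "a < Suc m" and N: "N \<in> msets n (Suc (Suc m))"
    have size: "size (N - {#j#}) = Suc m" if "j \<in># N" for j
      using msets_diff_single[OF N that] by (simp add: msets_def)
    show "(\<Sum>j\<in>#N. sc_deriv (GenAlpha a j) (contraction (N - {#j#}) z)) = 0"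
    proof (cases "a < m")
      case True
      let ?R = "\<Sum>j\<in>#N. contraction (N - {#j#}) (sc_deriv (GenAlpha a j) z)"
      have "?R = 0"
      proof (cases "d = 0")
        \<comment> \<open>In degree 0 there is no symbol to contract, and the degree d - 1 of the
          test element would be a truncated difference.\<close>
        case True
        have "homogeneous q_wt 0 (sc_deriv (GenAlpha a j) z)" for j
          using homogeneous_deriv[OF z(2), of "GenAlpha a j"] True by simp
        then show ?thesis by (simp add: contraction_homogeneous_0)
      next
        case False
        show ?thesis
        proof (rule test)
          show "linear_relation a N \<in> J"
            using rel \<open>a < m\<close> N by (auto simp: supertorus_relations_def)
          show "homogeneous q_wt 1 (linear_relation a N)"
            unfolding linear_relation_def
            using homogeneous_mult[OF homogeneous_letter[of q_wt "GenAlpha a _"] homogeneous_letter[of q_wt "GenQ _"]]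
            by (intro sum_mset_homogeneous) simp
          show "?R \<in> ?C" using z(1)
            by (intro free_supercomm_sum_mset contraction_carrier free_supercomm_deriv)
          show "homogeneous q_wt (d - 1) ?R"
            using homogeneous_contraction[OF homogeneous_deriv[OF z(2)]]
            by (intro sum_mset_homogeneous) (metis diff_zero q_wt_simps(1))
          show "gen_pairing (linear_relation a N * ?R) z = gen_pairing ?R ?R"
            unfolding linear_relation_def pair_left
            by (simp only: mult.assoc gen_pairing_alpha gen_pairing_q pair_right)
        qed (use False in simp)
      qed
      \<comment> \<open>The adjoint of a product applies its factors in the other order; the
        exchange costs a sign that is the same for every j.\<close>
      moreover have "(\<Sum>j\<in>#N. sc_deriv (GenAlpha a j) (contraction (N - {#j#}) z)) =
          (\<Sum>j\<in>#N. if odd (Suc m) then - contraction (N - {#j#}) (sc_deriv (GenAlpha a j) z)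
             else contraction (N - {#j#}) (sc_deriv (GenAlpha a j) z))"
        using size by (intro sum_mset_cong) (simp add: contraction_deriv)
      ultimately show ?thesis unfolding sum_mset_uniform_sign by simp
    next
      case False
      \<comment> \<open>Here a = m: z comes from the generators alone, so it contains no letter of
        the \<theta> row.\<close>
      have "sc_deriv (GenAlpha a j) (contraction (N - {#j#}) z) = 0" for j
        using False by (intro sc_deriv_eq_0[OF contraction_carrier[OF z(1)]]) (auto simp: gen_letters_def)
      then show ?thesis by simp
    qed
  next
    fix N1 N2 assume N: "N1 \<in> msets n m" "N2 \<in> msets n (Suc (Suc m))"
    let ?R = "\<Sum>j\<in>#N2. contraction (N2 - {#j#}) (contraction (add_mset j N1) z)"
    show "?R = 0"
    proof (cases "d \<le> 1")
      case True
      have "homogeneous q_wt 0 (contraction (add_mset j N1) z)" for j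
        using homogeneous_contraction[OF z(2)] True by simp
      then show ?thesis by (simp add: contraction_homogeneous_0)
    next
      case False
      show ?thesis
      proof (rule test)
        show "quadratic_relation N1 N2 \<in> J"
        proof -
          have "quadratic_relation N1 N2 \<in> supertorus_relations m n"
            using N by (simp add: supertorus_relations_def) blast
          then show ?thesis using rel by blast
        qed
        show "homogeneous q_wt 2 (quadratic_relation N1 N2)"
          unfolding quadratic_relation_def
          using homogeneous_mult[OF homogeneous_letter[of q_wt "GenQ _"] homogeneous_letter[of q_wt "GenQ _"]]
          by (intro sum_mset_homogeneous) (simp add: numeral_2_eq_2)
        show "?R \<in> ?C" using z(1)
          by (intro free_supercomm_sum_mset contraction_carrier)
        show "homogeneous q_wt (d - 2) ?R"
          using homogeneous_contraction[OF homogeneous_contraction[OF z(2)]]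
          by (intro sum_mset_homogeneous) (simp add: numeral_2_eq_2)
        show "gen_pairing (quadratic_relation N1 N2 * ?R) z = gen_pairing ?R ?R"
          unfolding quadratic_relation_def pair_left
          by (simp only: mult.assoc gen_pairing_q pair_right add_mset_add_single[symmetric])
      qed (use False in simp)
    qed
  qed
  moreover have "z \<in> carrier (free_supercomm (ext_letters m n))"
    using z(1) free_supercomm_mono[OF gen_letters_ext] by blast
  moreover have "sc_subst (ext_value m n) z = 0"
    using ext_value_eq_embedding[OF z(1)] z0 by simp
  ultimately have "z = 0" using ext_value_injective z(2) by blast
  then show "x \<in> J" using y by (simp add: z_def Jd_def)
qed

section \<open>Global sections are constant\<close>

definition translate :: "nat \<Rightarrow> (nat \<Rightarrow> complex) \<Rightarrow> (nat \<Rightarrow> complex) \<Rightarrow> nat \<Rightarrow> complex" where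
  "translate m v z = (\<lambda>k\<in>{..<m}. z k + v k)"

lemma translate_affine [simp]: "translate m v z \<in> affine_space m"
  by (simp add: translate_def affine_space_def)

lemma translate_translate [simp]: "translate m v (translate m w z) = translate m (\<lambda>k. w k + v k) z"
  by (auto simp: translate_def fun_eq_iff add.assoc)

lemma translate_0: "z \<in> affine_space m \<Longrightarrow> translate m (\<lambda>_. 0) z = z"
  by (auto simp: translate_def affine_space_def fun_eq_iff PiE_iff extensional_def)

lemma translate_S_eq: "translate_S m i = translate m (\<lambda>k. if k = i then 1 else 0)"
  by (simp add: translate_S_def translate_def fun_eq_iff)

lemma translate_T_eq: "translate_T m \<tau> i = translate m (\<lambda>k. \<tau> $$ (i, k))"
  by (simp add: translate_T_def translate_def fun_eq_iff)

section \<open>Entire functions that are periodic up to additive constants\<close>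

lemma quasi_periodic_int:
  assumes f: "\<And>z. z \<in> affine_space m \<Longrightarrow> f (translate m v z) = f z + (c :: complex)"
    and z: "z \<in> affine_space m"
  shows "f (translate m (\<lambda>k. of_int N * v k) z) = f z + of_int N * c"
proof (induction N rule: int_induct[where k = 0])
  case base
  then show ?case using z by (simp add: translate_0)
next
  case (step1 N)
  have "f (translate m (\<lambda>k. of_int (N + 1) * v k) z) = f (translate m v (translate m (\<lambda>k. of_int N * v k) z))"
    by (simp add: algebra_simps)
  then show ?case using step1 by (simp only: f translate_affine) (simp add: algebra_simps)
next
  case (step2 N)
  have "f (translate m (\<lambda>k. of_int N * v k) z) = f (translate m v (translate m (\<lambda>k. of_int (N - 1) * v k) z))"
    by (simp add: algebra_simps)
  also have "\<dots> = f (translate m (\<lambda>k. of_int (N - 1) * v k) z) + c" by (simp only: f translate_affine)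
  finally show ?case using step2 by (simp add: algebra_simps)
qed

lemma quasi_periodic_lattice:
  fixes M :: nat
  assumes f: "\<And>i z. i < M \<Longrightarrow> z \<in> affine_space m \<Longrightarrow> f (translate m (v i) z) = f z + (c i :: complex)"
    and z: "z \<in> affine_space m"
  shows "f (translate m (\<lambda>k. \<Sum>i<M. of_int (N i) * v i k) z) = f z + (\<Sum>i<M. of_int (N i) * c i)"
  using f
proof (induction M)
  case 0
  then show ?case using z by (simp add: translate_0)
next
  case (Suc M)
  have "f (translate m (\<lambda>k. \<Sum>i<Suc M. of_int (N i) * v i k) z) =
      f (translate m (\<lambda>k. of_int (N M) * v M k) (translate m (\<lambda>k. \<Sum>i<M. of_int (N i) * v i k) z))"
    by simp
  also have "\<dots> = f (translate m (\<lambda>k. \<Sum>i<M. of_int (N i) * v i k) z) + of_int (N M) * c M"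
    by (rule quasi_periodic_int) (use Suc.prems in auto)
  finally show ?case using Suc by simp
qed

text \<open>Tychonoff for the product over all natural indices: beyond m the coordinates are pinned
  to \<open>undefined\<close>, a compact singleton.\<close>

lemma compact_polydisc: "compact ({..<m} \<rightarrow>\<^sub>E cball (0::complex) R)"
proof -
  have "{..<m} \<rightarrow>\<^sub>E cball (0::complex) R = PiE UNIV (\<lambda>i. if i < m then cball 0 R else {undefined})"
    by (auto simp: PiE_iff extensional_def split: if_splits)
  moreover have "compactin (product_topology (\<lambda>i. euclidean) UNIV)
      (PiE UNIV (\<lambda>i. if i < m then cball (0::complex) R else {undefined}))"
    unfolding compactin_PiE by auto
  ultimately show ?thesis by (simp add: euclidean_product_topology)
qed

lemma left_inverse_of_det:
  fixes A :: "real mat"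
  assumes A: "A \<in> carrier_mat m m" and "Determinant.det A \<noteq> 0"
  obtains C where "\<And>l k. \<lbrakk>l < m; k < m\<rbrakk> \<Longrightarrow> (\<Sum>i<m. C l i * A $$ (i, k)) = (if l = k then 1 else 0)"
proof
  fix l k assume lk: "l < m" "k < m"
  have "(adj_mat A * A) $$ (l, k) = (\<Sum>i<m. adj_mat A $$ (l, i) * A $$ (i, k))"
    using A adj_mat(1)[OF A] lk by (simp add: scalar_prod_def atLeast0LessThan)
  moreover have "(adj_mat A * A) $$ (l, k) = (if l = k then Determinant.det A else 0)"
    unfolding adj_mat(3)[OF A] using lk by simp
  ultimately have "(\<Sum>i<m. adj_mat A $$ (l, i) * A $$ (i, k)) = (if l = k then Determinant.det A else 0)"
    by simp
  moreover have "(\<Sum>i<m. (adj_mat A $$ (l, i) / Determinant.det A) * A $$ (i, k)) =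
      (\<Sum>i<m. adj_mat A $$ (l, i) * A $$ (i, k)) / Determinant.det A"
    by (simp add: sum_divide_distrib)
  ultimately show "(\<Sum>i<m. (adj_mat A $$ (l, i) / Determinant.det A) * A $$ (i, k)) = (if l = k then 1 else 0)"
    using assms(2) by simp
qed

text \<open>
  Writing a point as a lattice vector plus a point of a compact set shows that a quasi-periodic
  function grows at most linearly.
\<close>

lemma quasi_periodic_growth:
  fixes f :: "(nat \<Rightarrow> complex) \<Rightarrow> complex"
  assumes \<tau>: "\<tau> \<in> carrier_mat m m" "Determinant.det (map_mat Im \<tau>) \<noteq> 0"
    and cont: "continuous_on (affine_space m) f"
    and S: "\<And>i z. i < m \<Longrightarrow> z \<in> affine_space m \<Longrightarrow> f (translate_S m i z) = f z"
    and T: "\<And>i z. i < m \<Longrightarrow> z \<in> affine_space m \<Longrightarrow> f (translate_T m \<tau> i z) = f z + c i"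
  obtains A B where "\<And>z. z \<in> affine_space m \<Longrightarrow> cmod (f z) \<le> A + (\<Sum>l<m. B l * cmod (z l))" "\<And>l. 0 \<le> B l"
proof -
  have "map_mat Im \<tau> \<in> carrier_mat m m" using \<tau>(1) by simp
  from left_inverse_of_det[OF this \<tau>(2)] obtain C :: "nat \<Rightarrow> nat \<Rightarrow> real"
    where C: "\<And>l k. \<lbrakk>l < m; k < m\<rbrakk> \<Longrightarrow> (\<Sum>i<m. C l i * map_mat Im \<tau> $$ (i, k)) = (if l = k then 1 else 0)"
    by blast
  then have C: "(\<Sum>i<m. C l i * Im (\<tau> $$ (i, k))) = (if l = k then 1 else 0)" if "l < m" "k < m" for l k
    using that \<tau>(1) C[OF that] by simp
  \<comment> \<open>The summand 1 bounds the real part after reduction modulo the periods of the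
    \<open>S\<close>, the double sum bounds the imaginary part after reduction modulo those of the
    \<open>T\<close>.\<close>
  define R where "R = 1 + (\<Sum>k<m. \<Sum>i<m. \<bar>Im (\<tau> $$ (i, k))\<bar>)"
  let ?K = "{..<m} \<rightarrow>\<^sub>E cball (0::complex) R"
  have "?K \<subseteq> affine_space m" by (auto simp: affine_space_def)
  then have "compact (f ` ?K)"
    by (intro compact_continuous_image compact_polydisc continuous_on_subset[OF cont])
  then obtain C0 where C0: "\<And>z. z \<in> ?K \<Longrightarrow> cmod (f z) \<le> C0"
    using compact_imp_bounded bounded_iff by (metis image_eqI)
  define B where "B l = (\<Sum>i<m. \<bar>C l i\<bar> * cmod (c i))" for l
  define A where "A = C0 + (\<Sum>i<m. cmod (c i))"
  have "cmod (f z) \<le> A + (\<Sum>l<m. B l * cmod (z l))" if z: "z \<in> affine_space m" for z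
  proof -
    \<comment> \<open>The real coordinates of Im z in the basis given by the imaginary parts of the
      rows of \<tau>. Rounding them down chooses the \<open>T\<close> periods; afterwards the real
      parts are rounded down by \<open>S\<close> periods, which are real and leave Im alone.\<close>
    define t where "t i = (\<Sum>l<m. Im (z l) * C l i)" for i
    define z1 where "z1 = translate m (\<lambda>k. \<Sum>i<m. of_int (- \<lfloor>t i\<rfloor>) * \<tau> $$ (i, k)) z"
    define z2 where "z2 = translate m (\<lambda>k. \<Sum>i<m. of_int (- \<lfloor>Re (z1 i)\<rfloor>) * (if k = i then 1 else 0)) z1"
    have "f z1 = f z + (\<Sum>i<m. of_int (- \<lfloor>t i\<rfloor>) * c i)"
      unfolding z1_def by (rule quasi_periodic_lattice[OF _ z]) (simp add: T flip: translate_T_eq)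
    moreover have "f z2 = f z1 + (\<Sum>i<m. of_int (- \<lfloor>Re (z1 i)\<rfloor>) * 0)"
      unfolding z2_def
      by (rule quasi_periodic_lattice) (simp_all add: S z1_def flip: translate_S_eq)
    ultimately have f_z: "f z = f z2 + (\<Sum>i<m. of_int \<lfloor>t i\<rfloor> * c i)" by (simp add: sum_negf)
    have "z2 \<in> ?K"
    proof (rule PiE_I)
      fix k assume "k \<in> {..<m}"
      then have k: "k < m" by simp
      have "z2 k = z1 k + (\<Sum>i<m. if k = i then of_int (- \<lfloor>Re (z1 i)\<rfloor>) else 0)"
        unfolding z2_def translate_def using k by (simp add: if_distrib cong: if_cong)
      then have z2k: "z2 k = z1 k - of_int \<lfloor>Re (z1 k)\<rfloor>" using k by simp
      have "(\<Sum>i<m. t i * Im (\<tau> $$ (i, k))) = (\<Sum>l<m. Im (z l) * (\<Sum>i<m. C l i * Im (\<tau> $$ (i, k))))"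
        unfolding t_def sum_distrib_right sum_distrib_left
        by (subst sum.swap) (simp add: mult.assoc)
      also have "\<dots> = (\<Sum>l<m. if l = k then Im (z l) else 0)"
        by (intro sum.cong refl) (simp add: C k)
      also have "\<dots> = Im (z k)" using k by simp
      finally have "Im (z1 k) = (\<Sum>i<m. (t i - of_int \<lfloor>t i\<rfloor>) * Im (\<tau> $$ (i, k)))"
        unfolding z1_def translate_def using k by (simp add: sum_negf sum_subtractf left_diff_distrib)
      also have "\<bar>\<dots>\<bar> \<le> (\<Sum>i<m. \<bar>Im (\<tau> $$ (i, k))\<bar>)"
      proof (rule order_trans[OF sum_abs sum_mono])
        fix i
        have "\<bar>t i - of_int \<lfloor>t i\<rfloor>\<bar> \<le> 1" by linarith
        then show "\<bar>(t i - of_int \<lfloor>t i\<rfloor>) * Im (\<tau> $$ (i, k))\<bar> \<le> \<bar>Im (\<tau> $$ (i, k))\<bar>"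
          by (simp add: abs_mult mult_left_le_one_le)
      qed
      also have "\<dots> \<le> (\<Sum>k<m. \<Sum>i<m. \<bar>Im (\<tau> $$ (i, k))\<bar>)"
        using k by (intro member_le_sum[where f = "\<lambda>k. \<Sum>i<m. \<bar>Im (\<tau> $$ (i, k))\<bar>"]) (auto intro: sum_nonneg)
      finally have "\<bar>Im (z2 k)\<bar> \<le> R - 1" by (simp add: z2k R_def)
      moreover have "\<bar>Re (z2 k)\<bar> \<le> 1" unfolding z2k by simp linarith
      ultimately show "z2 k \<in> cball 0 R" using cmod_le[of "z2 k"] by simp
    qed (simp add: z2_def translate_def)
    then have "cmod (f z2) \<le> C0" by (rule C0)
    moreover have "cmod (\<Sum>i<m. of_int \<lfloor>t i\<rfloor> * c i) \<le> (\<Sum>i<m. (1 + (\<Sum>l<m. cmod (z l) * \<bar>C l i\<bar>)) * cmod (c i))"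
    proof (rule order_trans[OF norm_sum sum_mono])
      fix i
      have "\<bar>t i\<bar> \<le> (\<Sum>l<m. cmod (z l) * \<bar>C l i\<bar>)"
        unfolding t_def
        by (rule order_trans[OF sum_abs sum_mono]) (simp add: abs_mult abs_Im_le_cmod mult_right_mono)
      then have "\<bar>of_int \<lfloor>t i\<rfloor>\<bar> \<le> 1 + (\<Sum>l<m. cmod (z l) * \<bar>C l i\<bar>)" by linarith
      then show "cmod (of_int \<lfloor>t i\<rfloor> * c i) \<le> (1 + (\<Sum>l<m. cmod (z l) * \<bar>C l i\<bar>)) * cmod (c i)"
        by (simp add: norm_mult mult_right_mono)
    qed
    moreover have "(\<Sum>i<m. (1 + (\<Sum>l<m. cmod (z l) * \<bar>C l i\<bar>)) * cmod (c i)) =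
        (\<Sum>i<m. cmod (c i)) + (\<Sum>l<m. B l * cmod (z l))"
    proof -
      have "(\<Sum>l<m. B l * cmod (z l)) = (\<Sum>i<m. (\<Sum>l<m. cmod (z l) * \<bar>C l i\<bar>) * cmod (c i))"
        unfolding B_def sum_distrib_right by (subst sum.swap) (simp add: mult_ac)
      then show ?thesis by (simp add: distrib_right sum.distrib)
    qed
    ultimately show ?thesis
      unfolding f_z A_def by (intro order_trans[OF norm_triangle_ineq]) linarith
  qed
  moreover have "0 \<le> B l" for l by (simp add: B_def sum_nonneg)
  ultimately show ?thesis using that by blast
qed

lemma quasi_periodic_constant:
  fixes f :: "(nat \<Rightarrow> complex) \<Rightarrow> complex"
  assumes \<tau>: "\<tau> \<in> carrier_mat m m" "Determinant.det (map_mat Im \<tau>) \<noteq> 0"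
    and hol: "holomorphic_several m (affine_space m) f"
    and S: "\<And>i z. i < m \<Longrightarrow> z \<in> affine_space m \<Longrightarrow> f (translate_S m i z) = f z"
    and T: "\<And>i z. i < m \<Longrightarrow> z \<in> affine_space m \<Longrightarrow> f (translate_T m \<tau> i z) = f z + c i"
    and zw: "z \<in> affine_space m" "w \<in> affine_space m"
  shows "f z = f w"
proof -
  have "continuous_on (affine_space m) f" using hol by (simp add: holomorphic_several_def)
  from quasi_periodic_growth[OF \<tau> this S T] obtain A B
    where AB: "\<And>z. z \<in> affine_space m \<Longrightarrow> cmod (f z) \<le> A + (\<Sum>l<m. B l * cmod (z l))" "\<And>l. 0 \<le> (B l :: real)"
    by blast
  have upd: "z(k := x) \<in> affine_space m" if "z \<in> affine_space m" "k < m" for z k x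
    using that by (auto simp: affine_space_def PiE_iff extensional_def)
  have coordinate: "f (z(k := x)) = f z" if z: "z \<in> affine_space m" and k: "k < m" for z k x
  proof -
    define g where "g x = f (z(k := x))" for x
    have "g field_differentiable at x" for x
    proof -
      have "(\<lambda>y. f ((z(k := x))(k := y))) field_differentiable at ((z(k := x)) k)"
        using hol upd[OF z k] k unfolding holomorphic_several_def by blast
      then show ?thesis by (simp add: g_def[abs_def])
    qed
    then have "g holomorphic_on UNIV" by (simp add: holomorphic_on_def field_differentiable_at_within)
    define D where "D = \<bar>A\<bar> + (\<Sum>l<m. B l * cmod (z l)) + B k"
    have growth: "cmod (g x) \<le> D * cmod x ^ 1" if x: "1 \<le> cmod x" for x
    proof -
      have "(\<Sum>l<m. B l * cmod ((z(k := x)) l)) \<le> (\<Sum>l<m. B l * cmod (z l) + (if l = k then B k * cmod x else 0))"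
        using AB(2) by (intro sum_mono) auto
      also have "\<dots> = (\<Sum>l<m. B l * cmod (z l)) + B k * cmod x" using k by (simp add: sum.distrib)
      finally have "cmod (g x) \<le> (\<bar>A\<bar> + (\<Sum>l<m. B l * cmod (z l))) * 1 + B k * cmod x"
        using AB(1)[OF upd[OF z k, of x]] abs_ge_self[of A] unfolding g_def mult_1_right by linarith
      also have "\<dots> \<le> (\<bar>A\<bar> + (\<Sum>l<m. B l * cmod (z l))) * cmod x + B k * cmod x"
        using x AB(2) by (intro add_right_mono mult_left_mono) (auto intro!: add_nonneg_nonneg sum_nonneg)
      finally show ?thesis by (simp add: D_def distrib_right)
    qed
    define a b where "a = g 0" and "b = deriv g 0"
    have ab: "g x = a + b * x" for x
      using Liouville_polynomial[OF \<open>g holomorphic_on UNIV\<close> growth, where \<xi> = x] by (simp add: a_def b_def)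
    have per: "g (x + 1) = g x" for x
    proof -
      have "translate_S m k (z(k := x)) = z(k := x + 1)"
        using z k by (auto simp: translate_S_def affine_space_def fun_eq_iff PiE_iff extensional_def)
      then show ?thesis using S[OF k upd[OF z k, of x]] by (simp add: g_def)
    qed
    \<comment> \<open>Periodicity under \<open>S\<close> is exact, without an additive constant;
      this is what excludes a nonzero slope.\<close>
    from per[of 0] have "b = 0" by (simp add: ab)
    then have "g x = g (z k)" by (simp add: ab)
    then show ?thesis by (simp add: g_def)
  qed
  \<comment> \<open>The coordinates of z are replaced by those of w one at a time.\<close>
  have "f (\<lambda>k. if k < p then w k else z k) = f z \<and> (\<lambda>k. if k < p then w k else z k) \<in> affine_space m"
    if "p \<le> m" for p
    using that
  proof (induction p)
    case (Suc p)
    let ?u = "\<lambda>p k. if k < p then w k else z k"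
    have "?u (Suc p) = (?u p)(p := w p)" by (auto simp: fun_eq_iff less_Suc_eq)
    then show ?case using Suc coordinate[of "?u p" p "w p"] upd[of "?u p" p "w p"] by simp
  qed (use zw in simp)
  from this[of m] have "f (\<lambda>k. if k < m then w k else z k) = f z" by simp
  moreover have "(\<lambda>k. if k < m then w k else z k) = w"
    using zw by (auto simp: affine_space_def fun_eq_iff PiE_iff extensional_def)
  ultimately show ?thesis by simp
qed

section \<open>Global sections as constant functions with invariant values\<close>

lemma torus_preimage_whole [simp]: "torus_preimage m \<tau> (torus_space m \<tau>) = affine_space m"
  by (auto simp: torus_preimage_def torus_space_def intro: quotientI)

lemma translates_in_affine_space [simp]:
  "translate_S m i z \<in> affine_space m" "translate_T m \<tau> i z \<in> affine_space m"
  by (simp_all add: translate_S_eq translate_T_eq)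

lemma affine_space_nonempty: "affine_space m \<noteq> {}"
  by (simp add: affine_space_def PiE_eq_empty_iff)

lemma section_constant:
  assumes \<tau>: "\<tau> \<in> carrier_mat m m" "Determinant.det (map_mat Im \<tau>) \<noteq> 0"
    and s: "s \<in> supertorus_sections m n \<tau> (torus_space m \<tau>)"
    and zw: "z \<in> affine_space m" "w \<in> affine_space m"
  shows "s z = s w"
proof (rule supercomm_eqI)
  let ?T = "{M. set_mset M \<subseteq> torus_letters m n \<and> sc_monomial M}"
  let ?wt = "wt_mset theta_wt"
  define D where "D = Max (?wt ` ?T)"
  have finT: "finite ?T" by (rule finite_torus_monomials)
  have s_carrier: "s z \<in> carrier (E_algebra m n)" if "z \<in> affine_space m" for z
    using s that by (auto simp: supertorus_sections_def)
  have s_hol: "holomorphic_several m (affine_space m) (\<lambda>z. sc_coeff (s z) M)" for M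
    using s by (simp add: supertorus_sections_def)
  have s_inv: "s (translate_S m i z) = s z" "row_shift i (s (translate_T m \<tau> i z)) = s z"
    if "i < m" "z \<in> affine_space m" for i z
    using s that by (auto simp: supertorus_sections_def)
  have supp: "{M. sc_coeff (s z) M \<noteq> 0} \<subseteq> ?T" if "z \<in> affine_space m" for z
    using s_carrier[OF that] sc_coeff_monomial[of "s z"] by (auto simp: in_free_supercomm)
  fix M
  show "sc_coeff (s z) M = sc_coeff (s w) M" using zw
  proof (induction "D - ?wt M" arbitrary: M z w rule: less_induct)
    case (less M)
    define \<kappa> where "\<kappa> i M' = sc_coeff (row_shift i (sc_basis M')) M" for i M'
    define H where "H = {M' \<in> ?T. ?wt M < ?wt M'}"
    \<comment> \<open>By the induction hypothesis the coefficients of larger \<theta>-degree are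
      constant, so they may be read off at the fixed point z. Thus c i does not depend on the point
      being translated.\<close>
    define c where "c i = - (\<Sum>M'\<in>H. sc_coeff (s z) M' * \<kappa> i M')" for i
    show ?case
    proof (rule quasi_periodic_constant[OF \<tau> s_hol _ _ less.prems, where c = c])
      fix i y assume i: "i < m" and y: "y \<in> affine_space m"
      show "sc_coeff (s (translate_S m i y)) M = sc_coeff (s y) M" using s_inv i y by simp
      let ?y = "translate_T m \<tau> i y"
      have "s ?y = (\<Sum>M'\<in>?T. sc_scalar (sc_coeff (s ?y) M') * sc_basis M')"
        by (rule basis_expansion[OF finT supp]) simp
      then have "row_shift i (s ?y) = (\<Sum>M'\<in>?T. sc_scalar (sc_coeff (s ?y) M') * row_shift i (sc_basis M'))"
        by (metis (no_types, lifting) sc_subst_scale sc_subst_sum sum.cong)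
      then have "sc_coeff (s y) M = (\<Sum>M'\<in>?T. sc_coeff (s ?y) M' * \<kappa> i M')"
        using s_inv(2)[OF i y] by (simp add: sc_coeff_sum \<kappa>_def)
      also have "\<dots> = (\<Sum>M'\<in>H. sc_coeff (s ?y) M' * \<kappa> i M') + (\<Sum>M'\<in>?T - H. sc_coeff (s ?y) M' * \<kappa> i M')"
        by (subst add.commute, rule sum.subset_diff) (auto simp: H_def finT)
      \<comment> \<open>Monomials of no larger \<theta>-degree contribute to the coefficient at M
        only through M itself, since the shift is unitriangular.\<close>
      also have "(\<Sum>M'\<in>?T - H. sc_coeff (s ?y) M' * \<kappa> i M') =
          (\<Sum>M'\<in>?T - H. if M' = M then sc_coeff (s ?y) M else 0)"
      proof (intro sum.cong refl)
        fix M' assume M': "M' \<in> ?T - H"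
        then have "\<kappa> i M' = sc_coeff (sc_basis M') M"
          unfolding \<kappa>_def by (intro row_shift_basis[of _ m n]) (auto simp: H_def)
        then show "sc_coeff (s ?y) M' * \<kappa> i M' = (if M' = M then sc_coeff (s ?y) M else 0)"
          using M' by (auto simp: sc_basis.rep_eq)
      qed
      also have "\<dots> = sc_coeff (s ?y) M"
        using supp[of ?y] finT by (auto simp: H_def sum.delta)
      also have "(\<Sum>M'\<in>H. sc_coeff (s ?y) M' * \<kappa> i M') = (\<Sum>M'\<in>H. sc_coeff (s z) M' * \<kappa> i M')"
      proof (intro sum.cong refl)
        fix M' assume M': "M' \<in> H"
        then have "?wt M' \<le> D" unfolding D_def using finT by (intro Max_ge) (auto simp: H_def)
        then have "D - ?wt M' < D - ?wt M" using M' by (auto simp: H_def)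
        from less.hyps[OF this, of ?y z] less.prems
        show "sc_coeff (s ?y) M' * \<kappa> i M' = sc_coeff (s z) M' * \<kappa> i M'" by simp
      qed
      finally show "sc_coeff (s ?y) M = sc_coeff (s y) M + c i" by (simp add: c_def)
    qed
  qed
qed

lemma constant_section_in_sections:
  assumes "f \<in> carrier (E_algebra m n)" "\<And>i. i < m \<Longrightarrow> row_shift i f = f"
  shows "constant_section m f \<in> supertorus_sections m n \<tau> (torus_space m \<tau>)"
proof -
  have upd: "z(i := w) \<in> affine_space m" if "z \<in> affine_space m" "i < m" for z i w
    using that by (auto simp: affine_space_def PiE_iff extensional_def)
  have "continuous_on (affine_space m) (\<lambda>z. sc_coeff (constant_section m f z) M)" for M
    by (rule continuous_on_eq[OF continuous_on_const[of _ "sc_coeff f M"]]) (simp add: constant_section_def)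
  then show ?thesis using assms
    by (auto simp: supertorus_sections_def holomorphic_several_def constant_section_def upd
        cong: restrict_cong)
qed

lemma carrier_H0:
  assumes \<tau>: "\<tau> \<in> carrier_mat m m" "Determinant.det (map_mat Im \<tau>) \<noteq> 0"
  shows "carrier (H0 m n \<tau>) = constant_section m ` invariants m n"
proof
  show "constant_section m ` invariants m n \<subseteq> carrier (H0 m n \<tau>)"
    using constant_section_in_sections[of _ m n] row_shift_fixed_iff[of _ m n]
    by (auto simp: H0_def supertorus_sheaf_def invariants_def)
  show "carrier (H0 m n \<tau>) \<subseteq> constant_section m ` invariants m n"
  proof
    fix s assume "s \<in> carrier (H0 m n \<tau>)"
    then have s: "s \<in> supertorus_sections m n \<tau> (torus_space m \<tau>)" by (simp add: H0_def supertorus_sheaf_def)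
    obtain z where z: "z \<in> affine_space m" using affine_space_nonempty by blast
    have "s \<in> extensional (affine_space m)" using s by (auto simp: supertorus_sections_def PiE_def)
    then have eq: "s = constant_section m (s z)"
      using section_constant[OF \<tau> s _ z] by (auto simp: constant_section_def fun_eq_iff extensional_def)
    have sz: "s z \<in> carrier (E_algebra m n)" using s z by (auto simp: supertorus_sections_def)
    moreover have "row_shift i (s z) = s z" if "i < m" for i
    proof -
      have "row_shift i (s (translate_T m \<tau> i z)) = s z" using s z that by (auto simp: supertorus_sections_def)
      then show ?thesis using section_constant[OF \<tau> s translates_in_affine_space(2) z] by metis
    qed
    ultimately have "s z \<in> invariants m n" using row_shift_fixed_iff[OF sz] by (simp add: invariants_def)
    then show "s \<in> constant_section m ` invariants m n" using eq by blast
  qed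
qed

section \<open>The ring of global sections\<close>

lemma H0_simps [simp]:
  "mult (H0 m n \<tau>) = (\<lambda>s t. \<lambda>z\<in>affine_space m. s z * t z)"
  "add (H0 m n \<tau>) = (\<lambda>s t. \<lambda>z\<in>affine_space m. s z + t z)"
  "one (H0 m n \<tau>) = constant_section m 1" "zero (H0 m n \<tau>) = constant_section m 0"
  by (simp_all add: H0_def supertorus_sheaf_def constant_section_def)

lemma constant_section_ops:
  "(\<lambda>z\<in>affine_space m. constant_section m f z * constant_section m g z) = constant_section m (f * g)"
  "(\<lambda>z\<in>affine_space m. constant_section m f z + constant_section m g z) = constant_section m (f + g)"
  by (auto simp: constant_section_def fun_eq_iff)

lemma constant_section_inject: "constant_section m f = constant_section m g \<longleftrightarrow> f = g"
proof
  assume eq: "constant_section m f = constant_section m g"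
  obtain z where "z \<in> affine_space m" using affine_space_nonempty by blast
  with fun_cong[OF eq, of z] show "f = g" by (simp add: constant_section_def)
qed simp

lemma invariants_add: "\<lbrakk>f \<in> invariants m n; g \<in> invariants m n\<rbrakk> \<Longrightarrow> f + g \<in> invariants m n"
  by (simp add: invariants_def row_derivation_add free_supercomm_add)

lemma invariants_scale: "f \<in> invariants m n \<Longrightarrow> sc_scalar c * f \<in> invariants m n"
  by (simp add: invariants_def row_derivation_scale free_supercomm_mult free_supercomm_scalar)

lemma invariants_1: "1 \<in> invariants m n"
  by (simp add: invariants_def free_supercomm_one)

lemma invariants_minus: "f \<in> invariants m n \<Longrightarrow> - f \<in> invariants m n"
  using invariants_scale[of f m n "-1"] by (simp add: sc_scalar_minus)

lemma invariants_0: "0 \<in> invariants m n"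
  using invariants_scale[OF invariants_1, of 0] by simp

lemma invariants_alpha_mult:
  "\<lbrakk>i < m; j < n; f \<in> invariants m n\<rbrakk> \<Longrightarrow> alpha_elem i j * f \<in> invariants m n"
  by (auto simp: invariants_def row_derivation_alpha_mult torus_letters_def
      intro!: free_supercomm_mult free_supercomm_letter)

lemma invariants_q_elem_mult:
  "\<lbrakk>N \<in> msets n (Suc m); f \<in> invariants m n\<rbrakk> \<Longrightarrow> q_elem m N * f \<in> invariants m n"
  by (simp add: invariants_def row_derivation_q_elem_mult q_elem_carrier free_supercomm_mult)

text \<open>The shifts are algebra homomorphisms, so their fixed points are closed under products;
  this avoids a Leibniz rule for arbitrary factors.\<close>

lemma invariants_mult:
  assumes "f \<in> invariants m n" "g \<in> invariants m n" shows "f * g \<in> invariants m n"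
proof -
  have fixed: "row_shift i h = h" if "h \<in> invariants m n" "i < m" for h i
    using that row_shift_fixed_iff[of h m n i] by (simp add: invariants_def)
  have fg: "f * g \<in> carrier (E_algebra m n)" using assms by (simp add: invariants_def free_supercomm_mult)
  have "row_shift i (f * g) = f * g" if "i < m" for i
    using sc_subst_mult[OF respects_parity_shift carrier_UNIV carrier_UNIV, of i f g] fixed assms that by simp
  then show ?thesis using fg row_shift_fixed_iff[OF fg] by (simp add: invariants_def)
qed

lemma ring_H0:
  assumes \<tau>: "\<tau> \<in> carrier_mat m m" "Determinant.det (map_mat Im \<tau>) \<noteq> 0"
  shows "ring (H0 m n \<tau>)"
proof (rule ringI)
  note carrier = carrier_H0[OF \<tau>, of n]
  show "abelian_group (H0 m n \<tau>)"
  proof (rule abelian_groupI, unfold carrier)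
    fix x assume "x \<in> constant_section m ` invariants m n"
    then obtain f where f: "f \<in> invariants m n" "x = constant_section m f" by blast
    then show "\<exists>y\<in>constant_section m ` invariants m n. y \<oplus>\<^bsub>H0 m n \<tau>\<^esub> x = \<zero>\<^bsub>H0 m n \<tau>\<^esub>"
      by (intro bexI[of _ "constant_section m (- f)"])
        (auto simp: constant_section_ops intro: invariants_minus)
  qed (auto simp: constant_section_ops add_ac intro: invariants_add invariants_0)
  show "monoid (H0 m n \<tau>)"
    by (rule monoidI, unfold carrier)
      (auto simp: constant_section_ops mult.assoc intro: invariants_mult invariants_1)
qed (auto simp: carrier_H0[OF \<tau>] constant_section_ops distrib_left distrib_right)

lemma q_elem_invariant: "N \<in> msets n (Suc m) \<Longrightarrow> q_elem m N \<in> invariants m n"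
  using invariants_q_elem_mult[OF _ invariants_1] by simp

lemma generators_invariant:
  "range sc_scalar \<union> {alpha_elem i j | i j. i < m \<and> j < n} \<union> {q_elem m N | N. N \<in> msets n (Suc m)}
     \<subseteq> invariants m n"
  using invariants_scale[OF invariants_1] invariants_alpha_mult[OF _ _ invariants_1] q_elem_invariant
  by fastforce

text \<open>The scalars are among the generators because \<open>generate_ring\<close> knows only
  ring operations; with them it produces the generated algebra over the complex numbers.\<close>

lemma H0_generated:
  assumes \<tau>: "\<tau> \<in> carrier_mat m m" "Determinant.det (map_mat Im \<tau>) \<noteq> 0"
  shows "generate_ring (H0 m n \<tau>) (constant_section m ` (range sc_scalar \<union>
      {alpha_elem i j | i j. i < m \<and> j < n} \<union> {q_elem m N | N. N \<in> msets n (Suc m)}))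
    = carrier (H0 m n \<tau>)" (is "generate_ring ?H (constant_section m ` ?G) = _")
proof
  let ?R = "generate_ring ?H (constant_section m ` ?G)"
  have G: "constant_section m ` ?G \<subseteq> carrier ?H"
    unfolding carrier_H0[OF \<tau>] using generators_invariant by (intro image_mono)
  show "?R \<subseteq> carrier ?H" by (rule ring.generate_ring_incl[OF ring_H0[OF \<tau>] G])
  \<comment> \<open>The preimage of the generated ring among the invariants; it has the closure
    properties under which \<open>invariants_generated\<close> forces it to be everything.\<close>
  define S where "S = {f \<in> invariants m n. constant_section m f \<in> ?R}"
  have add: "f + g \<in> S" if "f \<in> S" "g \<in> S" for f g
    using that generate_ring.eng_add[of "constant_section m f" ?H _ "constant_section m g"]
    by (simp add: S_def constant_section_ops invariants_add)
  have gen_mult: "g * f \<in> S" if g: "g \<in> ?G" and f: "f \<in> S" for f g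
  proof -
    have "constant_section m g \<in> ?R" using g by (intro generate_ring.incl imageI)
    then show ?thesis
      using f g generate_ring.eng_mult[of "constant_section m g" ?H _ "constant_section m f"]
        subsetD[OF generators_invariant g]
      by (simp add: S_def constant_section_ops invariants_mult)
  qed
  have one: "1 \<in> S"
    using generate_ring.one[of ?H] by (simp add: S_def invariants_1)
  have "invariants m n \<subseteq> S"
  proof (rule invariants_generated)
    show "S \<subseteq> invariants m n" by (auto simp: S_def)
    show "f \<in> S" if "f \<in> carrier (free_supercomm {Alpha i j | i j. i < m \<and> j < n})" for f
      using that
    proof (induction rule: free_supercomm_induct)
      case (scale c f)
      then show ?case by (intro gen_mult) auto
    next
      case (letter x f)
      then show ?case by (intro gen_mult) auto
    qed (use one add in auto)
  qed (use add in \<open>auto intro!: gen_mult\<close>)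
  then show "carrier ?H \<subseteq> ?R" unfolding carrier_H0[OF \<tau>] by (auto simp: S_def)
qed

subsection \<open>The evaluation homomorphism\<close>

lemma linear_relation_holds:
  assumes "i < m" "N \<in> msets n (Suc (Suc m))"
  shows "(\<Sum>j\<in>#N. alpha_elem i j * q_elem m (N - {#j#})) = 0"
proof -
  have "(\<Sum>j\<in>#N. alpha_elem i j * q_elem m (N - {#j#})) =
      (\<Sum>j\<in>#N. sc_letter (torus_row m i j) * torus_qhat m n [0..<Suc m] (N - {#j#}))"
    using assms msets_diff_single[OF assms(2)]
    by (intro sum_mset_cong) (simp add: q_elem_eq_qhat[where n = n] del: upt_Suc)
  also have "\<dots> = 0"
    using assms by (intro torus.qhat_linear_relation) (auto simp: msets_def)
  finally show ?thesis .
qed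

lemma quadratic_relation_holds:
  assumes "N1 \<in> msets n m" "N2 \<in> msets n (Suc (Suc m))"
  shows "(\<Sum>j\<in>#N2. q_elem m (add_mset j N1) * q_elem m (N2 - {#j#})) = 0"
proof -
  have "(\<Sum>j\<in>#N2. q_elem m (add_mset j N1) * q_elem m (N2 - {#j#})) =
      (\<Sum>j\<in>#N2. torus_qhat m n [0..<Suc m] (add_mset j N1) * torus_qhat m n [0..<Suc m] (N2 - {#j#}))"
  proof (intro sum_mset_cong)
    fix j assume j: "j \<in># N2"
    then have "j < n" using assms(2) by (auto simp: msets_def)
    then have "add_mset j N1 \<in> msets n (Suc m)" using assms(1) by (simp add: in_msets_simps)
    then show "q_elem m (add_mset j N1) * q_elem m (N2 - {#j#}) =
        torus_qhat m n [0..<Suc m] (add_mset j N1) * torus_qhat m n [0..<Suc m] (N2 - {#j#})"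
      using msets_diff_single[OF assms(2) j] by (simp add: q_elem_eq_qhat[where n = n] del: upt_Suc)
  qed
  also have "\<dots> = 0"
    using assms by (intro torus.qhat_quadratic_relation) (auto simp: msets_def)
  finally show ?thesis .
qed

lemma gen_letters_cases [consumes 1, case_names alpha q]:
  assumes "x \<in> gen_letters m n"
  obtains i j where "x = GenAlpha i j" "i < m" "j < n" | N where "x = GenQ N" "N \<in> msets n (Suc m)"
  using assms by (auto simp: gen_letters_def)

lemma gen_value_invariant:
  assumes "f \<in> carrier (gen_algebra m n)"
  shows "sc_subst (gen_value m) f \<in> invariants m n"
  using assms
proof (induction rule: free_supercomm_induct)
  case (letter x f)
  from letter(1) show ?case
    unfolding sc_subst_letter_mult[OF respects_parity_gen_value letter(1,2)]
    by (cases rule: gen_letters_cases) (use letter.IH in \<open>auto intro: invariants_alpha_mult invariants_q_elem_mult\<close>)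
qed (simp_all add: sc_subst_add sc_subst_scale invariants_1 invariants_add invariants_scale)

lemma evaluation_hom:
  assumes \<tau>: "\<tau> \<in> carrier_mat m m" "Determinant.det (map_mat Im \<tau>) \<noteq> 0"
  shows "(\<lambda>x. constant_section m (sc_subst (gen_value m) x)) \<in> Ring.ring_hom (gen_algebra m n) (H0 m n \<tau>)"
  by (rule ring_hom_memI)
    (auto simp: carrier_H0[OF \<tau>] constant_section_ops sc_subst_add
      sc_subst_mult[OF respects_parity_gen_value] intro: gen_value_invariant)

lemma homogeneous_torus_qhat:
  "homogeneous theta_wt (length (filter (\<lambda>a. a = m) as)) (torus_qhat m n as N)"
proof (induction as arbitrary: N)
  case Nil
  then show ?case by (simp add: torus.qhat_Nil)
next
  case (Cons a as)
  have "theta_wt (torus_row m a j) + length (filter (\<lambda>a. a = m) as) = length (filter (\<lambda>a. a = m) (a # as))" for j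
    by (simp add: torus_row_def)
  then show ?case unfolding torus.qhat_Cons
    using homogeneous_mult[OF homogeneous_letter Cons.IH]
    by (intro homogeneous_sum homogeneous_of_nat) metis
qed

lemma homogeneous_q_elem: "N \<in> msets n (Suc m) \<Longrightarrow> homogeneous theta_wt 1 (q_elem m N)"
  using homogeneous_torus_qhat[of m "[0..<Suc m]" n N] by (simp add: q_elem_eq_qhat[where n = n])

text \<open>Each q_N is linear in \<theta> and the \<alpha> have \<theta>-degree 0, so the number of
  symbols corresponds to the \<theta>-degree. Hence the kernel contains the graded parts of its
  elements.\<close>

lemma evaluation_graded:
  assumes "f \<in> carrier (gen_algebra m n)"
  shows "sc_subst (gen_value m) (graded_part q_wt d f) = graded_part theta_wt d (sc_subst (gen_value m) f)"
proof (rule graded_part_subst[OF respects_parity_gen_value _ assms])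
  fix x assume "x \<in> gen_letters m n"
  then show "homogeneous theta_wt (q_wt x) (gen_value m x)"
  proof (cases rule: gen_letters_cases)
    case (alpha i j)
    then show ?thesis using homogeneous_letter[of theta_wt "Alpha i j"] by simp
  next
    case (q N)
    then show ?thesis using homogeneous_q_elem by simp
  qed
qed

lemma relations_in_kernel:
  assumes "\<rho> \<in> supertorus_relations m n"
  shows "\<rho> \<in> carrier (gen_algebra m n)" "sc_subst (gen_value m) \<rho> = 0"
proof -
  have val: "sc_subst (gen_value m) (sc_letter x * sc_letter y) = gen_value m x * gen_value m y"
    "sc_letter x * sc_letter y \<in> carrier (gen_algebra m n)"
    if "x \<in> gen_letters m n" "y \<in> gen_letters m n" for x y
    using that sc_subst_letter_mult[OF respects_parity_gen_value that(1) free_supercomm_letter[OF that(2)]]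
      sc_subst_letter[OF respects_parity_gen_value that(2)]
    by (auto intro: free_supercomm_mult free_supercomm_letter)
  have additive: "Modules.additive (sc_subst (gen_value m))" by (simp add: Modules.additive_def sc_subst_add)
  from assms consider i N where "\<rho> = linear_relation i N" "i < m" "N \<in> msets n (Suc (Suc m))"
    | N1 N2 where "\<rho> = quadratic_relation N1 N2" "N1 \<in> msets n m" "N2 \<in> msets n (Suc (Suc m))"
    by (auto simp: supertorus_relations_def)
  then have "\<rho> \<in> carrier (gen_algebra m n) \<and> sc_subst (gen_value m) \<rho> = 0"
  proof cases
    case 1
    have in_letters: "GenAlpha i j \<in> gen_letters m n" "GenQ (N - {#j#}) \<in> gen_letters m n" if "j \<in># N" for j
      using 1 that msets_diff_single[OF 1(3) that] by (auto simp: gen_letters_def msets_def)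
    have "sc_subst (gen_value m) \<rho> = (\<Sum>j\<in>#N. alpha_elem i j * q_elem m (N - {#j#}))"
      unfolding 1(1) linear_relation_def additive_sum_mset[OF additive]
      by (intro sum_mset_cong) (simp add: val in_letters)
    then show ?thesis
      using linear_relation_holds[OF 1(2,3)]
      by (auto simp: 1(1) linear_relation_def intro!: free_supercomm_sum_mset val(2) in_letters)
  next
    case 2
    have in_letters: "GenQ (add_mset j N1) \<in> gen_letters m n" "GenQ (N2 - {#j#}) \<in> gen_letters m n" if "j \<in># N2" for j
      using 2 that msets_diff_single[OF 2(3) that] by (auto simp: gen_letters_def msets_def)
    have "sc_subst (gen_value m) \<rho> = (\<Sum>j\<in>#N2. q_elem m (add_mset j N1) * q_elem m (N2 - {#j#}))"
      unfolding 2(1) quadratic_relation_def additive_sum_mset[OF additive]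
      by (intro sum_mset_cong) (simp add: val in_letters)
    then show ?thesis
      using quadratic_relation_holds[OF 2(2,3)]
      by (auto simp: 2(1) quadratic_relation_def intro!: free_supercomm_sum_mset val(2) in_letters)
  qed
  then show "\<rho> \<in> carrier (gen_algebra m n)" "sc_subst (gen_value m) \<rho> = 0" by blast+
qed

lemma evaluation_kernel:
  assumes \<tau>: "\<tau> \<in> carrier_mat m m" "Determinant.det (map_mat Im \<tau>) \<noteq> 0"
  shows "a_kernel (gen_algebra m n) (H0 m n \<tau>) (\<lambda>x. constant_section m (sc_subst (gen_value m) x))
    = genideal (gen_algebra m n) (supertorus_relations m n)" (is "?K = ?I")
proof
  interpret P: ring "gen_algebra m n" by (rule ring_free_supercomm)
  have K: "?K = {x \<in> carrier (gen_algebra m n). sc_subst (gen_value m) x = 0}"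
    by (simp add: a_kernel_def' constant_section_inject)
  interpret hom: ring_hom_ring "gen_algebra m n" "H0 m n \<tau>" "\<lambda>x. constant_section m (sc_subst (gen_value m) x)"
    by (rule ring_hom_ringI2[OF P.ring_axioms ring_H0[OF \<tau>] evaluation_hom[OF \<tau>]])
  have rel: "supertorus_relations m n \<subseteq> ?K" using relations_in_kernel by (auto simp: K)
  show sub: "?I \<subseteq> ?K" by (rule P.genideal_minimal[OF hom.kernel_is_ideal rel])
  have rel_carrier: "supertorus_relations m n \<subseteq> carrier (gen_algebra m n)" using relations_in_kernel by blast
  interpret I: ideal ?I "gen_algebra m n" by (rule P.genideal_ideal[OF rel_carrier])
  have I_add: "f + g \<in> ?I" if "f \<in> ?I" "g \<in> ?I" for f g using I.a_closed[OF that] by simp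
  have I_mult: "f * g \<in> ?I" if "f \<in> ?I" "g \<in> carrier (gen_algebra m n)" for f g
    using I.I_r_closed[OF that] by simp
  have I_0: "0 \<in> ?I" using I.zero_closed by simp
  show "?K \<subseteq> ?I"
  proof
    fix x assume "x \<in> ?K"
    then have x: "x \<in> carrier (gen_algebra m n)" "sc_subst (gen_value m) x = 0" by (auto simp: K)
    \<comment> \<open>Homogeneity in the symbols confines the orthogonal projection to finitely many
      monomials, so the kernel is treated one degree at a time.\<close>
    have "graded_part q_wt d x \<in> ?I" for d
    proof (rule kernel_contained)
      show "?I \<subseteq> carrier (gen_algebra m n)" using I.a_subset by blast
      show "supertorus_relations m n \<subseteq> ?I" by (rule P.genideal_self[OF rel_carrier])
      show "sc_subst (gen_value m) y = 0" if "y \<in> ?I" for y using sub that by (auto simp: K)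
      show "sc_subst (gen_value m) (graded_part q_wt d x) = 0" by (simp add: evaluation_graded[OF x(1)] x(2))
    qed (use I_0 I_add I_mult x in \<open>auto intro: graded_part_carrier homogeneous_graded_part\<close>)
    then have "(\<Sum>k\<le>D. graded_part q_wt k x) \<in> ?I" for D
      by (induction D) (auto intro: I_add)
    then show "x \<in> ?I" using sum_graded_parts[of x q_wt] by metis
  qed
qed

theorem theorem1p3:
  fixes m n :: nat and \<tau> :: "complex mat"
  assumes "\<tau> \<in> carrier_mat m m"
    and "Determinant.det (map_mat Im \<tau>) \<noteq> 0"
  shows
    "generate_ring (H0 m n \<tau>)
       (constant_section m `
          (range sc_scalar \<union> {alpha_elem i j | i j. i < m \<and> j < n} \<union>
           {q_elem m N | N. N \<in> msets n (m + 1)}))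
     = carrier (H0 m n \<tau>)
     \<and> (\<forall>i<m. \<forall>N\<in>msets n (m + 2). (\<Sum>j\<in>#N. alpha_elem i j * q_elem m (N - {#j#})) = 0)
     \<and> (\<forall>N1\<in>msets n m. \<forall>N2\<in>msets n (m + 2).
          (\<Sum>j\<in>#N2. q_elem m (N1 + {#j#}) * q_elem m (N2 - {#j#})) = 0)
     \<and> (\<lambda>x. constant_section m (sc_subst (gen_value m) x))
          \<in> Ring.ring_hom (gen_algebra m n) (H0 m n \<tau>)
     \<and> a_kernel (gen_algebra m n) (H0 m n \<tau>)
          (\<lambda>x. constant_section m (sc_subst (gen_value m) x))
        = genideal (gen_algebra m n) (supertorus_relations m n)"
  using H0_generated[OF assms, of n] linear_relation_holds[of _ m _ n] quadratic_relation_holds[of _ n m]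
    evaluation_hom[OF assms, of n] evaluation_kernel[OF assms, of n]
  by simp

end
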